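(* For restricted-branching DPLL-Mono, the optimal tree size problem (OTS) can be reduced in polynomial time (many-one) to the optimal branching variable problem (OBV). Here, OTS is: given a CNF formula $F$, a set $B$ of variables and an integer $k$ in binary, decide whether $F$ has a DPLL-Mono search tree with branching restricted to $B$ of size at most $k$; OBV is: given a CNF formula $F$, a set $B$ of variables and a variable $x\in B$, decide whether $x$ is the root of some minimum-size DPLL-Mono search tree of $F$ with branching restricted to $B$.
   Context: A CNF formula is a finite set of clauses; the empty clause is unsatisfiable. For a partial assignment $I$ (set of literals), $F|I$ is obtained by deleting clauses containing a literal true under $I$ and deleting false literals from remaining clauses. $Var(F)$ is the set of variables of $F$. A binary tree is empty $()$ or a triple $(x~T_1~T_2)$; its size is its number of nodes. $U(F)$ denotes the result of exhaustive unit propagation on $F$. For a set $B$ of variables, a DPLL-Mono search tree (DMST) of $F$ with branching restricted to $B$ is: $()$ if $U(F)$ contains the empty clause; otherwise $(x~T_1~T_2)$ with $x \in B \cap Var(U(F))$, $T_1$ a DMST of $U(F|\{\neg x\})$ and $T_2$ a DMST of $U(F|\{x\})$ (branching restricted to $B$). *)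

theory Defs
  imports Main
begin

datatype lit = Pos nat | Neg nat

fun var :: "lit \<Rightarrow> nat" where
  "var (Pos v) = v" | "var (Neg v) = v"

fun neg :: "lit \<Rightarrow> lit" where
  "neg (Pos v) = Neg v" | "neg (Neg v) = Pos v"

type_synonym clause = "lit set"
type_synonym cnf = "clause set"

definition restrict :: "cnf \<Rightarrow> lit \<Rightarrow> cnf" where
  "restrict F l = {C - {neg l} | C. C \<in> F \<and> l \<notin> C}"

definition vars :: "cnf \<Rightarrow> nat set" where
  "vars F = var ` (\<Union>F)"

inductive up :: "cnf \<Rightarrow> cnf \<Rightarrow> bool" where
  up_empty: "{} \<in> F \<Longrightarrow> up F {{}}"
| up_unit: "{} \<notin> F \<Longrightarrow> {l} \<in> F \<Longrightarrow> up (restrict F l) G \<Longrightarrow> up F G"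
| up_done: "{} \<notin> F \<Longrightarrow> \<not> (\<exists>l. {l} \<in> F) \<Longrightarrow> up F F"

definition U :: "cnf \<Rightarrow> cnf" where
  "U F = (THE G. up F G)"

datatype btree = Leaf | Node nat btree btree

fun tsize :: "btree \<Rightarrow> nat" where
  "tsize Leaf = 0"
| "tsize (Node x T1 T2) = 1 + tsize T1 + tsize T2"

fun root :: "btree \<Rightarrow> nat option" where
  "root Leaf = None"
| "root (Node x T1 T2) = Some x"

inductive dmst :: "nat set \<Rightarrow> cnf \<Rightarrow> btree \<Rightarrow> bool" where
  dmst_leaf: "{} \<in> U F \<Longrightarrow> dmst B F Leaf"
| dmst_node: "{} \<notin> U F \<Longrightarrow> x \<in> B \<Longrightarrow> x \<in> vars (U F)
     \<Longrightarrow> dmst B (U (restrict F (Neg x))) T1 \<Longrightarrow> dmst B (U (restrict F (Pos x))) T2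
     \<Longrightarrow> dmst B F (Node x T1 T2)"

definition OTS :: "cnf \<Rightarrow> nat set \<Rightarrow> int \<Rightarrow> bool" where
  "OTS F B k \<longleftrightarrow> (\<exists>T. dmst B F T \<and> int (tsize T) \<le> k)"

definition OBV :: "cnf \<Rightarrow> nat set \<Rightarrow> nat \<Rightarrow> bool" where
  "OBV F B x \<longleftrightarrow> x \<in> B \<and>
     (\<exists>T. dmst B F T \<and> root T = Some x \<and> (\<forall>T'. dmst B F T' \<longrightarrow> tsize T \<le> tsize T'))"

text \<open>Symbols: 1 = bit 0, 2 = bit 1, 3 = positive sign, 4 = negative sign,
  5 = item terminator, 6 = list terminator.  Numbers in binary (LSB first).\<close>

fun enc_nat :: "nat \<Rightarrow> nat list" where
  "enc_nat n = (if n = 0 then [] else (if even n then 1 else 2) # enc_nat (n div 2))"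

fun enc_lit :: "lit \<Rightarrow> nat list" where
  "enc_lit (Pos v) = 3 # enc_nat v"
| "enc_lit (Neg v) = 4 # enc_nat v"

definition enc_clause :: "lit list \<Rightarrow> nat list" where
  "enc_clause C = concat (map enc_lit C) @ [5]"

definition enc_cnf :: "lit list list \<Rightarrow> nat list" where
  "enc_cnf F = concat (map enc_clause F) @ [6]"

definition enc_vars :: "nat list \<Rightarrow> nat list" where
  "enc_vars B = concat (map (\<lambda>v. enc_nat v @ [5]) B) @ [6]"

definition enc_int :: "int \<Rightarrow> nat list" where
  "enc_int k = (if k \<ge> 0 then 3 else 4) # enc_nat (nat \<bar>k\<bar>)"

definition cnf_of :: "lit list list \<Rightarrow> cnf" where
  "cnf_of F = set (map set F)"

definition OTS_lang :: "nat list set" where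
  "OTS_lang = {enc_cnf F @ enc_vars B @ enc_int k | F B k. OTS (cnf_of F) (set B) k}"

definition OBV_lang :: "nat list set" where
  "OBV_lang = {enc_cnf F @ enc_vars B @ enc_nat x | F B x. OBV (cnf_of F) (set B) x}"

definition input_alphabet :: "nat set" where
  "input_alphabet = {1..6}"

datatype dir = Lft | Rgt | Stay

text \<open>A machine is a transition function; states and symbols are naturals,
  0 is the start state, 1 the halting state, symbol 0 is the blank.
  A configuration is (state, reversed left part of tape, tape from head on).\<close>
type_synonym tm = "nat \<Rightarrow> nat \<Rightarrow> nat \<times> nat \<times> dir"
type_synonym config = "nat \<times> nat list \<times> nat list"

definition wf_tm :: "nat \<Rightarrow> nat \<Rightarrow> tm \<Rightarrow> bool" where
  "wf_tm Q S M \<longleftrightarrow> 2 \<le> Q \<and> 6 < S \<and>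
     (\<forall>q < Q. \<forall>a < S. fst (M q a) < Q \<and> fst (snd (M q a)) < S)"

fun step :: "tm \<Rightarrow> config \<Rightarrow> config" where
  "step M (q, ls, rs) =
    (if q = 1 then (q, ls, rs) else
      (let a = (case rs of [] \<Rightarrow> 0 | x # _ \<Rightarrow> x);
           (q', b, d) = M q a;
           rs' = b # tl rs
       in case d of
            Lft \<Rightarrow> (case ls of [] \<Rightarrow> (q', [], rs') | l # ls' \<Rightarrow> (q', ls', l # rs'))
          | Rgt \<Rightarrow> (q', b # ls, tl rs)
          | Stay \<Rightarrow> (q', ls, rs')))"

definition run :: "tm \<Rightarrow> nat \<Rightarrow> nat list \<Rightarrow> config" where
  "run M n w = (step M ^^ n) (0, [], w)"

definition tm_output :: "config \<Rightarrow> nat list" where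
  "tm_output c = takeWhile (\<lambda>a. a \<noteq> 0) (snd (snd c))"

definition poly_time_computable :: "(nat list \<Rightarrow> nat list) \<Rightarrow> bool" where
  "poly_time_computable f \<longleftrightarrow>
     (\<exists>Q S M c d. wf_tm Q S M \<and>
        (\<forall>w \<in> lists input_alphabet. \<exists>n. n \<le> c * length w ^ d + c \<and>
            fst (run M n w) = 1 \<and> tm_output (run M n w) = f w))"

definition poly_many_one_reducible :: "nat list set \<Rightarrow> nat list set \<Rightarrow> bool" where
  "poly_many_one_reducible L1 L2 \<longleftrightarrow>
     (\<exists>f. poly_time_computable f \<and> (\<forall>w \<in> lists input_alphabet. w \<in> L1 \<longleftrightarrow> f w \<in> L2))"

end

theory Submission
  imports Defs
begin

text \<open>
  Let \<open>F\<close>, \<open>B\<close>, \<open>k \<ge> 0\<close> be given. The new formula is the union of two parts sharing just one auxiliary variable.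
  In the first, every clause of \<open>F\<close> is weakened by two literals that become false only once the new
  variable \<open>x\<close> is set to true; setting \<open>x\<close> to false is a conflict at once. Refuting this part
  takes a tree of size at least one plus the optimum of \<open>F\<close>, which is attained with root \<open>x\<close>.
  The second part has optimal size exactly \<open>k + 1\<close>: it propagates to a conflict only when all
  bits of a number have been decided, and it forces a bit to \<open>0\<close> as soon as the number would exceed
  \<open>k\<close>; together with one extra branch this gives \<open>k + 2\<close> leaves. Hence \<open>x\<close> is an optimal root iff
  \<open>1 + opt F \<le> k + 1\<close>.

  The bit variables are named by the numbers \<open>k div 2 ^ i\<close>, whose encodings are the suffixes of
  the encoding of \<open>k\<close>, so a machine writes them by copying a part of its input.
\<close>

subsection \<open>Unit propagation as closed partial assignments\<close>

text \<open>A search tree may interleave decisions on both parts, so the lower bound has to cover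
  every mixed tree. It rests on a semantic test for conflicts by partial assignments, and on
  treating a child as the parent formula plus a unit clause, so that a node is described by its
  decisions. Picture the numbers from 0 to \<open>k\<close> and one further point
  \<open>k + 1\<close> for the extra branch. As long as two of these points fit the decisions, what
  they have in common gives an assignment that excludes a conflict in the second part, so a leaf can
  only be due to \<open>F\<close>, and this only after \<open>x\<close> has been set, which costs a
  node. Hence a tree either separates all \<open>k + 2\<close> points or yields a tree of
  \<open>F\<close> and a node for \<open>x\<close>.

  The auxiliary variables must not be decided, and the restricted branching set keeps them out.
  Pairs of clauses with \<open>Qv\<close> stand where a unit clause would do logically: a unit
  clause would be propagated at the start, and \<open>x\<close> could not be a root.\<close>

fun pol :: "lit \<Rightarrow> bool" where
  "pol (Pos v) = True" | "pol (Neg v) = False"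

type_synonym asg = "nat \<Rightarrow> bool option"

definition holds :: "asg \<Rightarrow> lit \<Rightarrow> bool" where
  "holds A l \<longleftrightarrow> A (var l) = Some (pol l)"

definition fails :: "asg \<Rightarrow> lit \<Rightarrow> bool" where
  "fails A l \<longleftrightarrow> A (var l) = Some (\<not> pol l)"

text \<open>No clause is false or unit under such an assignment. One exists iff unit propagation
  does not reach a conflict (lemma \<open>empty_in_U\<close>).\<close>
definition up_closed_clause :: "asg \<Rightarrow> clause \<Rightarrow> bool" where
  "up_closed_clause A C \<longleftrightarrow>
     (\<exists>l\<in>C. holds A l) \<or> (\<exists>l\<in>C. \<exists>m\<in>C. l \<noteq> m \<and> \<not> fails A l \<and> \<not> fails A m)"

definition up_closed :: "asg \<Rightarrow> cnf \<Rightarrow> bool" where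
  "up_closed A F \<longleftrightarrow> (\<forall>C\<in>F. up_closed_clause A C)"

definition up_consistent :: "cnf \<Rightarrow> bool" where
  "up_consistent F \<longleftrightarrow> (\<exists>A. up_closed A F)"

definition forced :: "cnf \<Rightarrow> lit \<Rightarrow> bool" where
  "forced F l \<longleftrightarrow> (\<forall>A. up_closed A F \<longrightarrow> holds A l)"

text \<open>Describes the outcome of exhaustive propagation without reference to the order of the
  unit steps; this is what makes \<open>U\<close>, a definite description, well defined.\<close>

definition residual :: "cnf \<Rightarrow> cnf" where
  "residual F = {{m \<in> C. \<not> forced F (neg m)} | C. C \<in> F \<and> (\<forall>m\<in>C. \<not> forced F m)}"

lemma neg_neg [simp]: "neg (neg l) = l" by (cases l) auto
lemma var_neg [simp]: "var (neg l) = var l" by (cases l) auto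
lemma var_eq_iff: "var l = var m \<longleftrightarrow> l = m \<or> l = neg m" by (cases l; cases m) auto
lemma pol_neg [simp]: "pol (neg l) = (\<not> pol l)" by (cases l) auto
lemma lit_eq_iff: "l = m \<longleftrightarrow> var l = var m \<and> pol l = pol m" by (cases l; cases m) auto

lemma holds_neg [simp]: "holds A (neg l) = fails A l" by (simp add: holds_def fails_def)
lemma fails_neg [simp]: "fails A (neg l) = holds A l" by (simp add: holds_def fails_def)
lemma not_holds_fails: "holds A l \<Longrightarrow> \<not> fails A l" by (simp add: holds_def fails_def)

lemma holds_upd [simp]: "holds (A(var l := Some (pol l))) m \<longleftrightarrow> m = l \<or> (m \<noteq> neg l \<and> holds A m)"
  by (cases l; cases m) (auto simp: holds_def)
lemma fails_upd [simp]: "fails (A(var l := Some (pol l))) m \<longleftrightarrow> m = neg l \<or> (m \<noteq> l \<and> fails A m)"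
  by (cases l; cases m) (auto simp: fails_def)

lemma up_closed_clause_unit [simp]: "up_closed_clause A {l} \<longleftrightarrow> holds A l"
  by (auto simp: up_closed_clause_def)

lemma up_closed_insert [simp]:
  "up_closed A (insert C F) \<longleftrightarrow> up_closed_clause A C \<and> up_closed A F"
  by (auto simp: up_closed_def)

lemma up_closed_unit: "up_closed A F \<Longrightarrow> {l} \<in> F \<Longrightarrow> holds A l"
  by (metis up_closed_def up_closed_clause_unit)

lemma up_closed_restrict:
  assumes "up_closed A F" "holds A l"
  shows "up_closed A (restrict F l)"
  unfolding up_closed_def
proof
  fix D assume "D \<in> restrict F l"
  then obtain C where C: "C \<in> F" "l \<notin> C" "D = C - {neg l}" by (auto simp: restrict_def)
  have "up_closed_clause A C" using assms C by (auto simp: up_closed_def)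
  moreover have "fails A (neg l)" "\<not> holds A (neg l)" using assms not_holds_fails by auto
  ultimately show "up_closed_clause A D" unfolding up_closed_clause_def C(3)
    by (metis Diff_iff singletonD)
qed

text \<open>\<open>restrict F l\<close> no longer constrains \<open>var l\<close>, so its value can
  be overwritten: the witnesses in a clause without \<open>l\<close> differ from
  \<open>neg l\<close> and survive the update.\<close>

lemma up_closed_restrict_upd:
  assumes "up_closed A (restrict F l)"
  shows "up_closed (A(var l := Some (pol l))) F"
  unfolding up_closed_def
proof
  fix C assume C: "C \<in> F"
  show "up_closed_clause (A(var l := Some (pol l))) C"
  proof (cases "l \<in> C")
    case True then show ?thesis by (auto simp: up_closed_clause_def)
  next
    case False
    then have "up_closed_clause A (C - {neg l})" using assms C
      by (auto simp: up_closed_def restrict_def)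
    then show ?thesis using False unfolding up_closed_clause_def holds_upd fails_upd
      by (metis Diff_iff singletonI)
  qed
qed

lemma vars_restrict: "var l \<notin> vars (restrict F l)"
  by (auto simp: vars_def restrict_def var_eq_iff)

lemma vars_restrict_subset: "vars (restrict F l) \<subseteq> vars F"
  by (auto simp: vars_def restrict_def)

lemma up_consistent_restrict:
  assumes "{l} \<in> F" shows "up_consistent (restrict F l) \<longleftrightarrow> up_consistent F"
  using assms up_closed_restrict up_closed_restrict_upd up_closed_unit
  unfolding up_consistent_def by metis

lemma forced_restrict:
  assumes "{l} \<in> F" "var m \<noteq> var l"
  shows "forced (restrict F l) m \<longleftrightarrow> forced F m"
proof
  assume f: "forced (restrict F l) m"
  then show "forced F m"
    using assms up_closed_restrict up_closed_unit unfolding forced_def by metis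
next
  assume f: "forced F m"
  show "forced (restrict F l) m" unfolding forced_def
  proof safe
    fix A assume "up_closed A (restrict F l)"
    then have "holds (A(var l := Some (pol l))) m"
      using f up_closed_restrict_upd unfolding forced_def by blast
    then show "holds A m" using assms(2) by auto
  qed
qed

lemma not_forced_both: "up_consistent F \<Longrightarrow> forced F l \<Longrightarrow> \<not> forced F (neg l)"
  unfolding up_consistent_def forced_def using not_holds_fails by auto

text \<open>Since \<open>l\<close> is forced, a unit step on it only anticipates deletions that
  \<open>residual\<close> makes anyway, and other literals keep their status by
  \<open>forced_restrict\<close>. In an inconsistent formula \<open>neg l\<close> would be forced as
  well.\<close>

lemma residual_restrict:
  assumes l: "{l} \<in> F" and c: "up_consistent F"
  shows "residual (restrict F l) = residual F"
proof -
  have fl: "forced F l" using l up_closed_unit unfolding forced_def by blast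
  have nfl: "\<not> forced F (neg l)" using not_forced_both[OF c fl] .
  have key: "forced (restrict F l) m = forced F m" "forced (restrict F l) (neg m) = forced F (neg m)"
    if "C \<in> F" "l \<notin> C" "m \<in> C - {neg l}" for C m
    using that forced_restrict[OF l, of m] forced_restrict[OF l, of "neg m"]
    by (metis DiffE insertCI var_eq_iff var_neg)+
  have "D \<in> residual (restrict F l) \<longleftrightarrow> D \<in> residual F" for D
  proof
    assume "D \<in> residual (restrict F l)"
    then obtain C where C: "C \<in> F" "l \<notin> C" "\<forall>m\<in>C-{neg l}. \<not> forced (restrict F l) m"
      "D = {m\<in>C-{neg l}. \<not> forced (restrict F l) (neg m)}"
      unfolding residual_def restrict_def by blast
    have "forced (restrict F l) (neg m) = forced F (neg m) \<and> m \<noteq> neg l"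
      if "m \<in> C" "\<not> forced F (neg m) \<or> m \<noteq> neg l" for m
      using key(2)[OF C(1,2), of m] that fl by (cases "m = neg l") auto
    then have "D = {m\<in>C. \<not> forced F (neg m)}" using C(4) by blast
    moreover have "\<forall>m\<in>C. \<not> forced F m" using C key[OF C(1,2)] nfl by blast
    ultimately show "D \<in> residual F" using C(1) unfolding residual_def by blast
  next
    assume "D \<in> residual F"
    then obtain C where C: "C \<in> F" "\<forall>m\<in>C. \<not> forced F m" "D = {m\<in>C. \<not> forced F (neg m)}"
      unfolding residual_def by blast
    have lC: "l \<notin> C" using C fl by auto
    have "forced (restrict F l) (neg m) = forced F (neg m) \<and> m \<noteq> neg l"
      if "m \<in> C" "\<not> forced F (neg m) \<or> m \<noteq> neg l" for m
      using key(2)[OF C(1) lC, of m] that fl by (cases "m = neg l") auto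
    then have "D = {m\<in>C-{neg l}. \<not> forced (restrict F l) (neg m)}" using C(3) by blast
    moreover have "\<forall>m\<in>C-{neg l}. \<not> forced (restrict F l) m" using C key[OF C(1) lC] by auto
    moreover have "C - {neg l} \<in> restrict F l" using C lC by (auto simp: restrict_def)
    ultimately show "D \<in> residual (restrict F l)" unfolding residual_def by blast
  qed
  then show ?thesis by blast
qed

lemma up_closed_empty_asg:
  assumes "{} \<notin> F" "\<not> (\<exists>l. {l} \<in> F)"
  shows "up_closed (\<lambda>_. None) F"
  unfolding up_closed_def up_closed_clause_def
proof (intro ballI disjI2)
  fix C assume C: "C \<in> F"
  then obtain l where "l \<in> C" using assms by (metis ex_in_conv)
  moreover then obtain m where "m \<in> C" "m \<noteq> l" using assms C
    by (metis is_singletonI' is_singleton_def)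
  ultimately show "\<exists>l\<in>C. \<exists>m\<in>C. l \<noteq> m \<and> \<not> fails (\<lambda>_. None) l \<and> \<not> fails (\<lambda>_. None) m"
    by (metis fails_def option.distinct(1))
qed

text \<open>Consistency and \<open>residual\<close> are invariant under unit steps; in a normal form
  the empty assignment is closed, so nothing is forced and \<open>residual F = F\<close>.\<close>

lemma up_normal_form:
  assumes "up F G"
  shows "G = (if up_consistent F then residual F else {{}})"
  using assms
proof induction
  case (up_empty F)
  then show ?case by (auto simp: up_consistent_def up_closed_def up_closed_clause_def)
next
  case (up_unit F l G)
  then show ?case using up_consistent_restrict residual_restrict by metis
next
  case (up_done F)
  then have c: "up_closed (\<lambda>_. None) F" by (rule up_closed_empty_asg)
  then have nf: "\<not> forced F l" for l unfolding forced_def holds_def by force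
  have "residual F = F" unfolding residual_def using nf by auto
  then show ?case using c unfolding up_consistent_def by auto
qed

definition finite_cnf :: "cnf \<Rightarrow> bool" where
  "finite_cnf F \<longleftrightarrow> finite (vars F)"

lemma finite_cnf_restrict: "finite_cnf F \<Longrightarrow> finite_cnf (restrict F l)"
  unfolding finite_cnf_def using vars_restrict_subset finite_subset by blast

lemma up_exists:
  assumes "finite_cnf F" shows "\<exists>G. up F G"
proof -
  have "finite (vars F)" using assms by (simp add: finite_cnf_def)
  then show ?thesis
  proof (induction "vars F" arbitrary: F rule: finite_psubset_induct)
    case (psubset F)
    consider "{} \<in> F" | l where "{} \<notin> F" "{l} \<in> F" | "{} \<notin> F" "\<not> (\<exists>l. {l} \<in> F)" by blast
    then show ?case
    proof cases
      case 1 then show ?thesis using up_empty by blast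
    next
      case 2
      then have "var l \<in> vars F" by (force simp: vars_def)
      then have "vars (restrict F l) \<subset> vars F"
        using vars_restrict vars_restrict_subset by blast
      then show ?thesis using psubset(2) 2 up_unit by blast
    next
      case 3 then show ?thesis using up_done by blast
    qed
  qed
qed

lemma U_eqI: "up F G \<Longrightarrow> U F = G"
  unfolding U_def by (rule the_equality) (simp, metis up_normal_form)

lemma up_U: "finite_cnf F \<Longrightarrow> up F (U F)"
  using up_exists U_eqI by metis

lemma U_eq: "finite_cnf F \<Longrightarrow> U F = (if up_consistent F then residual F else {{}})"
  using up_U up_normal_form by blast

lemma up_result: "up F G \<Longrightarrow> G = {{}} \<or> ({} \<notin> G \<and> \<not> (\<exists>l. {l} \<in> G))"
  by (induction rule: up.induct) auto

lemma up_vars: "up F G \<Longrightarrow> vars G \<subseteq> vars F"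
proof (induction rule: up.induct)
  case (up_unit F l G) then show ?case using vars_restrict_subset by blast
qed (auto simp: vars_def)

lemma finite_cnf_U: "finite_cnf F \<Longrightarrow> finite_cnf (U F)"
  by (metis finite_cnf_def finite_subset up_U up_vars)

lemma U_U: "finite_cnf F \<Longrightarrow> U (U F) = U F"
  using up_result[OF up_U] up_done up_empty U_eqI by (metis insertI1)

lemma finite_cnf_insert [simp]: "finite_cnf (insert {l} F) = finite_cnf F"
  by (simp add: finite_cnf_def vars_def)

lemma restrict_insert [simp]: "restrict (insert {l} F) l = restrict F l"
  by (auto simp: restrict_def)

text \<open>Propagating the added unit clause first gives the restriction. Thanks to this a node of
  a tree becomes the original formula plus its decided literals.\<close>

lemma U_restrict: "finite_cnf F \<Longrightarrow> U (restrict F l) = U (insert {l} F)"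
proof -
  assume f: "finite_cnf F"
  show ?thesis
  proof (cases "{} \<in> F")
    case True
    then have "{} \<in> restrict F l" by (auto simp: restrict_def)
    then show ?thesis using True U_eqI up_empty by (metis insertI2)
  next
    case False
    then have "up (insert {l} F) (U (restrict F l))"
      using up_unit[of "insert {l} F" l] up_U[OF finite_cnf_restrict[OF f]] by auto
    then show ?thesis using U_eqI by metis
  qed
qed

lemma empty_in_U: "finite_cnf F \<Longrightarrow> {} \<in> U F \<longleftrightarrow> \<not> up_consistent F"
proof -
  assume f: "finite_cnf F"
  { assume c: "up_consistent F" and e: "{} \<in> U F"
    then obtain C where C: "C \<in> F" "\<forall>m\<in>C. \<not> forced F m" "{} = {m\<in>C. \<not> forced F (neg m)}"
      using U_eq[OF f] unfolding residual_def by auto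
    obtain A where A: "up_closed A F" using c up_consistent_def by blast
    have "\<forall>m\<in>C. fails A m" using C(3) A by (auto simp: forced_def)
    then have False using A C(1) unfolding up_closed_def up_closed_clause_def
      by (meson not_holds_fails) }
  then show ?thesis using U_eq[OF f] by (metis insertI1)
qed

lemma vars_U_not_forced:
  assumes "finite_cnf F" "up_consistent F" "var l \<in> vars (U F)"
  shows "\<not> forced F l" "\<not> forced F (neg l)"
proof -
  obtain C m where C: "\<forall>m\<in>C. \<not> forced F m" "m \<in> C" "\<not> forced F (neg m)" "var m = var l"
    using assms unfolding U_eq[OF assms(1)] residual_def vars_def by force
  then show "\<not> forced F l" "\<not> forced F (neg l)" using var_eq_iff[of m l] by auto
qed

text \<open>A decision on an unforced variable may come before or after propagation: each propagated
  literal \<open>u\<close> is forced, so it has another variable than \<open>l\<close>, and adding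
  \<open>{l}\<close> commutes with restricting by \<open>u\<close>.\<close>

lemma U_insert_up:
  assumes "up F G" "finite_cnf F" "up_consistent F" "\<not> forced F l" "\<not> forced F (neg l)"
  shows "U (insert {l} G) = U (insert {l} F)"
  using assms
proof (induction rule: up.induct)
  case (up_empty F)
  then show ?case by (auto simp: up_consistent_def up_closed_def up_closed_clause_def)
next
  case (up_unit F u G)
  have fu: "forced F u" unfolding forced_def using up_closed_unit[OF _ up_unit.hyps(2)] by blast
  have vu: "var l \<noteq> var u"
    using fu up_unit.prems(3,4) var_eq_iff[of u l] by metis
  have "\<not> forced (restrict F u) l" "\<not> forced (restrict F u) (neg l)"
    using forced_restrict[OF up_unit.hyps(2), of l] forced_restrict[OF up_unit.hyps(2), of "neg l"]
      vu up_unit.prems(3,4) by simp_all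
  then have "U (insert {l} G) = U (insert {l} (restrict F u))"
    using up_unit.IH finite_cnf_restrict[OF up_unit.prems(1)]
      up_consistent_restrict[OF up_unit.hyps(2)] up_unit.prems(2) by simp
  also have "insert {l} (restrict F u) = restrict (insert {l} F) u"
  proof -
    have "u \<noteq> l" "{l} - {neg u} = {l}" using vu by auto
    then show ?thesis unfolding restrict_def by (intro equalityI subsetI) fastforce+
  qed
  also have "U \<dots> = U (insert {l} F)"
  proof -
    have "up (restrict (insert {l} F) u) (U (restrict (insert {l} F) u))"
      using up_U finite_cnf_restrict up_unit.prems(1) by simp
    then have "up (insert {l} F) (U (restrict (insert {l} F) u))"
      by (rule up.up_unit[rotated 2]) (use up_unit.hyps in auto)
    then show ?thesis using U_eqI by simp
  qed
  finally show ?case .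
next
  case (up_done F) then show ?case by simp
qed

lemma U_insert_U:
  assumes "finite_cnf F" "up_consistent F" "\<not> forced F l" "\<not> forced F (neg l)"
  shows "U (insert {l} (U F)) = U (insert {l} F)"
  using U_insert_up up_U assms by blast

section \<open>Search trees with decisions as unit clauses\<close>

lemma dmst_U: "finite_cnf F \<Longrightarrow> dmst B (U F) T \<longleftrightarrow> dmst B F T"
proof -
  assume f: "finite_cnf F"
  have fU: "finite_cnf (U F)" using f by (rule finite_cnf_U)
  have r: "U (restrict (U F) l) = U (restrict F l)" if "{} \<notin> U F" "var l \<in> vars (U F)" for l
    using that U_insert_U[OF f] vars_U_not_forced[OF f] empty_in_U[OF f]
      U_restrict[OF f] U_restrict[OF fU] by metis
  have "{} \<notin> U F \<Longrightarrow> x \<in> vars (U F) \<Longrightarrow> U (restrict (U F) (Pos x)) = U (restrict F (Pos x)) \<and>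
      U (restrict (U F) (Neg x)) = U (restrict F (Neg x))" for x
    using r[of "Pos x"] r[of "Neg x"] by simp
  then show ?thesis
    using U_U[OF f] dmst.simps[of B "U F" T] dmst.simps[of B F T] by auto
qed

lemma dmst_cong: "finite_cnf F \<Longrightarrow> finite_cnf G \<Longrightarrow> U F = U G \<Longrightarrow> dmst B F T \<longleftrightarrow> dmst B G T"
  using dmst_U by metis

lemma dmst_Leaf: "finite_cnf F \<Longrightarrow> dmst B F Leaf \<longleftrightarrow> \<not> up_consistent F"
  by (subst dmst.simps) (simp add: empty_in_U)

text \<open>The form of the node rule used from here on: the children carry no \<open>U\<close> and
  are named by one more decision.\<close>

lemma dmst_Node:
  "finite_cnf F \<Longrightarrow> dmst B F (Node x T1 T2) \<longleftrightarrow>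
     up_consistent F \<and> x \<in> B \<and> x \<in> vars (U F) \<and>
     dmst B (insert {Neg x} F) T1 \<and> dmst B (insert {Pos x} F) T2"
  by (subst dmst.simps) (simp add: empty_in_U U_restrict dmst_U)

definition active :: "cnf \<Rightarrow> asg \<Rightarrow> nat \<Rightarrow> bool" where
  "active F A x \<longleftrightarrow> A x = None \<and> (\<exists>C\<in>F. x \<in> var ` C \<and> (\<forall>l\<in>C. \<not> holds A l))"

text \<open>Every closed assignment makes all forced literals true, so whatever a single one leaves
  open is left open by propagation.\<close>

lemma vars_UI:
  assumes "finite_cnf F" "up_closed A F" "active F A x"
  shows "x \<in> vars (U F)"
proof -
  obtain C l where C: "C \<in> F" "l \<in> C" "x = var l" "A x = None" "\<forall>l\<in>C. \<not> holds A l"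
    using assms unfolding active_def by auto
  have "\<forall>m\<in>C. \<not> forced F m" using C assms(2) unfolding forced_def by blast
  moreover have "\<not> forced F (neg l)" using C assms(2) unfolding forced_def by (metis holds_def option.distinct(1) var_neg)
  ultimately have "x \<in> vars (residual F)" unfolding vars_def residual_def using C
    by (auto intro!: imageI)
  moreover have "up_consistent F" using assms up_consistent_def by blast
  ultimately show ?thesis using U_eq[OF assms(1)] by simp
qed

definition least_asg :: "cnf \<Rightarrow> asg" where
  "least_asg F x = (if forced F (Pos x) then Some True else if forced F (Neg x) then Some False else None)"

lemma holds_least_asg: "up_consistent F \<Longrightarrow> holds (least_asg F) l \<longleftrightarrow> forced F l"
  using not_forced_both[of F "Pos _"] by (cases l) (auto simp: holds_def least_asg_def)

lemma fails_least_asg: "up_consistent F \<Longrightarrow> fails (least_asg F) l \<longleftrightarrow> forced F (neg l)"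
  using holds_least_asg[of F "neg l"] by simp

text \<open>If all literals but one of a clause are forced false, the remaining one is true in every
  closed assignment, hence forced; so the forced literals alone already form a closed
  assignment.\<close>

lemma up_closed_least_asg:
  assumes c: "up_consistent F" shows "up_closed (least_asg F) F"
  unfolding up_closed_def
proof
  fix C assume C: "C \<in> F"
  show "up_closed_clause (least_asg F) C"
  proof (rule ccontr)
    assume n: "\<not> up_closed_clause (least_asg F) C"
    obtain A where A: "up_closed A F" using c up_consistent_def by blast
    have 1: "\<forall>l\<in>C. \<not> forced F l" using n holds_least_asg[OF c] by (auto simp: up_closed_clause_def)
    have 2: "\<forall>l\<in>C. \<forall>m\<in>C. l \<noteq> m \<longrightarrow> forced F (neg l) \<or> forced F (neg m)"
      using n fails_least_asg[OF c] by (auto simp: up_closed_clause_def)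
    have "\<exists>l\<in>C. \<not> forced F (neg l)"
      using A C unfolding up_closed_def up_closed_clause_def forced_def
      by (metis holds_neg not_holds_fails)
    then obtain l where l: "l \<in> C" "\<not> forced F (neg l)" by blast
    have 3: "forced F (neg m)" if "m \<in> C" "m \<noteq> l" for m using 2 l that by blast
    have "holds A' l" if A': "up_closed A' F" for A'
    proof -
      have "fails A' m" if "m \<in> C" "m \<noteq> l" for m
        using 3[OF that] A' unfolding forced_def by auto
      moreover have "up_closed_clause A' C" using A' C by (auto simp: up_closed_def)
      ultimately show ?thesis unfolding up_closed_clause_def by (metis not_holds_fails)
    qed
    then show False using 1 l(1) unfolding forced_def by blast
  qed
qed

lemma active_least_asg:
  assumes f: "finite_cnf F" and c: "up_consistent F" and x: "x \<in> vars (U F)"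
  shows "active F (least_asg F) x"
proof -
  obtain C m where C: "C \<in> F" "\<forall>m\<in>C. \<not> forced F m" "m \<in> C" "\<not> forced F (neg m)" "x = var m"
    using x c unfolding U_eq[OF f] residual_def vars_def by auto
  have "\<not> forced F (Pos x)" "\<not> forced F (Neg x)" using C by (cases m; auto)+
  then show ?thesis unfolding active_def using C holds_least_asg[OF c] by (auto simp: least_asg_def)
qed

lemma U_insert_forced:
  assumes f: "finite_cnf F" and l: "forced F l" shows "U (insert {l} F) = U F"
proof -
  have u: "up_closed A (insert {l} F) = up_closed A F" for A using l unfolding forced_def by auto
  then have fo: "forced (insert {l} F) m = forced F m" for m unfolding forced_def by auto
  have "residual (insert {l} F) = residual F" unfolding residual_def fo using l by auto
  moreover have "up_consistent (insert {l} F) = up_consistent F" unfolding up_consistent_def u ..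
  ultimately show ?thesis using U_eq f by simp
qed

text \<open>\<open>v\<close> need not occur in \<open>U F\<close>; in that case one of the two subtrees already serves for \<open>F\<close>.\<close>
lemma dmst_merge:
  assumes f: "finite_cnf F" and v: "v \<in> B"
    and T1: "dmst B (insert {Neg v} F) T1" and T2: "dmst B (insert {Pos v} F) T2"
  shows "\<exists>T. dmst B F T \<and> tsize T \<le> 1 + tsize T1 + tsize T2"
proof -
  consider "\<not> up_consistent F" | "up_consistent F" "v \<in> vars (U F)"
    | "forced F (Neg v)" | "forced F (Pos v)"
    | "up_consistent F" "v \<notin> vars (U F)" "\<not> forced F (Neg v)" "\<not> forced F (Pos v)" by blast
  then show ?thesis
  proof cases
    case 1 then show ?thesis using dmst_Leaf[OF f] by (metis tsize.simps(1) zero_le)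
  next
    case 2
    then have "dmst B F (Node v T1 T2)" using dmst_Node[OF f] v T1 T2 by blast
    then show ?thesis by fastforce
  next
    case 3
    then have "dmst B F T1" using T1 dmst_cong f U_insert_forced by (metis finite_cnf_insert)
    then show ?thesis by (metis trans_le_add1 trans_le_add2 le_refl)
  next
    case 4
    then have "dmst B F T2" using T2 dmst_cong f U_insert_forced by (metis finite_cnf_insert)
    then show ?thesis by (metis trans_le_add2 le_refl)
  next
    case 5
    have "U (insert {Neg v} F) = U (insert {Neg v} (U F))" using 5 U_insert_U[OF f] by (metis neg.simps(2))
    also have "\<dots> = U (restrict (U F) (Neg v))" using U_restrict finite_cnf_U f by metis
    also have "restrict (U F) (Neg v) = U F"
    proof -
      have "Neg v \<notin> C \<and> Pos v \<notin> C" if "C \<in> U F" for C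
        using 5(2) that unfolding vars_def by (metis UnionI imageI var.simps)
      then show ?thesis unfolding restrict_def by (auto; metis Diff_empty Diff_insert0)
    qed
    finally have "U (insert {Neg v} F) = U F" using U_U f by simp
    then have "dmst B F T1" using T1 dmst_cong f by (metis finite_cnf_insert)
    then show ?thesis by (metis trans_le_add1 trans_le_add2 le_refl)
  qed
qed

subsection \<open>The reduction\<close>

text \<open>With \<open>m = k div 2 ^ i\<close>: \<open>Yv m\<close> is bit \<open>i\<close> of the number, \<open>Dv m\<close> says that all bits from
  position \<open>i\<close> on are decided, \<open>Ev m\<close> that they agree with those of \<open>k\<close>. \<open>Xv\<close> is the guard of \<open>F\<close>
  (through \<open>X1v\<close> and \<open>X2v\<close>), \<open>Zv\<close> the extra branch, \<open>Qv\<close> closes all conflicts. The residues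
  modulo 16 keep the families apart.\<close>
definition Fv :: "nat \<Rightarrow> nat" where "Fv v = 2 * v + 1"
definition Dv :: "nat \<Rightarrow> nat" where "Dv m = 4 * m + 2"
definition Ev :: "nat \<Rightarrow> nat" where "Ev m = 8 * m + 4"
definition Yv :: "nat \<Rightarrow> nat" where "Yv m = 16 * m + 8"
definition Xv :: nat where "Xv = 16"
definition Zv :: nat where "Zv = 32"
definition X1v :: nat where "X1v = 48"
definition X2v :: nat where "X2v = 64"
definition Qv :: nat where "Qv = 80"

lemmas gadget_var_defs = Fv_def Dv_def Ev_def Yv_def Xv_def Zv_def X1v_def X2v_def Qv_def

fun ren :: "lit \<Rightarrow> lit" where
  "ren (Pos v) = Pos (Fv v)" | "ren (Neg v) = Neg (Fv v)"

text \<open>With \<open>Neg Xv\<close> as the only guard, a falsified clause would propagate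
  \<open>Xv\<close> to false and so reach a conflict without a branch on \<open>Xv\<close>. Two
  guard literals leave a binary clause, which propagates nothing.\<close>

definition guard :: "lit list \<Rightarrow> lit list" where
  "guard C = map ren C @ [Neg X1v, Neg X2v]"

text \<open>Logically the first two clauses amount to \<open>Dv m\<close> implying
  \<open>Dv a\<close>, but unit propagation sees this only once \<open>Yv a\<close> has a value. The
  others carry agreement with \<open>k\<close> downwards; where \<open>k\<close> has digit 0,
  agreement above sets \<open>Yv a\<close> to false and persists at once.\<close>

definition digit_clauses :: "nat \<Rightarrow> lit list list" where
  "digit_clauses a = (let m = a div 2 in
     [[Neg (Dv m), Neg (Yv a), Pos (Dv a)], [Neg (Dv m), Pos (Yv a), Pos (Dv a)]] @
     (if odd a then [[Neg (Ev m), Neg (Yv a), Pos (Ev a)]]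
      else [[Neg (Ev m), Neg (Yv a)], [Neg (Ev m), Pos (Ev a)]]))"

fun count_clauses :: "nat \<Rightarrow> lit list list" where
  "count_clauses k = (if k = 0 then [] else digit_clauses k @ count_clauses (k div 2))"

fun digit_vars :: "nat \<Rightarrow> nat list" where
  "digit_vars k = (if k = 0 then [] else Yv k # digit_vars (k div 2))"

declare count_clauses.simps [simp del] digit_vars.simps [simp del]

text \<open>A pair with \<open>Qv\<close> turns \<open>Dv k\<close> into a conflict once it is
  derived, but propagates nothing before that. The same device refutes \<open>Neg Xv\<close> and
  \<open>Pos Zv\<close> in \<open>gate_clauses\<close>.\<close>

definition conflict_clauses :: "nat \<Rightarrow> lit list list" where
  "conflict_clauses k = [[Pos Qv, Neg (Dv k)], [Neg Qv, Neg (Dv k)]]"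

definition gate_clauses :: "lit list list" where
  "gate_clauses =
     [[Neg Xv, Pos X1v], [Neg Xv, Pos X2v], [Pos Xv, Pos Qv], [Pos Xv, Neg Qv],
      [Neg Zv, Pos Qv], [Neg Zv, Neg Qv], [Pos Zv, Pos (Dv 0)], [Pos Zv, Pos (Ev 0)]]"

definition target_cnf :: "lit list list \<Rightarrow> nat \<Rightarrow> lit list list" where
  "target_cnf F k = map guard F @ conflict_clauses k @ count_clauses k @ gate_clauses"

text \<open>Here the restriction of branching is exploited: a decision on \<open>Qv\<close>, for
  instance, would propagate \<open>Pos Xv\<close> and \<open>Neg Zv\<close> whichever value it
  takes.\<close>

definition target_vars :: "nat list \<Rightarrow> nat \<Rightarrow> nat list" where
  "target_vars B k = map Fv B @ digit_vars k @ [Xv, Zv]"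

lemma var_ren [simp]: "var (ren l) = Fv (var l)" by (cases l) auto
lemma pol_ren [simp]: "pol (ren l) = pol l" by (cases l) auto
lemma inj_Fv: "Fv v = Fv w \<longleftrightarrow> v = w" by (auto simp: Fv_def)
lemma inj_ren: "ren l = ren m \<longleftrightarrow> l = m" by (auto simp: lit_eq_iff inj_Fv)

lemma div_pow_Suc: "k div 2 ^ Suc i = k div 2 ^ i div (2::nat)"
  by (metis div_exp_eq plus_1_eq_Suc power_one_right add.commute)

lemma in_count_clauses:
  "C \<in> set (count_clauses k) \<longleftrightarrow> (\<exists>i. k div 2 ^ i > 0 \<and> C \<in> set (digit_clauses (k div 2 ^ i)))"
proof (induction k rule: count_clauses.induct)
  case (1 k)
  show ?case
  proof (cases "k = 0")
    case True then show ?thesis by (simp add: count_clauses.simps)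
  next
    case False
    have "(\<exists>i. k div 2 ^ i > 0 \<and> C \<in> set (digit_clauses (k div 2 ^ i))) \<longleftrightarrow>
      C \<in> set (digit_clauses k) \<or>
      (\<exists>i. k div 2 div 2 ^ i > 0 \<and> C \<in> set (digit_clauses (k div 2 div 2 ^ i)))" (is "?L \<longleftrightarrow> ?R")
    proof
      assume ?L
      then obtain i where "k div 2 ^ i > 0 \<and> C \<in> set (digit_clauses (k div 2 ^ i))" by blast
      then show ?R by (cases i) (auto simp: div_mult2_eq)
    next
      assume ?R
      then show ?L
      proof
        assume "C \<in> set (digit_clauses k)"
        then show ?L using False by (intro exI[of _ 0]) simp
      next
        assume "\<exists>i. k div 2 div 2 ^ i > 0 \<and> C \<in> set (digit_clauses (k div 2 div 2 ^ i))"
        then show ?L by (metis div_mult2_eq power_Suc)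
      qed
    qed
    then show ?thesis using 1 False by (subst count_clauses.simps) simp
  qed
qed

lemma in_digit_vars: "v \<in> set (digit_vars k) \<longleftrightarrow> (\<exists>i. k div 2 ^ i > 0 \<and> v = Yv (k div 2 ^ i))"
proof (induction k rule: digit_vars.induct)
  case (1 k)
  show ?case
  proof (cases "k = 0")
    case True then show ?thesis by (simp add: digit_vars.simps)
  next
    case False
    have "(\<exists>i. k div 2 ^ i > 0 \<and> v = Yv (k div 2 ^ i)) \<longleftrightarrow>
      v = Yv k \<or> (\<exists>i. k div 2 div 2 ^ i > 0 \<and> v = Yv (k div 2 div 2 ^ i))" (is "?L \<longleftrightarrow> ?R")
    proof
      assume ?L
      then obtain i where "k div 2 ^ i > 0 \<and> v = Yv (k div 2 ^ i)" by blast
      then show ?R by (cases i) (auto simp: div_mult2_eq)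
    next
      assume ?R
      then show ?L
      proof
        assume "v = Yv k"
        then show ?L using False by (intro exI[of _ 0]) simp
      next
        assume "\<exists>i. k div 2 div 2 ^ i > 0 \<and> v = Yv (k div 2 div 2 ^ i)"
        then show ?L by (metis div_mult2_eq power_Suc)
      qed
    qed
    then show ?thesis using 1 False by (subst digit_vars.simps) simp
  qed
qed

text \<open>Halving strictly decreases a positive number, so a digit position can be recovered from
  its name \<open>k div 2 ^ i\<close>.\<close>

lemma div_pow_inj:
  fixes k :: nat
  assumes "k div 2 ^ i = k div 2 ^ j" "k div 2 ^ i > 0" shows "i = j"
proof (rule ccontr)
  have *: False if "k div 2 ^ i = k div 2 ^ j" "k div 2 ^ i > 0" "i < j" for i j
  proof -
    have "k div 2 ^ j = k div 2 ^ i div 2 ^ (j - i)"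
      using that(3) by (metis div_mult2_eq le_add_diff_inverse less_imp_le power_add)
    also have "\<dots> < k div 2 ^ i" using that(2,3)
      by (intro div_less_dividend) (auto intro: one_less_power[of "2::nat", simplified])
    finally show False using that by simp
  qed
  assume "i \<noteq> j"
  then show False using *[of i j] *[of j i] assms by (cases "i < j") auto
qed

section \<open>Points, and what propagation knows while two of them remain\<close>

definition agree :: "bool \<Rightarrow> bool \<Rightarrow> bool option" where
  "agree a b = (if a = b then Some a else None)"

text \<open>The point \<open>k + 1\<close> stands for the branch where \<open>Zv\<close> is true;
  the conjunct \<open>p \<le> k\<close> gives it only zero digits. The argument is a digit name, not
  a position, because names are what the variables carry.\<close>

definition bit_of :: "nat \<Rightarrow> nat \<Rightarrow> nat \<Rightarrow> bool" where
  "bit_of k p m \<longleftrightarrow> p \<le> k \<and> (\<exists>i. m = k div 2 ^ i \<and> odd (p div 2 ^ i))"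

definition tight :: "nat \<Rightarrow> nat \<Rightarrow> nat \<Rightarrow> bool" where
  "tight k p m \<longleftrightarrow> p \<le> k \<and> (\<exists>i. m = k div 2 ^ i \<and> m = p div 2 ^ i)"

definition same_prefix :: "nat \<Rightarrow> nat \<Rightarrow> nat \<Rightarrow> nat \<Rightarrow> bool" where
  "same_prefix k p q m \<longleftrightarrow> p \<le> k \<and> q \<le> k \<and> (\<exists>i. m = k div 2 ^ i \<and> p div 2 ^ i = q div 2 ^ i)"

lemma div_pow_zero_le: "p \<le> (k::nat) \<Longrightarrow> k div 2 ^ i = 0 \<Longrightarrow> p div 2 ^ i = 0"
  by (metis div_le_mono le_zero_eq)

lemma bit_of_iff: "k div 2 ^ i > 0 \<Longrightarrow> bit_of k p (k div 2 ^ i) \<longleftrightarrow> p \<le> k \<and> odd (p div 2 ^ i)"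
  unfolding bit_of_def using div_pow_inj by metis

text \<open>All positions above the top digit share the name 0; there both quotients are 0 because
  \<open>p \<le> k\<close>, so the choice of the position does not matter.\<close>

lemma tight_iff: "tight k p (k div 2 ^ i) \<longleftrightarrow> p \<le> k \<and> p div 2 ^ i = k div 2 ^ i"
  unfolding tight_def using div_pow_inj div_pow_zero_le by (metis gr0I)

lemma same_prefix_iff: "same_prefix k p q (k div 2 ^ i) \<longleftrightarrow> p \<le> k \<and> q \<le> k \<and> p div 2 ^ i = q div 2 ^ i"
  unfolding same_prefix_def using div_pow_inj div_pow_zero_le by (metis gr0I)

definition point_val :: "nat \<Rightarrow> nat \<Rightarrow> nat \<Rightarrow> bool" where
  "point_val k p v = (if v = Zv then p > k else bit_of k p (v div 16))"

text \<open>What unit propagation may know while two points \<open>p\<close> and \<open>q\<close> are both still possible.\<close>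
definition gasg :: "nat \<Rightarrow> asg \<Rightarrow> bool \<Rightarrow> nat \<Rightarrow> nat \<Rightarrow> asg" where
  "gasg k fa xt p q v =
     (if odd v then fa (v div 2)
      else if v mod 4 = 2 then if same_prefix k p q (v div 4) then Some True else None
      else if v mod 8 = 4 then agree (tight k p (v div 8)) (tight k q (v div 8))
      else if v mod 16 = 8 \<or> v = Zv then agree (point_val k p v) (point_val k q v)
      else if v \<in> {Xv, X1v, X2v} \<and> xt then Some True else None)"

lemma gasg_simps:
  "gasg k fa xt p q (Fv v) = fa v"
  "gasg k fa xt p q (Dv m) = (if same_prefix k p q m then Some True else None)"
  "gasg k fa xt p q (Ev m) = agree (tight k p m) (tight k q m)"
  "gasg k fa xt p q (Yv m) = agree (bit_of k p m) (bit_of k q m)"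
  "gasg k fa xt p q Zv = agree (p > k) (q > k)"
  "gasg k fa xt p q Xv = (if xt then Some True else None)"
  "gasg k fa xt p q X1v = (if xt then Some True else None)"
  "gasg k fa xt p q X2v = (if xt then Some True else None)"
  "gasg k fa xt p q Qv = None"
proof -
  have D: "even (Dv m)" "Dv m mod 4 = 2" "Dv m div 4 = m"
    unfolding Dv_def by presburger+
  have E: "even (Ev m)" "Ev m mod 4 \<noteq> 2" "Ev m mod 8 = 4" "Ev m div 8 = m"
    unfolding Ev_def by presburger+
  have Y: "even (Yv m)" "Yv m mod 4 \<noteq> 2" "Yv m mod 8 \<noteq> 4" "Yv m mod 16 = 8" "Yv m div 16 = m" "Yv m \<noteq> Zv"
    unfolding Yv_def Zv_def by presburger+
  show "gasg k fa xt p q (Dv m) = (if same_prefix k p q m then Some True else None)"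
    unfolding gasg_def using D by simp
  show "gasg k fa xt p q (Ev m) = agree (tight k p m) (tight k q m)"
    unfolding gasg_def using E by simp
  show "gasg k fa xt p q (Yv m) = agree (bit_of k p m) (bit_of k q m)"
    unfolding gasg_def point_val_def using Y by simp
qed (simp_all add: gasg_def point_val_def gadget_var_defs)

lemma gadget_vars_distinct:
  "Yv a \<noteq> Dv b" "Dv b \<noteq> Yv a" "Zv \<noteq> Dv b" "Dv b \<noteq> Zv" "Zv \<noteq> Ev b" "Zv \<noteq> Qv" "Ev b \<noteq> Yv a" "Qv \<noteq> Dv b" "Xv \<noteq> Qv" "Yv a \<noteq> Zv"
  "Fv v \<noteq> X1v" "Fv v \<noteq> X2v" "X1v \<noteq> X2v"
  "Fv v \<noteq> Xv" "Yv a \<noteq> Xv" "Zv \<noteq> Xv"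
  unfolding gadget_var_defs by presburger+

lemma holds_ren: "holds A (ren l) = holds (\<lambda>v. A (Fv v)) l" by (simp add: holds_def)
lemma fails_ren: "fails A (ren l) = fails (\<lambda>v. A (Fv v)) l" by (simp add: fails_def)

lemma up_closed_clause_mono:
  "up_closed_clause A C \<Longrightarrow> C \<subseteq> D \<Longrightarrow> up_closed_clause A D"
  unfolding up_closed_clause_def by blast

lemma up_closed_clause_ren:
  "up_closed_clause A (ren ` C) = up_closed_clause (\<lambda>v. A (Fv v)) C"
  unfolding up_closed_clause_def by (auto simp: holds_ren fails_ren inj_ren)

lemma up_closed_clause_guard:
  assumes "holds A (Pos X1v)" "holds A (Pos X2v)"
  shows "up_closed_clause A (set (guard C)) = up_closed_clause (\<lambda>v. A (Fv v)) (set C)"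
proof
  have f: "fails A (Neg X1v)" "fails A (Neg X2v)" using assms by (auto simp: holds_def fails_def)
  assume "up_closed_clause A (set (guard C))"
  then have "up_closed_clause A (ren ` set C)"
    using f not_holds_fails unfolding up_closed_clause_def guard_def by (auto; blast)
  then show "up_closed_clause (\<lambda>v. A (Fv v)) (set C)" by (simp add: up_closed_clause_ren)
next
  assume "up_closed_clause (\<lambda>v. A (Fv v)) (set C)"
  then show "up_closed_clause A (set (guard C))"
    by (auto simp: guard_def up_closed_clause_ren intro: up_closed_clause_mono[of A "ren ` set C"])
qed

lemma up_closed_cnf_of: "up_closed A (cnf_of F) \<longleftrightarrow> (\<forall>C\<in>set F. up_closed_clause A (set C))"
  by (auto simp: up_closed_def cnf_of_def)

lemma up_closed_clause_2:
  "up_closed_clause A {l, m} \<longleftrightarrow> holds A l \<or> holds A m \<or> (l \<noteq> m \<and> \<not> fails A l \<and> \<not> fails A m)"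
  unfolding up_closed_clause_def by auto

lemma up_closed_clause_3:
  "up_closed_clause A {l, m, n} \<longleftrightarrow> holds A l \<or> holds A m \<or> holds A n \<or> (l \<noteq> m \<and> \<not> fails A l \<and> \<not> fails A m)
   \<or> (l \<noteq> n \<and> \<not> fails A l \<and> \<not> fails A n) \<or> (m \<noteq> n \<and> \<not> fails A m \<and> \<not> fails A n)"
  unfolding up_closed_clause_def by auto

lemmas upc = up_closed_clause_2 up_closed_clause_3 holds_def fails_def

text \<open>Two distinct points that are both still possible rule out a conflict: the chain of
  \<open>Dv\<close> variables stops at the first digit, seen from the top, where they differ, so
  \<open>Dv k\<close> stays open. The \<open>F\<close> part enters only when its guards are set,
  that is, under \<open>xt\<close>.\<close>

lemma up_closed_gasg:
  assumes pq: "p \<noteq> q" "p \<le> k + 1" "q \<le> k + 1" and xt: "xt \<Longrightarrow> up_closed fa (cnf_of F)"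
  shows "up_closed (gasg k fa xt p q) (cnf_of (target_cnf F k))"
proof -
  let ?A = "gasg k fa xt p q"
  note ss = upc gasg_simps gadget_vars_distinct
  have g: "up_closed_clause ?A (set (guard C))" if "C \<in> set F" for C
  proof (cases xt)
    case True
    then have "up_closed_clause ?A (set (guard C)) = up_closed_clause fa (set C)"
      by (subst up_closed_clause_guard) (auto simp: holds_def gasg_simps)
    then show ?thesis using xt True that by (auto simp: up_closed_cnf_of)
  next
    case False
    then have "up_closed_clause ?A {Neg X1v, Neg X2v}" by (simp add: ss)
    then show ?thesis by (rule up_closed_clause_mono) (auto simp: guard_def)
  qed
  \<comment> \<open>The name \<open>k\<close> belongs to position 0, where a common prefix would
    mean \<open>p = q\<close>; so \<open>Dv k\<close> is open.\<close>
  have "\<not> same_prefix k p q k" using same_prefix_iff[of k p q 0] pq by auto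
  then have c: "up_closed_clause ?A (set C)" if "C \<in> set (conflict_clauses k)" for C
    using that by (auto simp: conflict_clauses_def ss)
  have z: "\<not> (p > k \<and> q > k)" using pq by auto
  have s0: "same_prefix k p q 0 \<longleftrightarrow> p \<le> k \<and> q \<le> k"
    using same_prefix_iff[of k p q k] div_pow_zero_le[of p k k] div_pow_zero_le[of q k k] by auto
  have t0: "tight k p 0 \<longleftrightarrow> p \<le> k" for p
    using tight_iff[of k p k] div_pow_zero_le[of p k k] by auto
  have ga: "up_closed_clause ?A (set C)" if "C \<in> set gate_clauses" for C
    using that z s0 t0[of p] t0[of q] by (auto simp: gate_clauses_def ss agree_def split: if_splits)
  have "up_closed_clause ?A (set C)" if "C \<in> set (count_clauses k)" for C
  proof -
    obtain i where i: "k div 2 ^ i > 0" "C \<in> set (digit_clauses (k div 2 ^ i))"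
      using \<open>C \<in> set (count_clauses k)\<close> in_count_clauses by blast
    define a where "a = k div 2 ^ i"
    have m: "a div 2 = k div 2 ^ Suc i" unfolding a_def div_pow_Suc ..
    have sp: "r div 2 ^ i = 2 * (r div 2 ^ Suc i) + (if odd (r div 2 ^ i) then 1 else 0)" for r :: nat
      unfolding div_pow_Suc by simp
    have same_a: "same_prefix k p q a \<longleftrightarrow> same_prefix k p q (a div 2) \<and> (bit_of k p a = bit_of k q a)"
      unfolding m unfolding a_def same_prefix_iff bit_of_iff[OF i(1)]
      using sp[of p] sp[of q] by (smt (verit) div_pow_Suc)
    have tight_a: "tight k r a \<longleftrightarrow> tight k r (a div 2) \<and> (bit_of k r a = odd a)" for r
      unfolding m unfolding a_def tight_iff bit_of_iff[OF i(1)]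
      using sp[of r] sp[of k] by (smt (verit) div_pow_Suc)
    \<comment> \<open>A point that agrees with \<open>k\<close> above a digit 0 and has 1 there
      would exceed \<open>k\<close>.\<close>
    have even_a: "\<not> (tight k r (a div 2) \<and> bit_of k r a)" if "even a" for r
    proof
      assume t: "tight k r (a div 2) \<and> bit_of k r a"
      then have "r \<le> k" "r div 2 ^ Suc i = k div 2 ^ Suc i" "odd (r div 2 ^ i)"
        unfolding m unfolding a_def tight_iff bit_of_iff[OF i(1)] by auto
      then have "r div 2 ^ i > k div 2 ^ i"
        using sp[of r] sp[of k] \<open>even a\<close> unfolding a_def by simp
      then show False using \<open>r \<le> k\<close> div_le_mono by (meson leD)
    qed
    show ?thesis
      using i(2) even_a[of p] even_a[of q] unfolding a_def[symmetric] digit_clauses_def Let_def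
      by (cases "odd a")
        (auto simp: ss agree_def same_a tight_a split: if_splits)
  qed
  then show ?thesis using g c ga unfolding up_closed_cnf_of target_cnf_def by auto
qed

section \<open>Lower bound for arbitrary trees of the target formula\<close>

definition units :: "lit set \<Rightarrow> cnf" where "units L = (\<lambda>l. {l}) ` L"

text \<open>\<open>I\<close> holds the decisions on variables of \<open>F\<close>, before renaming,
  and \<open>J\<close> those on the gadget. The decision \<open>Pos Xv\<close> is kept apart because
  it switches the \<open>F\<close> part on.\<close>

definition node_cnf :: "lit list list \<Rightarrow> nat \<Rightarrow> lit set \<Rightarrow> lit set \<Rightarrow> bool \<Rightarrow> cnf" where
  "node_cnf F k I J xt =
     cnf_of (target_cnf F k) \<union> units (ren ` I \<union> J \<union> (if xt then {Pos Xv} else {}))"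

lemma up_closed_Un: "up_closed A (F \<union> G) \<longleftrightarrow> up_closed A F \<and> up_closed A G"
  by (auto simp: up_closed_def)

lemma up_closed_units: "up_closed A (units L) \<longleftrightarrow> (\<forall>l\<in>L. holds A l)"
  by (auto simp: up_closed_def units_def)

lemma up_closed_node_cnf:
  "up_closed A (node_cnf F k I J xt) \<longleftrightarrow> up_closed A (cnf_of (target_cnf F k)) \<and>
     (\<forall>l\<in>I. holds (\<lambda>v. A (Fv v)) l) \<and> (\<forall>l\<in>J. holds A l) \<and> (xt \<longrightarrow> holds A (Pos Xv))"
  by (simp add: node_cnf_def up_closed_Un up_closed_units ball_Un holds_ren)

lemma node_cnf_insert:
  "insert {ren l} (node_cnf F k I J xt) = node_cnf F k (insert l I) J xt"
  "insert {l} (node_cnf F k I J xt) = node_cnf F k I (insert l J) xt"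
  "insert {Pos Xv} (node_cnf F k I J xt) = node_cnf F k I J True"
  by (auto simp: node_cnf_def units_def)

lemma units_insert: "insert {l} (F \<union> units I) = F \<union> units (insert l I)"
  by (auto simp: units_def)

lemma finite_cnf_Un_units: "finite_cnf (cnf_of F \<union> units I) \<longleftrightarrow> finite I"
proof -
  have "vars (cnf_of F \<union> units I) = var ` (\<Union>C\<in>set F. set C) \<union> var ` I"
    by (auto simp: vars_def cnf_of_def units_def)
  moreover have "finite (var ` I) \<longleftrightarrow> finite I"
  proof
    assume f: "finite (var ` I)"
    have "I \<subseteq> Pos ` (var ` I) \<union> Neg ` (var ` I)"
    proof
      fix l assume "l \<in> I"
      then have "var l \<in> var ` I" by (rule imageI)
      then show "l \<in> Pos ` (var ` I) \<union> Neg ` (var ` I)" by (cases l) simp_all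
    qed
    then show "finite I" using f by (meson finite_UnI finite_imageI finite_subset)
  qed simp
  ultimately show ?thesis by (simp add: finite_cnf_def)
qed

lemma finite_node_cnf: "finite I \<Longrightarrow> finite J \<Longrightarrow> finite_cnf (node_cnf F k I J xt)"
  unfolding node_cnf_def finite_cnf_Un_units by simp

definition points :: "nat \<Rightarrow> lit set \<Rightarrow> nat set" where
  "points k J = {p. p \<le> k + 1 \<and> (\<forall>l\<in>J. point_val k p (var l) = pol l)}"

lemma finite_points [simp]: "finite (points k J)"
  by (rule finite_subset[of _ "{..k+1}"]) (auto simp: points_def)

lemma card_points_split:
  "card (points k J) \<le> card (points k (insert (Neg v) J)) + card (points k (insert (Pos v) J))"
proof -
  have "points k J = points k (insert (Neg v) J) \<union> points k (insert (Pos v) J)"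
    by (auto simp: points_def)
  then show ?thesis using card_Un_le by metis
qed

lemma gasg_point:
  assumes "p \<in> points k J" "q \<in> points k J" "l \<in> J" "var l = Zv \<or> (\<exists>a. var l = Yv a)"
  shows "holds (gasg k fa xt p q) l"
proof -
  have *: "point_val k p (var l) = pol l" "point_val k q (var l) = pol l"
    using assms by (auto simp: points_def)
  have y: "Yv a div 16 = a" for a unfolding Yv_def by presburger
  show ?thesis using assms(4) * 
    by (auto simp: holds_def gasg_simps agree_def point_val_def y gadget_vars_distinct)
qed

definition lits_asg :: "lit set \<Rightarrow> asg" where
  "lits_asg I v = (if Pos v \<in> I then Some True else if Neg v \<in> I then Some False else None)"

lemma holds_lits_asg: "\<forall>l\<in>I. neg l \<notin> I \<Longrightarrow> l \<in> I \<Longrightarrow> holds (lits_asg I) l"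
  by (cases l) (auto simp: holds_def lits_asg_def)

text \<open>Every leaf either refutes \<open>F\<close> or leaves at most one point, so the points are counted by the leaves.\<close>
lemma tree_lower_bound:
  assumes "dmst (set (target_vars B k)) (node_cnf F k I J xt) T"
    and "finite I" "finite J" "\<forall>l\<in>I. neg l \<notin> I"
    and "\<forall>l\<in>J. var l = Zv \<or> (\<exists>a. var l = Yv a)"
  shows "card (points k J) \<le> tsize T + 1 \<or>
    (\<exists>T0. dmst (set B) (cnf_of F \<union> units I) T0 \<and> tsize T0 + (if xt then 0 else 1) \<le> tsize T)"
  using assms
proof (induction T arbitrary: I J xt rule: btree.induct)
  case Leaf
  have fin: "finite_cnf (node_cnf F k I J xt)" "finite_cnf (cnf_of F \<union> units I)"
    using Leaf by (simp_all add: finite_node_cnf finite_cnf_Un_units)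
  have nc: "\<not> up_consistent (node_cnf F k I J xt)" using Leaf fin dmst_Leaf by blast
  show ?case
  proof (cases "card (points k J) \<le> 1")
    case True then show ?thesis by simp
  next
    case False
    then obtain p q where pq: "p \<in> points k J" "q \<in> points k J" "p \<noteq> q"
      using card_le_Suc0_iff_eq[OF finite_points, of k J] by (metis One_nat_def)
    \<comment> \<open>With two points left, any admissible state \<open>fa\<close> of the
      \<open>F\<close> part extends to a closed assignment of the whole node, so the conflict must
      come from \<open>F\<close> and \<open>I\<close>.\<close>
    have cl: "\<not> (\<forall>l\<in>I. holds fa l)" if "xt \<Longrightarrow> up_closed fa (cnf_of F)" for fa
    proof
      assume "\<forall>l\<in>I. holds fa l"
      then have "up_closed (gasg k fa xt p q) (node_cnf F k I J xt)"
        using that pq up_closed_gasg[OF pq(3), of k xt fa F] gasg_point[OF pq(1,2)] Leaf.prems(5)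
        unfolding up_closed_node_cnf by (auto simp: points_def gasg_simps holds_def)
      then show False using nc unfolding up_consistent_def by blast
    qed
    \<comment> \<open>Were \<open>Xv\<close> not set, \<open>F\<close> would put no condition on
      \<open>fa\<close>, and recording the decisions \<open>I\<close> would be enough.\<close>
    have xt using cl[of "lits_asg I"] holds_lits_asg Leaf.prems(4) by blast
    moreover have "\<not> up_consistent (cnf_of F \<union> units I)"
      using cl unfolding up_consistent_def up_closed_Un up_closed_units by blast
    ultimately show ?thesis using dmst_Leaf[OF fin(2)] by (metis add_0_right le_refl tsize.simps(1))
  qed
next
  case (Node v T1 T2)
  let ?N = "node_cnf F k I J xt"
  have fin: "finite_cnf ?N" using Node by (simp add: finite_node_cnf)
  have n: "up_consistent ?N" "v \<in> set (target_vars B k)" "v \<in> vars (U ?N)"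
    "dmst (set (target_vars B k)) (insert {Neg v} ?N) T1"
    "dmst (set (target_vars B k)) (insert {Pos v} ?N) T2"
    using Node.prems(1) dmst_Node[OF fin] by auto
  consider (f) b where "b \<in> set B" "v = Fv b" | (g) "v = Zv \<or> (\<exists>a. v = Yv a)" | (x) "v = Xv"
    using n(2) by (auto simp: target_vars_def in_digit_vars)
  then show ?case
  proof cases
    case f
    have nf: "\<not> forced ?N (Pos v)" "\<not> forced ?N (Neg v)"
      using vars_U_not_forced[OF fin n(1), of "Pos v"] n(3) by auto
    have "forced ?N (ren l)" if "l \<in> I" for l
      using that unfolding forced_def up_closed_node_cnf holds_ren by blast
    then have nI: "Pos b \<notin> I" "Neg b \<notin> I" using nf f(2) by (metis ren.simps)+
    have i: "insert {Neg v} ?N = node_cnf F k (insert (Neg b) I) J xt"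
      "insert {Pos v} ?N = node_cnf F k (insert (Pos b) I) J xt"
      using node_cnf_insert(1)[of "Neg b"] node_cnf_insert(1)[of "Pos b"] f(2) by simp_all
    have c: "\<forall>l\<in>insert (Neg b) I. neg l \<notin> insert (Neg b) I" "\<forall>l\<in>insert (Pos b) I. neg l \<notin> insert (Pos b) I"
      using Node.prems(4) nI by (auto; metis neg_neg neg.simps)+
    let ?c = "if xt then 0 else 1 :: nat"
    have "card (points k J) \<le> tsize T1 + 1 \<or>
      (\<exists>T0. dmst (set B) (insert {Neg b} (cnf_of F \<union> units I)) T0 \<and> tsize T0 + ?c \<le> tsize T1)"
      using Node.IH(1)[OF n(4)[unfolded i] _ _ c(1)] Node.prems unfolding units_insert by simp
    moreover have "card (points k J) \<le> tsize T2 + 1 \<or>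
      (\<exists>T0. dmst (set B) (insert {Pos b} (cnf_of F \<union> units I)) T0 \<and> tsize T0 + ?c \<le> tsize T2)"
      using Node.IH(2)[OF n(5)[unfolded i] _ _ c(2)] Node.prems unfolding units_insert by simp
    \<comment> \<open>If one subtree separates the points, so does the whole tree, as
      \<open>J\<close> is unchanged. Otherwise both yield trees of \<open>F\<close>, joined by
      \<open>dmst_merge\<close>; the charge \<open>?c\<close> is due only once.\<close>
    moreover have "\<exists>T0. dmst (set B) (cnf_of F \<union> units I) T0 \<and> tsize T0 + ?c \<le> tsize (Node v T1 T2)"
      if "dmst (set B) (insert {Neg b} (cnf_of F \<union> units I)) S1" "tsize S1 + ?c \<le> tsize T1"
        "dmst (set B) (insert {Pos b} (cnf_of F \<union> units I)) S2" "tsize S2 + ?c \<le> tsize T2" for S1 S2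
    proof -
      have "finite_cnf (cnf_of F \<union> units I)" using Node.prems by (simp add: finite_cnf_Un_units)
      from dmst_merge[OF this f(1) that(1,3)] obtain T where
        "dmst (set B) (cnf_of F \<union> units I) T" "tsize T \<le> 1 + tsize S1 + tsize S2" by blast
      moreover then have "tsize T + ?c \<le> tsize (Node v T1 T2)" using that(2,4) by simp
      ultimately show ?thesis by blast
    qed
    ultimately show ?thesis by fastforce
  next
    case g
    let ?P = "\<lambda>t. \<exists>T0. dmst (set B) (cnf_of F \<union> units I) T0 \<and> tsize T0 + (if xt then 0 else 1) \<le> t"
    have "card (points k (insert (Neg v) J)) \<le> tsize T1 + 1 \<or> ?P (tsize T1)"
      using Node.IH(1)[OF n(4)[unfolded node_cnf_insert(2)]] Node.prems g by auto
    moreover have "card (points k (insert (Pos v) J)) \<le> tsize T2 + 1 \<or> ?P (tsize T2)"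
      using Node.IH(2)[OF n(5)[unfolded node_cnf_insert(2)]] Node.prems g by auto
    moreover have "?P s \<Longrightarrow> s \<le> t \<Longrightarrow> ?P t" for s t using order_trans by blast
    moreover have "tsize T1 \<le> tsize (Node v T1 T2)" "tsize T2 \<le> tsize (Node v T1 T2)" by simp_all
    ultimately have "(card (points k (insert (Neg v) J)) \<le> tsize T1 + 1 \<and>
      card (points k (insert (Pos v) J)) \<le> tsize T2 + 1) \<or> ?P (tsize (Node v T1 T2))" by blast
    \<comment> \<open>Leaves add up: \<open>(tsize T1 + 1) + (tsize T2 + 1)\<close> is
      \<open>tsize (Node v T1 T2) + 1\<close>.\<close>
    then show ?thesis using card_points_split[of k J v] by auto
  next
    case x
    \<comment> \<open>Only the subtree under \<open>Pos Xv\<close> is used; the node itself pays the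
      1 charged while \<open>xt\<close> is false.\<close>
    have "card (points k J) \<le> tsize T2 + 1 \<or>
      (\<exists>T0. dmst (set B) (cnf_of F \<union> units I) T0 \<and> tsize T0 + 0 \<le> tsize T2)"
      using Node.IH(2)[of I J True] n(5) x node_cnf_insert(3) Node.prems by auto
    then show ?thesis
    proof
      assume "\<exists>T0. dmst (set B) (cnf_of F \<union> units I) T0 \<and> tsize T0 + 0 \<le> tsize T2"
      then obtain T0 where "dmst (set B) (cnf_of F \<union> units I) T0" "tsize T0 \<le> tsize T2" by auto
      then show ?thesis by (intro disjI2 exI[of _ T0]) auto
    qed simp
  qed
qed

section \<open>Explicit trees for the two parts\<close>

lemma node_cnf_not_consistent:
  assumes "\<And>A. up_closed A (node_cnf F k I J xt) \<Longrightarrow> False"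
  shows "\<not> up_consistent (node_cnf F k I J xt)"
  using assms up_consistent_def by blast

lemma node_cnf_clause:
  assumes "up_closed A (node_cnf F k I J xt)" "C \<in> set (target_cnf F k)"
  shows "up_closed_clause A (set C)"
  using assms unfolding up_closed_node_cnf up_closed_cnf_of by blast

text \<open>Once \<open>Xv\<close> is true the guards are propagated away and the renamed copy
  behaves like \<open>F\<close>; the counting part does not disturb it, since without decisions on
  it two points remain.\<close>

lemma guarded_tree:
  assumes "dmst (set B) (cnf_of F \<union> units I) T0" "finite I"
  shows "\<exists>T. dmst (set (target_vars B k)) (node_cnf F k I {} True) T \<and> tsize T = tsize T0"
  using assms
proof (induction T0 arbitrary: I rule: btree.induct)
  case Leaf
  have fin: "finite_cnf (node_cnf F k I {} True)" "finite_cnf (cnf_of F \<union> units I)"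
    using Leaf by (simp_all add: finite_node_cnf finite_cnf_Un_units)
  have nc: "\<not> up_consistent (cnf_of F \<union> units I)" using Leaf fin dmst_Leaf by blast
  have "\<not> up_consistent (node_cnf F k I {} True)"
  proof (rule node_cnf_not_consistent)
    fix A assume A: "up_closed A (node_cnf F k I {} True)"
    have X: "A Xv = Some True" using A unfolding up_closed_node_cnf holds_def by simp
    have "up_closed_clause A (set [Neg Xv, Pos X1v])" "up_closed_clause A (set [Neg Xv, Pos X2v])"
      by (rule node_cnf_clause[OF A]; simp add: target_cnf_def gate_clauses_def)+
    then have "holds A (Pos X1v)" "holds A (Pos X2v)" using X by (auto simp: upc)
    then have "up_closed (\<lambda>v. A (Fv v)) (cnf_of F)"
      using A up_closed_clause_guard unfolding up_closed_node_cnf up_closed_cnf_of target_cnf_def by auto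
    then show False using A nc
      unfolding up_closed_node_cnf up_consistent_def up_closed_Un up_closed_units by blast
  qed
  then show ?case using dmst_Leaf[OF fin(1)] by blast
next
  case (Node v T1 T2)
  let ?F = "cnf_of F \<union> units I" and ?N = "node_cnf F k I {} True"
  have fin: "finite_cnf ?N" "finite_cnf ?F"
    using Node by (simp_all add: finite_node_cnf finite_cnf_Un_units)
  have n: "up_consistent ?F" "v \<in> set B" "v \<in> vars (U ?F)"
    "dmst (set B) (cnf_of F \<union> units (insert (Neg v) I)) T1"
    "dmst (set B) (cnf_of F \<union> units (insert (Pos v) I)) T2"
    using Node.prems(1) dmst_Node[OF fin(2)] by (auto simp: units_insert)
  \<comment> \<open>Any two distinct points serve here; 0 and \<open>k + 1\<close> differ for every
    \<open>k\<close>.\<close>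
  let ?fa = "least_asg ?F" and ?A = "gasg k (least_asg ?F) True 0 (k + 1)"
  have fa: "up_closed ?fa (cnf_of F)" "\<forall>l\<in>I. holds ?fa l"
    using up_closed_least_asg[OF n(1)] by (auto simp: up_closed_Un up_closed_units)
  have A: "up_closed ?A ?N"
    using up_closed_gasg[of 0 "k+1" k True ?fa F] fa
    by (auto simp: up_closed_node_cnf gasg_simps holds_def)
  obtain C where C: "C \<in> ?F" "v \<in> var ` C" "\<forall>l\<in>C. \<not> holds ?fa l" "?fa v = None"
    using active_least_asg[OF fin(2) n(1,3)] unfolding active_def by blast
  have "C \<notin> units I" using C(3) fa(2) by (auto simp: units_def)
  then obtain D where D: "D \<in> set F" "C = set D" using C(1) by (auto simp: cnf_of_def)
  have "\<not> holds ?A l" if "l \<in> set (guard D)" for l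
    using that C(3) D by (auto simp: guard_def holds_ren gasg_simps) (auto simp: holds_def gasg_simps)
  moreover have "Fv v \<in> var ` set (guard D)" using C(2) D by (force simp: guard_def)
  moreover have "set (guard D) \<in> ?N" using D by (auto simp: node_cnf_def cnf_of_def target_cnf_def)
  ultimately have "active ?N ?A (Fv v)" unfolding active_def using C(4) by (auto simp: gasg_simps)
  then have v: "Fv v \<in> vars (U ?N)" using vars_UI fin(1) A by blast
  obtain S1 where S1: "dmst (set (target_vars B k)) (insert {ren (Neg v)} ?N) S1" "tsize S1 = tsize T1"
    using Node.IH(1)[OF n(4)] Node.prems(2) unfolding node_cnf_insert(1) by auto
  obtain S2 where S2: "dmst (set (target_vars B k)) (insert {ren (Pos v)} ?N) S2" "tsize S2 = tsize T2"
    using Node.IH(2)[OF n(5)] Node.prems(2) unfolding node_cnf_insert(1) by auto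
  have "dmst (set (target_vars B k)) ?N (Node (Fv v) S1 S2)"
    using dmst_Node[OF fin(1)] S1 S2 v A n(2) by (auto simp: up_consistent_def target_vars_def)
  then show ?case using S1 S2 by (metis tsize.simps(2))
qed

lemma gate_tree:
  assumes "dmst (set B) (cnf_of F) T0"
  shows "\<exists>T. dmst (set (target_vars B k)) (cnf_of (target_cnf F k)) (Node Xv Leaf T) \<and> tsize T = tsize T0"
proof -
  have N: "node_cnf F k {} {} False = cnf_of (target_cnf F k)" by (simp add: node_cnf_def units_def)
  let ?N = "node_cnf F k {} {} False"
  have fin: "finite_cnf ?N" by (simp add: finite_node_cnf)
  obtain T where T: "dmst (set (target_vars B k)) (insert {Pos Xv} ?N) T" "tsize T = tsize T0"
    using guarded_tree[of B F "{}" T0 k] assms unfolding node_cnf_insert(3) by (auto simp: units_def)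
  let ?A = "gasg k (\<lambda>_. None) False 0 (k + 1)"
  have A: "up_closed ?A ?N" using up_closed_gasg[of 0 "k+1" k False] by (simp add: up_closed_node_cnf)
  have "set [Neg Xv, Pos X1v] \<in> ?N"
    unfolding N cnf_of_def target_cnf_def gate_clauses_def set_map by (intro imageI) simp
  then have "active ?N ?A Xv" unfolding active_def
    by (intro conjI bexI[of _ "set [Neg Xv, Pos X1v]"]) (auto simp: gasg_simps holds_def)
  then have v: "Xv \<in> vars (U ?N)" using vars_UI fin A by blast
  have "\<not> up_consistent (insert {Neg Xv} ?N)" unfolding node_cnf_insert(2)
  proof (rule node_cnf_not_consistent)
    fix A assume A: "up_closed A (node_cnf F k {} {Neg Xv} False)"
    have "up_closed_clause A (set [Pos Xv, Pos Qv])" "up_closed_clause A (set [Pos Xv, Neg Qv])"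
      by (rule node_cnf_clause[OF A]; simp add: target_cnf_def gate_clauses_def)+
    then show False using A by (auto simp: upc up_closed_node_cnf)
  qed
  then have "dmst (set (target_vars B k)) (insert {Neg Xv} ?N) Leaf"
    using dmst_Leaf fin finite_cnf_insert by blast
  then have "dmst (set (target_vars B k)) ?N (Node Xv Leaf T)"
    using dmst_Node[OF fin] T v A by (auto simp: up_consistent_def target_vars_def)
  then show ?thesis using T N by metis
qed

text \<open>The number \<open>t\<close> supplies the bits from position \<open>i\<close> on.\<close>
definition prefix_lits :: "nat \<Rightarrow> nat \<Rightarrow> nat \<Rightarrow> lit set" where
  "prefix_lits k i t = insert (Neg Zv)
     {(if odd (t div 2 ^ (j - i)) then Pos else Neg) (Yv (k div 2 ^ j)) | j. i \<le> j \<and> k div 2 ^ j > 0}"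

definition cell :: "nat \<Rightarrow> nat \<Rightarrow> nat \<Rightarrow> nat set" where
  "cell k i t = {y. y \<le> k \<and> y div 2 ^ i = t}"

lemma finite_cell [simp]: "finite (cell k i t)"
  by (rule finite_subset[of _ "{..k}"]) (auto simp: cell_def)

lemma finite_digits: "finite {j. k div 2 ^ j > (0::nat)}"
proof (rule finite_subset)
  show "{j. k div 2 ^ j > 0} \<subseteq> {..<k}"
  proof
    fix j assume "j \<in> {j. k div 2 ^ j > 0}"
    then have "2 ^ j \<le> k" by (auto simp: div_greater_zero_iff)
    then show "j \<in> {..<k}" by (auto intro: less_le_trans[OF less_exp])
  qed
qed simp

lemma finite_prefix_lits: "finite (prefix_lits k i t)"
proof -
  have "{(if odd (t div 2 ^ (j - i)) then Pos else Neg) (Yv (k div 2 ^ j)) | j. i \<le> j \<and> k div 2 ^ j > 0}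
    \<subseteq> (\<lambda>j. (if odd (t div 2 ^ (j - i)) then Pos else Neg) (Yv (k div 2 ^ j))) ` {j. k div 2 ^ j > 0}" by blast
  then show ?thesis unfolding prefix_lits_def using finite_digits finite_subset by auto
qed

lemma cell_nonempty: "cell k i t \<noteq> {} \<longleftrightarrow> t \<le> k div 2 ^ i"
proof
  assume "cell k i t \<noteq> {}"
  then show "t \<le> k div 2 ^ i" unfolding cell_def using div_le_mono by blast
next
  assume "t \<le> k div 2 ^ i"
  then have "t * 2 ^ i \<le> k" by (metis div_times_less_eq_dividend le_trans mult_le_mono1)
  then have "t * 2 ^ i \<in> cell k i t" by (simp add: cell_def)
  then show "cell k i t \<noteq> {}" by blast
qed

lemma cell_split:
  "cell k (Suc i) t = cell k i (2 * t) \<union> cell k i (2 * t + 1)" "cell k i (2 * t) \<inter> cell k i (2 * t + 1) = {}"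
  unfolding cell_def div_pow_Suc by auto

lemma Collect_ge_Suc:
  fixes i :: nat
  assumes "P i" shows "{f j | j. i \<le> j \<and> P j} = insert (f i) {f j | j. Suc i \<le> j \<and> P j}"
  using assms by (auto simp: le_eq_less_or_eq Suc_le_eq)

lemma prefix_lits_step:
  assumes "k div 2 ^ i > 0"
  shows "prefix_lits k i (2 * t) = insert (Neg (Yv (k div 2 ^ i))) (prefix_lits k (Suc i) t)" (is ?A)
    and "prefix_lits k i (2 * t + 1) = insert (Pos (Yv (k div 2 ^ i))) (prefix_lits k (Suc i) t)" (is ?B)
proof -
  have e: "s div 2 ^ (j - i) = t div 2 ^ (j - Suc i)" if "Suc i \<le> j" "s div 2 = t" for j s
  proof -
    have "j - i = Suc (j - Suc i)" using that by simp
    then show ?thesis using that by (simp add: div_mult2_eq)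
  qed
  have "prefix_lits k i s = insert ((if odd s then Pos else Neg) (Yv (k div 2 ^ i))) (prefix_lits k (Suc i) t)"
    if s: "s div 2 = t" for s
  proof -
    have "{(if odd (s div 2 ^ (j - i)) then Pos else Neg) (Yv (k div 2 ^ j)) | j. i \<le> j \<and> k div 2 ^ j > 0} =
      insert ((if odd s then Pos else Neg) (Yv (k div 2 ^ i)))
       {(if odd (s div 2 ^ (j - i)) then Pos else Neg) (Yv (k div 2 ^ j)) | j. Suc i \<le> j \<and> k div 2 ^ j > 0}"
      using Collect_ge_Suc[of "\<lambda>j. k div 2 ^ j > 0", OF assms, of "\<lambda>j. (if odd (s div 2 ^ (j - i)) then Pos else Neg) (Yv (k div 2 ^ j))"]
      by simp
    also have "{(if odd (s div 2 ^ (j - i)) then Pos else Neg) (Yv (k div 2 ^ j)) | j. Suc i \<le> j \<and> k div 2 ^ j > 0} =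
      {(if odd (t div 2 ^ (j - Suc i)) then Pos else Neg) (Yv (k div 2 ^ j)) | j. Suc i \<le> j \<and> k div 2 ^ j > 0}"
      by (intro Collect_cong ex_cong1) (use e[OF _ s] in \<open>force split: if_splits\<close>)
    finally show ?thesis unfolding prefix_lits_def by (simp add: insert_commute)
  qed
  from this[of "2 * t"] this[of "2 * t + 1"] show ?A ?B by simp_all
qed

lemma prefix_lits_point:
  assumes "p \<in> cell k i t" shows "p \<in> points k (prefix_lits k i t)"
proof -
  have p: "p \<le> k" "p div 2 ^ i = t" using assms by (auto simp: cell_def)
  have y: "Yv a div 16 = a" for a unfolding Yv_def by presburger
  have "odd (p div 2 ^ j) = odd (t div 2 ^ (j - i))" if "i \<le> j" for j
    using p(2) that by (metis div_mult2_eq le_add_diff_inverse power_add)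
  then show ?thesis using p(1) bit_of_iff[of k _ p]
    unfolding points_def prefix_lits_def by (auto simp: point_val_def gadget_vars_distinct y)
qed

lemma prefix_lits_vars: "l \<in> prefix_lits k i t \<Longrightarrow> var l = Zv \<or> (\<exists>a. var l = Yv a)"
  by (auto simp: prefix_lits_def split: if_splits)

lemma digit_clauses_subset:
  "k div 2 ^ i > 0 \<Longrightarrow> set (digit_clauses (k div 2 ^ i)) \<subseteq> set (target_cnf F k)"
  using in_count_clauses by (auto simp: target_cnf_def)

text \<open>The induction descends from positions above the top digit: their name is 0, and there
  the gate clauses with \<open>Zv\<close> false supply \<open>Dv 0\<close> and \<open>Ev 0\<close>.
  The digit clauses then carry both down to position \<open>i\<close>.\<close>

lemma prefix_forces:
  assumes A: "up_closed A (node_cnf F k {} (prefix_lits k i t) False)" and j: "i \<le> j"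
  shows "A (Dv (k div 2 ^ j)) = Some True \<and> (t = k div 2 ^ i \<longrightarrow> A (Ev (k div 2 ^ j)) = Some True)"
  using j
proof (induction "k - j" arbitrary: j rule: less_induct)
  case less
  have J: "\<forall>l\<in>prefix_lits k i t. holds A l" using A by (simp add: up_closed_node_cnf)
  show ?case
  proof (cases "k div 2 ^ j = 0")
    case True
    have "up_closed_clause A (set [Pos Zv, Pos (Dv 0)])" "up_closed_clause A (set [Pos Zv, Pos (Ev 0)])"
      by (rule node_cnf_clause[OF A]; simp add: target_cnf_def gate_clauses_def)+
    moreover have "holds A (Neg Zv)" using J by (simp add: prefix_lits_def)
    ultimately show ?thesis using True by (auto simp: upc)
  next
    case False
    \<comment> \<open>The measure \<open>k - j\<close> decreases only while \<open>j < k\<close>; a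
      nonzero quotient guarantees this.\<close>
    have "j < 2 ^ j" by (rule less_exp)
    moreover have "2 ^ j \<le> k" using False by (meson div_less not_less)
    ultimately have "j < k" by (rule less_le_trans)
    then have IH: "A (Dv (k div 2 ^ Suc j)) = Some True"
       "t = k div 2 ^ i \<Longrightarrow> A (Ev (k div 2 ^ Suc j)) = Some True"
      using less.hyps[of "Suc j"] less.prems by auto
    define a where "a = k div 2 ^ j"
    have m: "k div 2 ^ Suc j = a div 2" unfolding a_def div_pow_Suc ..
    have C: "up_closed_clause A (set C)" if "C \<in> set (digit_clauses a)" for C
      by (rule node_cnf_clause[OF A]) (use that False digit_clauses_subset in \<open>auto simp: a_def\<close>)
    have Y: "A (Yv a) = Some (odd (t div 2 ^ (j - i)))"
    proof -
      have "(if odd (t div 2 ^ (j - i)) then Pos else Neg) (Yv a) \<in> prefix_lits k i t"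
        unfolding prefix_lits_def a_def using False less.prems by blast
      then show ?thesis using J by (auto simp: holds_def split: if_splits)
    qed
    have "up_closed_clause A (set [Neg (Dv (a div 2)), Neg (Yv a), Pos (Dv a)])"
      "up_closed_clause A (set [Neg (Dv (a div 2)), Pos (Yv a), Pos (Dv a)])"
      by (rule C; simp add: digit_clauses_def Let_def)+
    then have D: "A (Dv a) = Some True" using IH(1) Y unfolding m by (auto simp: upc)
    have "A (Ev a) = Some True" if t: "t = k div 2 ^ i"
    proof -
      have "t div 2 ^ (j - i) = a" unfolding t a_def using less.prems
        by (metis div_mult2_eq le_add_diff_inverse power_add)
      then have Y: "A (Yv a) = Some (odd a)" using Y by simp
      show ?thesis
      proof (cases "odd a")
        case True
        then have "up_closed_clause A (set [Neg (Ev (a div 2)), Neg (Yv a), Pos (Ev a)])"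
          by (intro C) (simp add: digit_clauses_def Let_def)
        then show ?thesis using IH(2)[OF t] Y True unfolding m by (auto simp: upc)
      next
        case False
        then have "up_closed_clause A (set [Neg (Ev (a div 2)), Pos (Ev a)])"
          by (intro C) (simp add: digit_clauses_def Let_def)
        then show ?thesis using IH(2)[OF t] unfolding m by (auto simp: upc)
      qed
    qed
    then show ?thesis using D by (simp add: a_def)
  qed
qed

text \<open>Digits are decided from the top. A node is spent only where both values leave some
  number up to \<open>k\<close>, so every leaf belongs to a number of its own. The second premise
  says that the next position is a genuine digit.\<close>

lemma prefix_tree:
  assumes "t \<le> k div 2 ^ i" "i = 0 \<or> k div 2 ^ (i - 1) > 0"
  shows "\<exists>T. dmst (set (target_vars B k)) (node_cnf F k {} (prefix_lits k i t) False) T \<and>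
    tsize T + 1 \<le> card (cell k i t)"
  using assms
proof (induction i arbitrary: t)
  case 0
  have "\<not> up_consistent (node_cnf F k {} (prefix_lits k 0 t) False)"
  proof (rule node_cnf_not_consistent)
    fix A assume A: "up_closed A (node_cnf F k {} (prefix_lits k 0 t) False)"
    have "up_closed_clause A (set [Pos Qv, Neg (Dv k)])" "up_closed_clause A (set [Neg Qv, Neg (Dv k)])"
      by (rule node_cnf_clause[OF A]; simp add: target_cnf_def conflict_clauses_def)+
    then show False using prefix_forces[OF A, of 0] by (auto simp: upc)
  qed
  moreover have "card (cell k 0 t) = 1" using 0 by (auto simp: cell_def card_1_singleton_iff)
  ultimately show ?case using dmst_Leaf[OF finite_node_cnf[OF _ finite_prefix_lits]]
    by (intro exI[of _ Leaf]) auto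
next
  case (Suc i)
  let ?N = "node_cnf F k {} (prefix_lits k (Suc i) t) False" and ?B = "set (target_vars B k)"
  define a where "a = k div 2 ^ i"
  have a: "a > 0" "k div 2 ^ i > 0" using Suc.prems(2) by (auto simp: a_def)
  have i: "i = 0 \<or> k div 2 ^ (i - 1) > 0"
    using a(2) by (cases i) (auto simp: div_pow_Suc simp del: power_Suc)
  have m: "k div 2 ^ Suc i = a div 2" unfolding a_def div_pow_Suc ..
  have fin: "finite_cnf ?N" using finite_node_cnf[OF _ finite_prefix_lits] by simp
  have ne: "2 * t \<le> k div 2 ^ i" using Suc.prems(1) unfolding m a_def[symmetric] by linarith
  note step = prefix_lits_step[OF a(2), of t]
  obtain T1 where T1: "dmst ?B (insert {Neg (Yv a)} ?N) T1" "tsize T1 + 1 \<le> card (cell k i (2 * t))"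
    using Suc.IH[OF ne i] unfolding step node_cnf_insert(2)[symmetric] a_def by blast
  have cs: "card (cell k (Suc i) t) = card (cell k i (2 * t)) + card (cell k i (2 * t + 1))"
    unfolding cell_split(1) by (rule card_Un_disjoint) (simp_all only: finite_cell cell_split(2))
  show ?case
  proof (cases "2 * t + 1 \<le> k div 2 ^ i")
    case True
    obtain T2 where T2: "dmst ?B (insert {Pos (Yv a)} ?N) T2" "tsize T2 + 1 \<le> card (cell k i (2 * t + 1))"
      using Suc.IH[OF True i] unfolding step node_cnf_insert(2)[symmetric] a_def by blast
    \<comment> \<open>One number from each half: both fit the decisions so far and first differ at
      position \<open>i\<close>, so their common knowledge makes \<open>Dv (a div 2)\<close> true
      and leaves \<open>Yv a\<close> open.\<close>
    obtain p q where p: "p \<in> cell k i (2 * t)" and q: "q \<in> cell k i (2 * t + 1)"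
      using cell_nonempty ne True by (metis ex_in_conv)
    have pq: "p \<le> k" "q \<le> k" "p div 2 ^ i = 2 * t" "q div 2 ^ i = 2 * t + 1"
      "p \<in> cell k (Suc i) t" "q \<in> cell k (Suc i) t"
      using p q unfolding cell_split(1) by (auto simp: cell_def)
    then have "p \<noteq> q" by auto
    let ?A = "gasg k (\<lambda>_. None) False p q"
    have A: "up_closed ?A ?N"
      using up_closed_gasg[OF \<open>p \<noteq> q\<close>, of k False] pq gasg_point[OF prefix_lits_point prefix_lits_point]
        prefix_lits_vars unfolding up_closed_node_cnf by auto
    have Y: "?A (Yv a) = None" using pq bit_of_iff[OF a(2)] by (simp add: gasg_simps agree_def a_def)
    have D: "?A (Dv a) = None" using pq same_prefix_iff[of k p q i] by (simp add: gasg_simps a_def)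
    have D': "?A (Dv (a div 2)) = Some True" using pq same_prefix_iff[of k p q "Suc i"] m
      by (simp add: gasg_simps cell_def)
    have "set [Neg (Dv (a div 2)), Neg (Yv a), Pos (Dv a)] \<in> cnf_of (target_cnf F k)"
      unfolding cnf_of_def set_map
      by (intro imageI subsetD[OF digit_clauses_subset[OF a(2)]])
        (simp add: a_def digit_clauses_def Let_def)
    then have "active ?N ?A (Yv a)" unfolding active_def node_cnf_def using Y D D'
      by (intro conjI bexI[of _ "set [Neg (Dv (a div 2)), Neg (Yv a), Pos (Dv a)]"]) (auto simp: holds_def)
    then have "Yv a \<in> vars (U ?N)" using vars_UI fin A by blast
    moreover have "Yv a \<in> ?B" using a in_digit_vars by (auto simp: target_vars_def a_def)
    ultimately have "dmst ?B ?N (Node (Yv a) T1 T2)"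
      using dmst_Node[OF fin] T1(1) T2(1) A up_consistent_def by blast
    then show ?thesis using T1(2) T2(2) cs by (intro exI[of _ "Node (Yv a) T1 T2"]) simp
  next
    case False
    \<comment> \<open>The half \<open>2 * t + 1\<close> is empty only if the prefix agrees with
      \<open>k\<close> and the next digit of \<open>k\<close> is 0. Then propagation fixes
      \<open>Yv a\<close> and no node is spent.\<close>
    then have ta: "t = a div 2" "even a" using ne unfolding a_def[symmetric] by presburger+
    have "forced ?N (Neg (Yv a))" unfolding forced_def
    proof (intro allI impI)
      fix A assume A: "up_closed A ?N"
      have "A (Ev (a div 2)) = Some True" using prefix_forces[OF A, of "Suc i"] ta(1) m by simp
      moreover have "up_closed_clause A (set [Neg (Ev (a div 2)), Neg (Yv a)])"
        by (rule node_cnf_clause[OF A], rule subsetD[OF digit_clauses_subset[OF a(2)]])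
          (use ta(2) in \<open>simp add: a_def digit_clauses_def Let_def\<close>)
      ultimately show "holds A (Neg (Yv a))" by (auto simp: upc)
    qed
    then have "dmst ?B ?N T1" using T1(1) dmst_cong U_insert_forced fin finite_cnf_insert by metis
    then show ?thesis using T1(2) cs by (intro exI[of _ T1]) simp
  qed
qed

lemma counting_tree:
  "\<exists>T. dmst (set (target_vars B k)) (cnf_of (target_cnf F k)) T \<and> tsize T \<le> k + 1"
proof -
  have N: "node_cnf F k {} {} False = cnf_of (target_cnf F k)" by (simp add: node_cnf_def units_def)
  let ?N = "node_cnf F k {} {} False" and ?B = "set (target_vars B k)"
  have fin: "finite_cnf ?N" by (simp add: finite_node_cnf)
  \<comment> \<open>\<open>n\<close> is the number of digits of \<open>k\<close>: none is decided
    yet, and the cell is all of \<open>{..k}\<close>. Minimality makes \<open>n - 1\<close> a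
    genuine position.\<close>
  define n where "n = (LEAST n. k div 2 ^ n = 0)"
  have "k div 2 ^ k = 0" by simp
  then have n0: "k div 2 ^ n = 0" unfolding n_def by (rule LeastI)
  have n1: "n = 0 \<or> k div 2 ^ (n - 1) > 0"
    using not_less_Least[of "n - 1" "\<lambda>n. k div 2 ^ n = 0"] unfolding n_def[symmetric] by linarith
  have J: "prefix_lits k n 0 = {Neg Zv}"
  proof -
    have "k div 2 ^ j = 0" if "n \<le> j" for j
      using n0 that by (metis div_0 div_mult2_eq le_add_diff_inverse power_add)
    then show ?thesis by (auto simp: prefix_lits_def)
  qed
  have "cell k n 0 = {..k}" using n0 div_pow_zero_le by (auto simp: cell_def)
  then obtain T where T: "dmst ?B (insert {Neg Zv} ?N) T" "tsize T \<le> k"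
    using prefix_tree[of 0 k n B F] n1 unfolding J node_cnf_insert(2) by auto
  \<comment> \<open>One of the two points has to be \<open>k + 1\<close>, otherwise
    \<open>Zv\<close> would count as known to be false.\<close>
  let ?A = "gasg k (\<lambda>_. None) False 0 (k + 1)"
  have A: "up_closed ?A ?N" using up_closed_gasg[of 0 "k+1" k False] by (simp add: up_closed_node_cnf)
  have "set [Pos Zv, Pos (Dv 0)] \<in> ?N"
    unfolding N cnf_of_def target_cnf_def gate_clauses_def set_map by (intro imageI) simp
  moreover have "\<not> same_prefix k 0 (k + 1) 0" by (simp add: same_prefix_def)
  ultimately have "active ?N ?A Zv" unfolding active_def
    by (intro conjI bexI[of _ "set [Pos Zv, Pos (Dv 0)]"]) (auto simp: gasg_simps holds_def agree_def)
  then have v: "Zv \<in> vars (U ?N)" using vars_UI fin A by blast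
  have "\<not> up_consistent (insert {Pos Zv} ?N)" unfolding node_cnf_insert(2)
  proof (rule node_cnf_not_consistent)
    fix A assume A: "up_closed A (node_cnf F k {} {Pos Zv} False)"
    have "up_closed_clause A (set [Neg Zv, Pos Qv])" "up_closed_clause A (set [Neg Zv, Neg Qv])"
      by (rule node_cnf_clause[OF A]; simp add: target_cnf_def gate_clauses_def)+
    then show False using A by (auto simp: upc up_closed_node_cnf)
  qed
  then have "dmst ?B (insert {Pos Zv} ?N) Leaf" using dmst_Leaf fin finite_cnf_insert by blast
  then have "dmst ?B ?N (Node Zv T Leaf)"
    using dmst_Node[OF fin] T v A by (auto simp: up_consistent_def target_vars_def)
  then show ?thesis using T N by (metis Suc_eq_plus1 Suc_le_mono add.commute add_0_right plus_1_eq_Suc tsize.simps)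
qed

text \<open>If \<open>Xv\<close> is an optimal root, \<open>counting_tree\<close> leaves at most
  \<open>k\<close> nodes below \<open>Pos Xv\<close>, too few for \<open>k + 2\<close> points, so
  the lower bound must produce a tree of \<open>F\<close>. Conversely every tree has at least
  \<open>k + 1\<close> nodes or pays for both \<open>F\<close> and \<open>Xv\<close>.\<close>

theorem OBV_target_iff_OTS:
  "OBV (cnf_of (target_cnf F k)) (set (target_vars B k)) Xv \<longleftrightarrow> OTS (cnf_of F) (set B) (int k)"
proof -
  have N: "node_cnf F k {} {} False = cnf_of (target_cnf F k)" by (simp add: node_cnf_def units_def)
  let ?N = "cnf_of (target_cnf F k)" and ?B = "set (target_vars B k)"
  have fin: "finite_cnf ?N" using finite_node_cnf[of "{}" "{}" F k False] N by simp
  have F0: "cnf_of F \<union> units {} = cnf_of F" by (simp add: units_def)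
  have pts: "card (points k {}) = k + 2"
  proof -
    have "points k {} = {..k+1}" by (auto simp: points_def)
    then show ?thesis by simp
  qed
  show ?thesis
  proof
    assume "OBV ?N ?B Xv"
    then obtain T where T: "dmst ?B ?N T" "root T = Some Xv" "\<forall>T'. dmst ?B ?N T' \<longrightarrow> tsize T \<le> tsize T'"
      unfolding OBV_def by blast
    then obtain T1 T2 where TT: "T = Node Xv T1 T2" by (cases T) auto
    have "tsize T \<le> k + 1" using T(3) counting_tree order_trans by blast
    then have s: "tsize T2 \<le> k" by (simp add: TT)
    have "dmst ?B (insert {Pos Xv} (node_cnf F k {} {} False)) T2"
      using T(1) TT dmst_Node[OF fin] N by simp
    then obtain T0 where "dmst (set B) (cnf_of F) T0" "tsize T0 \<le> tsize T2"
      using tree_lower_bound[of B k F "{}" "{}" True T2] s pts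
      unfolding node_cnf_insert(3) F0 by auto
    then show "OTS (cnf_of F) (set B) (int k)" unfolding OTS_def using s by (intro exI[of _ T0]) simp
  next
    assume "OTS (cnf_of F) (set B) (int k)"
    then obtain S where S: "dmst (set B) (cnf_of F) S" "tsize S \<le> k" unfolding OTS_def by auto
    \<comment> \<open>\<open>S\<close> need not be optimal, but the tree with root \<open>Xv\<close>
      has to be, so a minimum tree of \<open>F\<close> goes below it.\<close>
    obtain T0 where T0: "dmst (set B) (cnf_of F) T0"
      and min: "\<And>T'. dmst (set B) (cnf_of F) T' \<Longrightarrow> tsize T0 \<le> tsize T'"
      using ex_has_least_nat[of "dmst (set B) (cnf_of F)" S tsize] S(1) by blast
    obtain T where T: "dmst ?B ?N (Node Xv Leaf T)" "tsize T = tsize T0" using gate_tree[OF T0] by blast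
    have "tsize T0 + 1 \<le> tsize T'" if "dmst ?B ?N T'" for T'
    proof -
      have "k + 2 \<le> tsize T' + 1 \<or> (\<exists>T0. dmst (set B) (cnf_of F) T0 \<and> tsize T0 + 1 \<le> tsize T')"
        using tree_lower_bound[of B k F "{}" "{}" False T'] that pts unfolding N F0 by simp
      then show ?thesis using min[OF S(1)] S(2) by (auto dest!: min)
    qed
    then show "OBV ?N ?B Xv" unfolding OBV_def using T
      by (intro conjI exI[of _ "Node Xv Leaf T"]) (auto simp: target_vars_def)
  qed
qed

subsection \<open>Turing machines that append words\<close>

type_synonym 'q machine = "'q \<Rightarrow> nat \<Rightarrow> 'q \<times> nat \<times> dir"
type_synonym 'q emitter = "'q \<Rightarrow> nat \<Rightarrow> 'q \<times> nat \<times> dir \<times> nat list"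

definition head :: "nat list \<Rightarrow> nat" where
  "head rs = (case rs of [] \<Rightarrow> 0 | x # _ \<Rightarrow> x)"

lemma head_simps [simp]: "head [] = 0" "head (x # xs) = x" by (simp_all add: head_def)

fun shift :: "dir \<Rightarrow> nat \<Rightarrow> nat list \<Rightarrow> nat list \<Rightarrow> nat list \<times> nat list" where
  "shift Lft b [] t = ([], b # t)"
| "shift Lft b (l # ls) t = (ls, l # b # t)"
| "shift Rgt b ls t = (b # ls, t)"
| "shift Stay b ls t = (ls, b # t)"

fun mstep :: "'q machine \<Rightarrow> 'q \<Rightarrow> 'q \<times> nat list \<times> nat list \<Rightarrow> 'q \<times> nat list \<times> nat list" where
  "mstep M h (q, ls, rs) =
     (if q = h then (q, ls, rs)
      else case M q (head rs) of (q', b, d) \<Rightarrow> (q', shift d b ls (tl rs)))"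

text \<open>An emitter may, besides an ordinary machine step, append a word at the right end of the used tape.\<close>
fun estep :: "'q emitter \<Rightarrow> 'q \<Rightarrow> 'q \<times> nat list \<times> nat list \<Rightarrow> 'q \<times> nat list \<times> nat list" where
  "estep M h (q, ls, rs) =
     (if q = h then (q, ls, rs)
      else case M q (head rs) of (q', b, d, s) \<Rightarrow> (q', shift d b ls (tl rs @ s)))"

lemma step_eq_mstep: "step M = mstep M 1"
proof
  fix c show "step M c = mstep M 1 c"
    by (cases c)
      (auto simp: Let_def head_def split: prod.split dir.split list.split)
qed

lemma set_shift: "shift d b ls t = (ls', rs') \<Longrightarrow> set ls' \<union> set rs' = insert b (set ls \<union> set t)"
  by (cases "(d, b, ls, t)" rule: shift.cases) auto

lemma length_shift: "shift d b ls t = (ls', rs') \<Longrightarrow> length ls' + length rs' = length ls + length t + 1"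
  by (cases "(d, b, ls, t)" rule: shift.cases) auto

definition machine_ok :: "'q set \<Rightarrow> nat \<Rightarrow> 'q \<Rightarrow> 'q machine \<Rightarrow> bool" where
  "machine_ok A S h M \<longleftrightarrow> (\<forall>q\<in>A - {h}. \<forall>a<S. fst (M q a) \<in> A \<and> fst (snd (M q a)) < S)"

lemma mstep_ok:
  assumes "machine_ok A S h M" "0 < S" "q \<in> A" "set ls \<union> set rs \<subseteq> {..<S}"
    and "mstep M h (q, ls, rs) = (q', ls', rs')"
  shows "q' \<in> A \<and> set ls' \<union> set rs' \<subseteq> {..<S}"
proof (cases "q = h")
  case True then show ?thesis using assms by auto
next
  case False
  obtain p b d where m: "M q (head rs) = (p, b, d)" by (metis prod_cases3)
  have "head rs < S" using assms(2,4) by (cases rs) auto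
  then have "p \<in> A" "b < S" using assms(1,3) False m unfolding machine_ok_def by force+
  moreover have "set (tl rs) \<subseteq> set rs" by (cases rs) auto
  moreover have "q' = p" "shift d b ls (tl rs) = (ls', rs')" using assms(5) False m by auto
  ultimately show ?thesis using set_shift[of d b ls "tl rs" ls' rs'] assms(4) by auto
qed

lemma exists_numbering:
  assumes "finite A" "s \<in> A" "h \<in> A" "s \<noteq> h"
  shows "\<exists>e. inj_on e A \<and> e ` A = {..<card A} \<and> e s = (0::nat) \<and> e h = 1"
proof -
  let ?B = "A - {s, h}"
  obtain g where g: "bij_betw g ?B {0..<card ?B}" using ex_bij_betw_finite_nat assms(1) by blast
  define e where "e x = (if x = s then 0 else if x = h then 1 else g x + 2)" for x
  have cA: "card A = card ?B + 2"
    using assms card_Diff_subset[of "{s,h}" A] card_mono[of A "{s,h}"] by auto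
  have gi: "inj_on g ?B" using g by (auto simp: bij_betw_def)
  have gr: "g x < card ?B" if "x \<in> ?B" for x using g that by (auto simp: bij_betw_def)
  have inj: "inj_on e A"
  proof (rule inj_onI)
    fix x y assume "x \<in> A" "y \<in> A" "e x = e y"
    then show "x = y" using inj_onD[OF gi, of x y] by (auto simp: e_def split: if_splits)
  qed
  have "e ` A \<subseteq> {..<card A}" using gr unfolding cA by (auto simp: e_def)
  moreover have "card (e ` A) = card A" using inj by (rule card_image)
  ultimately have "e ` A = {..<card A}" by (metis card_lessThan card_subset_eq finite_lessThan)
  moreover have "e s = 0" "e h = 1" using assms(4) by (simp_all add: e_def)
  ultimately show ?thesis using inj by blast
qed

lemma machine_to_tm:
  assumes fin: "finite A" and s: "s \<in> A" and h: "h \<in> A" and sh: "s \<noteq> h"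
    and S: "6 < S" and ok: "machine_ok A S h M"
  shows "\<exists>Q M'. wf_tm Q S M' \<and>
    (\<forall>w n ls rs. set w \<subseteq> {..<S} \<longrightarrow> (mstep M h ^^ n) (s, [], w) = (h, ls, rs) \<longrightarrow>
      run M' n w = (1, ls, rs))"
proof -
  obtain e where e: "inj_on e A" "e ` A = {..<card A}" "e s = (0::nat)" "e h = 1"
    using exists_numbering[OF fin s h sh] by blast
  define dec where "dec = the_inv_into A e"
  have dec: "dec (e q) = q" if "q \<in> A" for q unfolding dec_def using e(1) that by (rule the_inv_into_f_f)
  \<comment> \<open>\<open>wf_tm\<close> quantifies over the halting state as well, hence the
    default value in state 1.\<close>
  define M' where "M' i a = (if i = 1 then (1, 0, Stay) else
     case M (dec i) a of (q, b, d) \<Rightarrow> (e q, b, d))" for i a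
  have e1: "e q = 1 \<longleftrightarrow> q = h" if "q \<in> A" for q using e that h by (metis inj_onD)
  have A2: "2 \<le> card A" using card_mono[OF fin, of "{s, h}"] s h sh by auto
  have wf: "wf_tm (card A) S M'"
    unfolding wf_tm_def
  proof (intro conjI allI impI)
    fix i a assume i: "i < card A" and a: "a < S"
    obtain q where q: "q \<in> A" "i = e q" using e(2) i by auto
    obtain q' b d where m: "M q a = (q', b, d)" by (metis prod_cases3)
    have "q = h \<or> q' \<in> A \<and> b < S" using ok q a m unfolding machine_ok_def by force
    then show "fst (M' i a) < card A" "fst (snd (M' i a)) < S"
      unfolding M'_def using A2 S q m e e1 dec by auto
  qed (use A2 S in auto)
  have st: "step M' (e q, ls, rs) = (e q', ls', rs')"
    if "q \<in> A" "mstep M h (q, ls, rs) = (q', ls', rs')" for q ls rs q' ls' rs'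
    using that e1[OF that(1)] dec[OF that(1)]
    by (auto simp: step_eq_mstep M'_def split: if_splits prod.splits)
  have sim: "(step M' ^^ n) (0, [], w) = (e q, ls, rs) \<and> q \<in> A \<and> set ls \<union> set rs \<subseteq> {..<S}"
    if "set w \<subseteq> {..<S}" "(mstep M h ^^ n) (s, [], w) = (q, ls, rs)" for n w q ls rs
    using that(2)
  proof (induction n arbitrary: q ls rs)
    case 0 then show ?case using that(1) s e(3) by auto
  next
    case (Suc n)
    obtain p ls1 rs1 where p: "(mstep M h ^^ n) (s, [], w) = (p, ls1, rs1)" by (metis prod_cases3)
    have m: "mstep M h (p, ls1, rs1) = (q, ls, rs)" using Suc.prems p by simp
    show ?case using Suc.IH[OF p] st[OF _ m] mstep_ok[OF ok _ _ _ m] S by auto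
  qed
  have "run M' n w = (1, ls, rs)"
    if "set w \<subseteq> {..<S}" "(mstep M h ^^ n) (s, [], w) = (h, ls, rs)" for n w ls rs
    unfolding run_def conjunct1[OF sim[OF that]] e(4) ..
  then show ?thesis using wf by (intro exI[of _ "card A"] exI[of _ M'] conjI allI impI)
qed

section \<open>Compiling emitters to Turing machines\<close>

datatype 'q estate = Main 'q | Append 'q dir "nat list" | Return 'q dir

text \<open>The cell to return to is marked by adding \<open>N\<close> to its symbol.\<close>
fun compile :: "nat \<Rightarrow> 'q emitter \<Rightarrow> 'q estate machine" where
  "compile N M (Main q) a = (case M q a of (q', b, d, s) \<Rightarrow>
     if s = [] then (Main q', b, d) else (Append q' d s, b + N, Rgt))"
| "compile N M (Append q d s) a =
     (if a \<noteq> 0 then (Append q d s, a, Rgt)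
      else case s of [] \<Rightarrow> (Main q, 0, Stay)
        | x # s' \<Rightarrow> if s' = [] then (Return q d, x, Lft) else (Append q d s', x, Rgt))"
| "compile N M (Return q d) a = (if a < N then (Return q d, a, Lft) else (Main q, a - N, d))"

text \<open>Reading a blank halts, and no other symbol is overwritten by a blank. So during a run
  the used tape has no gap, and the first blank to the right is its true end.\<close>

definition emitter_ok :: "'q set \<Rightarrow> nat \<Rightarrow> nat \<Rightarrow> 'q \<Rightarrow> 'q emitter \<Rightarrow> bool" where
  "emitter_ok Q N E h M \<longleftrightarrow> (\<forall>q\<in>Q - {h}. \<forall>a<N. \<forall>q' b d s. M q a = (q', b, d, s) \<longrightarrow>
     q' \<in> Q \<and> b < N \<and> set s \<subseteq> {1..<N} \<and> length s \<le> E \<and>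
     (if a = 0 then s = [] \<and> q' = h else b \<noteq> 0))"

lemma emitter_okD:
  assumes "emitter_ok Q N E h M" "q \<in> Q" "q \<noteq> h" "a < N" "M q a = (q', b, d, s)"
  shows "q' \<in> Q" "b < N" "set s \<subseteq> {1..<N}" "length s \<le> E"
    "a = 0 \<Longrightarrow> s = []" "a = 0 \<Longrightarrow> q' = h" "a \<noteq> 0 \<Longrightarrow> b \<noteq> 0"
proof -
  have "q' \<in> Q \<and> b < N \<and> set s \<subseteq> {1..<N} \<and> length s \<le> E \<and> (if a = 0 then s = [] \<and> q' = h else b \<noteq> 0)"
    using assms unfolding emitter_ok_def by blast
  then show "q' \<in> Q" "b < N" "set s \<subseteq> {1..<N}" "length s \<le> E"
    "a = 0 \<Longrightarrow> s = []" "a = 0 \<Longrightarrow> q' = h" "a \<noteq> 0 \<Longrightarrow> b \<noteq> 0" by (auto split: if_splits)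
qed

definition estates :: "'q set \<Rightarrow> nat \<Rightarrow> nat \<Rightarrow> 'q estate set" where
  "estates Q N E = (let W = {s. set s \<subseteq> {1..<N} \<and> length s \<le> E} in
     Main ` Q \<union> (\<lambda>(q, d, s). Append q d s) ` (Q \<times> {Lft, Rgt, Stay} \<times> W) \<union>
     (\<lambda>(q, d). Return q d) ` (Q \<times> {Lft, Rgt, Stay}))"

lemma finite_estates: "finite Q \<Longrightarrow> finite (estates Q N E)"
  unfolding estates_def Let_def by (intro finite_UnI finite_imageI finite_cartesian_product finite_lists_length_le) auto

lemma estates_simps [simp]:
  "Main q \<in> estates Q N E \<longleftrightarrow> q \<in> Q"
  "Append q d s \<in> estates Q N E \<longleftrightarrow> q \<in> Q \<and> set s \<subseteq> {1..<N} \<and> length s \<le> E"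
  "Return q d \<in> estates Q N E \<longleftrightarrow> q \<in> Q"
  by (cases d; auto simp: estates_def Let_def image_iff)+

lemma compile_ok:
  assumes ok: "emitter_ok Q N E h M" and N: "0 < N" 
    and hi: "\<And>q a q' b d s. q \<in> Q - {h} \<Longrightarrow> a \<ge> N \<Longrightarrow> M q a = (q', b, d, s) \<Longrightarrow> q' \<in> Q \<and> b < N \<and> s = []"
  shows "machine_ok (estates Q N E) (2 * N) (Main h) (compile N M)"
  unfolding machine_ok_def
proof (intro ballI allI impI)
  fix p a assume p: "p \<in> estates Q N E - {Main h}" and a: "a < 2 * N"
  show "fst (compile N M p a) \<in> estates Q N E \<and> fst (snd (compile N M p a)) < 2 * N"
  proof (cases p)
    case (Main q)
    then have q: "q \<in> Q - {h}" using p by auto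
    obtain q' b d s where m: "M q a = (q', b, d, s)" by (metis prod_cases4)
    have "q' \<in> Q \<and> b < N \<and> set s \<subseteq> {1..<N} \<and> length s \<le> E"
    proof (cases "a < N")
      case True
      then show ?thesis using emitter_okD(1-4)[OF ok _ _ True m] q by blast
    next
      case False
      then show ?thesis using hi[OF q _ m] by auto
    qed
    then show ?thesis using Main m by auto
  next
    case (Append q d s)
    then show ?thesis using p a by (auto split: list.split)
  next
    case (Return q d)
    then show ?thesis using p a by auto
  qed
qed

lemma funpow_add_apply: "(f ^^ (m + n)) x = (f ^^ n) ((f ^^ m) x)"
  by (metis add.commute comp_apply funpow_add)

lemma append_scan:
  assumes "0 \<notin> set t"
  shows "(mstep (compile N M) (Main h) ^^ length t) (Append q d s, ls, t) = (Append q d s, rev t @ ls, [])"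
  using assms by (induction t arbitrary: ls) (auto simp: funpow_swap1)

lemma append_write:
  assumes "s \<noteq> []"
  shows "(mstep (compile N M) (Main h) ^^ length s) (Append q d s, ls, []) =
    (Return q d, shift Lft (last s) (rev (butlast s) @ ls) [])"
  using assms
proof (induction s arbitrary: ls)
  case (Cons x s)
  show ?case
  proof (cases "s = []")
    case True then show ?thesis by simp
  next
    case False
    have "(mstep (compile N M) (Main h) ^^ length (x # s)) (Append q d (x # s), ls, []) =
      (mstep (compile N M) (Main h) ^^ length s) (Append q d s, x # ls, [])"
      using False by (simp add: funpow_swap1)
    also have "\<dots> = (Return q d, shift Lft (last s) (rev (butlast s) @ x # ls) [])"
      using Cons.IH[OF False, of "x # ls"] by simp
    finally show ?thesis using False by simp
  qed
qed simp

text \<open>\<open>u\<close> lies between the marked cell \<open>c\<close> and the head;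
  \<open>hd\<close> and \<open>tl\<close> describe the tape after a left move also when
  \<open>u\<close> is empty.\<close>

lemma return_scan:
  assumes "set u \<subseteq> {..<N}"
  shows "(mstep (compile N M) (Main h) ^^ length u) (Return q d, tl (u @ c # ls), hd (u @ c # ls) # r) =
    (Return q d, ls, c # rev u @ r)"
  using assms
proof (induction u arbitrary: r)
  case (Cons y u)
  have "(mstep (compile N M) (Main h) ^^ length (y # u)) (Return q d, u @ c # ls, y # r) =
    (mstep (compile N M) (Main h) ^^ length u) (Return q d, tl (u @ c # ls), hd (u @ c # ls) # y # r)"
    using Cons.prems by (cases u) (simp_all add: funpow_swap1)
  also have "\<dots> = (Return q d, ls, c # rev u @ y # r)" using Cons by auto
  finally show ?case by simp
qed simp

lemma shift_Lft_append: "shift Lft x (u @ c # ls) t = (tl (u @ c # ls), hd (u @ c # ls) # x # t)"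
  by (cases u) auto

definition lift_config :: "'q \<times> nat list \<times> nat list \<Rightarrow> 'q estate \<times> nat list \<times> nat list" where
  "lift_config c = (Main (fst c), snd c)"

text \<open>A step costs a walk to the right end, the writing of \<open>s\<close> and the walk back,
  hence twice the length of what lies right of the head.\<close>

lemma simulate_estep:
  assumes ok: "emitter_ok Q N E h M" and q: "q \<in> Q" "q \<noteq> h" and tape: "set rs \<subseteq> {1..<N}" and N: "0 < N"
  shows "\<exists>n \<le> 2 * (length rs + E) + 2.
    (mstep (compile N M) (Main h) ^^ n) (Main q, ls, rs) = lift_config (estep M h (q, ls, rs))"
proof -
  obtain q' b d s where m: "M q (head rs) = (q', b, d, s)" by (metis prod_cases4)
  have hd: "head rs < N" using tape N by (cases rs) auto
  note o = emitter_okD(2-5)[OF ok q hd m]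
  let ?m = "mstep (compile N M) (Main h)"
  show ?thesis
  proof (cases "s = []")
    case True
    then have "(?m ^^ 1) (Main q, ls, rs) = lift_config (estep M h (q, ls, rs))"
      using m q by (simp add: lift_config_def)
    then show ?thesis by (intro exI[of _ 1]) simp
  next
    case False
    then obtain a t where rs: "rs = a # t" using o(4) by (cases rs) auto
    have t: "0 \<notin> set t" "set t \<subseteq> {..<N}" using tape rs by auto
    have s1: "(?m ^^ 1) (Main q, ls, rs) = (Append q' d s, (b + N) # ls, t)"
      using m q rs False by simp
    let ?u = "rev (butlast s) @ rev t"
    have "set (butlast s) \<subseteq> {..<N}" using o(2) by (meson atLeastLessThan_iff in_set_butlastD lessThan_iff subset_iff)
    then have u: "set ?u \<subseteq> {..<N}" using t by auto
    have s3: "(?m ^^ length s) (Append q' d s, rev t @ (b + N) # ls, []) =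
      (Return q' d, tl (?u @ (b + N) # ls), hd (?u @ (b + N) # ls) # [last s])"
      using append_write[OF False, where ls = "rev t @ (b + N) # ls"] shift_Lft_append[of "last s" ?u] by simp
    have s4: "(?m ^^ length ?u) (Return q' d, tl (?u @ (b + N) # ls), hd (?u @ (b + N) # ls) # [last s]) =
      (Return q' d, ls, (b + N) # t @ s)"
      using return_scan[OF u, where r = "[last s]" and c = "b + N" and ls = ls] False by simp
    have s5: "(?m ^^ 1) (Return q' d, ls, (b + N) # t @ s) = (Main q', shift d b ls (t @ s))" by simp
    have "(?m ^^ (1 + length t + length s + length ?u + 1)) (Main q, ls, rs) =
      (Main q', shift d b ls (t @ s))"
      unfolding funpow_add_apply s1 append_scan[OF t(1)] s3 s4 s5 ..
    moreover have "(Main q', shift d b ls (t @ s)) = lift_config (estep M h (q, ls, rs))"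
      using m q rs by (simp add: lift_config_def)
    moreover have "1 + length t + length s + length ?u + 1 \<le> 2 * (length rs + E) + 2"
      using o(3) rs by simp
    ultimately show ?thesis by metis
  qed
qed

lemma estep_ok:
  assumes ok: "emitter_ok Q N E h M" and N: "0 < N"
    and q: "q \<in> Q" and tape: "q \<noteq> h \<Longrightarrow> set ls \<union> set rs \<subseteq> {1..<N}"
    and e: "estep M h (q, ls, rs) = (q', ls', rs')"
  shows "q' \<in> Q \<and> (q' \<noteq> h \<longrightarrow> set ls' \<union> set rs' \<subseteq> {1..<N} \<and>
    length ls' + length rs' \<le> length ls + length rs + E)"
proof (cases "q = h")
  case True then show ?thesis using q e by auto
next
  case False
  obtain p b d s where m: "M q (head rs) = (p, b, d, s)" by (metis prod_cases4)
  have t: "set ls \<union> set rs \<subseteq> {1..<N}" using tape False by blast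
  have hd: "head rs < N" using t N by (cases rs) auto
  note o = emitter_okD(1-4,6,7)[OF ok q False hd m]
  have e': "q' = p" "shift d b ls (tl rs @ s) = (ls', rs')" using e m False by auto
  show ?thesis
  proof (cases rs)
    case Nil then show ?thesis using o e' by simp
  next
    case (Cons a r)
    then show ?thesis
      using o e' t set_shift[OF e'(2)] length_shift[OF e'(2)] by auto
  qed
qed

lemma simulate_run:
  assumes ok: "emitter_ok Q N E h M" and N: "0 < N"
    and q: "q \<in> Q" and tape: "set w \<subseteq> {1..<N}"
  shows "\<exists>m \<le> n * (2 * (length w + n * E + E) + 2). \<exists>q' ls rs.
    (estep M h ^^ n) (q, [], w) = (q', ls, rs) \<and>
    (mstep (compile N M) (Main h) ^^ m) (Main q, [], w) = (Main q', ls, rs) \<and> q' \<in> Q \<and>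
    (q' \<noteq> h \<longrightarrow> set ls \<union> set rs \<subseteq> {1..<N} \<and> length ls + length rs \<le> length w + n * E)"
proof (induction n)
  case 0 then show ?case using q tape by auto
next
  case (Suc n)
  let ?m = "mstep (compile N M) (Main h)"
  obtain m p ls rs where m: "m \<le> n * (2 * (length w + n * E + E) + 2)"
    "(estep M h ^^ n) (q, [], w) = (p, ls, rs)" "(?m ^^ m) (Main q, [], w) = (Main p, ls, rs)" "p \<in> Q"
    "p \<noteq> h \<longrightarrow> set ls \<union> set rs \<subseteq> {1..<N} \<and> length ls + length rs \<le> length w + n * E"
    using Suc by blast
  obtain p' ls' rs' where e: "estep M h (p, ls, rs) = (p', ls', rs')" by (metis prod_cases3)
  have inv: "p' \<in> Q \<and> (p' \<noteq> h \<longrightarrow> set ls' \<union> set rs' \<subseteq> {1..<N} \<and> length ls' + length rs' \<le> length w + Suc n * E)"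
  proof (cases "p = h")
    case True then show ?thesis using e m(4) by auto
  next
    case False
    then show ?thesis using estep_ok[OF ok N m(4) _ e] m(5) by auto
  qed
  have "\<exists>j \<le> 2 * (length w + n * E + E) + 2. (?m ^^ j) (Main p, ls, rs) = (Main p', ls', rs')"
  proof (cases "p = h")
    case True then show ?thesis using e by (intro exI[of _ 0]) auto
  next
    case False
    then obtain j where "j \<le> 2 * (length rs + E) + 2" "(?m ^^ j) (Main p, ls, rs) = (Main p', ls', rs')"
      using simulate_estep[OF ok m(4) False _ N, of rs ls] m(5) e by (auto simp: lift_config_def)
    moreover have "length rs \<le> length w + n * E" using m(5) False by simp
    ultimately show ?thesis by (intro exI[of _ j]) auto
  qed
  then obtain j where j: "j \<le> 2 * (length w + n * E + E) + 2" "(?m ^^ j) (Main p, ls, rs) = (Main p', ls', rs')" by blast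
  have "(?m ^^ (m + j)) (Main q, [], w) = (Main p', ls', rs')" unfolding funpow_add_apply m(3) j(2) ..
  moreover have "m + j \<le> Suc n * (2 * (length w + Suc n * E + E) + 2)"
  proof -
    let ?k = "2 * (length w + n * E + E) + 2" and ?k' = "2 * (length w + Suc n * E + E) + 2"
    have "m + j \<le> Suc n * ?k" using m(1) j(1) by simp
    also have "\<dots> \<le> Suc n * ?k'" by (intro mult_le_mono2) simp
    finally show ?thesis .
  qed
  moreover have "(estep M h ^^ Suc n) (q, [], w) = (p', ls', rs')" using m(2) e by simp
  ultimately show ?case using inv by blast
qed

text \<open>\<open>n\<close> emitter steps each cost time linear in a tape of length at most
  \<open>m + n * E\<close>; with \<open>n\<close> quadratic this is quartic. The factor 16 comes
  from \<open>(m + 1) ^ 4 \<le> (2 * m) ^ 4\<close> for positive \<open>m\<close>; the additive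
  constant covers \<open>m = 0\<close>.\<close>

lemma poly_bound:
  fixes n m :: nat
  assumes "n \<le> C * (m + 1) ^ 2"
  shows "n * (2 * (m + n * E + E) + 2) \<le>
    (16 * (C * (2 * (1 + C * E + E) + 2))) * m ^ 4 + 16 * (C * (2 * (1 + C * E + E) + 2))"
proof -
  define s where "s = (m + 1) ^ 2"
  let ?K = "C * (2 * (1 + C * E + E) + 2)"
  have s1: "1 \<le> s" "m \<le> s" by (simp_all add: s_def power2_eq_square)
  have n: "n \<le> C * s" using assms by (simp add: s_def)
  have "m + n * E + E \<le> s + C * s * E + s * E"
    using s1 n by (intro add_mono mult_right_mono) auto
  moreover have "2 \<le> 2 * s" using s1 by simp
  ultimately have "2 * (m + n * E + E) + 2 \<le> 2 * (s + C * s * E + s * E) + 2 * s"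
    by (rule add_mono[OF mult_le_mono2])
  also have "\<dots> = (2 * (1 + C * E + E) + 2) * s" by (simp add: algebra_simps)
  finally have "n * (2 * (m + n * E + E) + 2) \<le> (C * s) * ((2 * (1 + C * E + E) + 2) * s)"
    using n by (intro mult_le_mono)
  also have "\<dots> = ?K * (s * s)" by (simp add: algebra_simps)
  also have "s * s = (m + 1) ^ 4" unfolding s_def by (simp flip: power_add)
  also have "?K * (m + 1) ^ 4 \<le> ?K * (16 * m ^ 4 + 16)"
  proof (intro mult_le_mono2)
    show "(m + 1) ^ 4 \<le> 16 * m ^ 4 + 16"
    proof (cases "m = 0")
      case False
      then have "(m + 1) ^ 4 \<le> (2 * m) ^ 4" by (intro power_mono) auto
      then show ?thesis by (simp add: power_mult_distrib)
    qed simp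
  qed
  also have "\<dots> = 16 * ?K * m ^ 4 + 16 * ?K" by (simp add: algebra_simps)
  finally show ?thesis .
qed

theorem emitter_poly_time:
  assumes fin: "finite Q" and q: "q \<in> Q" and h: "h \<in> Q" and qh: "q \<noteq> h" and N: "6 < N"
    and ok: "emitter_ok Q N E h M"
    and time: "\<And>w. w \<in> lists input_alphabet \<Longrightarrow> \<exists>n \<le> C * (length w + 1) ^ 2. \<exists>ls rs.
      (estep M h ^^ n) (q, [], w) = (h, ls, rs) \<and> takeWhile (\<lambda>a. a \<noteq> 0) rs = f w"
  shows "poly_time_computable f"
proof -
  \<comment> \<open>Marking doubles the alphabet, and a well-formed machine must be defined on
    marked symbols too. The program never reads them in a \<open>Main\<close> state, so any value
    serves.\<close>
  define M1 where "M1 p a = (if a < N then M p a else (h, 0, Stay, []))" for p a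
  have ok1: "emitter_ok Q N E h M1"
    unfolding emitter_ok_def
  proof (intro ballI allI impI)
    fix p a q' b d s assume p: "p \<in> Q - {h}" and a: "a < N" and "M1 p a = (q', b, d, s)"
    then have m: "M p a = (q', b, d, s)" by (simp add: M1_def)
    show "q' \<in> Q \<and> b < N \<and> set s \<subseteq> {1..<N} \<and> length s \<le> E \<and> (if a = 0 then s = [] \<and> q' = h else b \<noteq> 0)"
      using emitter_okD[OF ok _ _ a m] p by simp
  qed
  have mok: "machine_ok (estates Q N E) (2 * N) (Main h) (compile N M1)"
    by (rule compile_ok[OF ok1]) (use N h in \<open>auto simp: M1_def\<close>)
  have "\<exists>S M'. wf_tm S (2 * N) M' \<and> (\<forall>w n ls rs. set w \<subseteq> {..<2 * N} \<longrightarrow>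
      (mstep (compile N M1) (Main h) ^^ n) (Main q, [], w) = (Main h, ls, rs) \<longrightarrow> run M' n w = (1, ls, rs))"
    by (rule machine_to_tm[OF finite_estates[OF fin] _ _ _ _ mok]) (use q h qh N in simp_all)
  then obtain S M' where M': "wf_tm S (2 * N) M'" "\<forall>w n ls rs. set w \<subseteq> {..<2 * N} \<longrightarrow>
      (mstep (compile N M1) (Main h) ^^ n) (Main q, [], w) = (Main h, ls, rs) \<longrightarrow> run M' n w = (1, ls, rs)"
    by (elim exE conjE)
  let ?c = "16 * (C * (2 * (1 + C * E + E) + 2))"
  have "\<exists>n \<le> ?c * length w ^ 4 + ?c. fst (run M' n w) = 1 \<and> tm_output (run M' n w) = f w"
    if w: "w \<in> lists input_alphabet" for w
  proof -
    have sw: "set w \<subseteq> {1..<N}" using w N unfolding input_alphabet_def by auto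
    obtain n ls rs where n: "n \<le> C * (length w + 1) ^ 2" "(estep M h ^^ n) (q, [], w) = (h, ls, rs)"
      "takeWhile (\<lambda>a. a \<noteq> 0) rs = f w" using time[OF w] by blast
    have "(estep M1 h ^^ i) (q, [], w) = (estep M h ^^ i) (q, [], w)" for i
    proof (induction i)
      case (Suc i)
      obtain m p ls rs where p: "(estep M h ^^ i) (q, [], w) = (p, ls, rs)"
        "p \<noteq> h \<longrightarrow> set ls \<union> set rs \<subseteq> {1..<N}"
        using simulate_run[OF ok _ q sw, of i] N by auto
      have "head rs < N" if "p \<noteq> h" using p(2) that N by (cases rs) auto
      then have "estep M1 h (p, ls, rs) = estep M h (p, ls, rs)" by (simp add: M1_def)
      then show ?case using Suc p(1) by simp
    qed simp
    then obtain m where m: "m \<le> n * (2 * (length w + n * E + E) + 2)"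
      "(mstep (compile N M1) (Main h) ^^ m) (Main q, [], w) = (Main h, ls, rs)"
      using simulate_run[OF ok1 _ q sw, of n] n(2) N by auto
    have "set w \<subseteq> {..<2 * N}" using sw by force
    then have "run M' m w = (1, ls, rs)" using M'(2) m(2) by blast
    moreover have "m \<le> ?c * length w ^ 4 + ?c" using m(1) poly_bound[OF n(1)] order_trans by blast
    ultimately show ?thesis using n(3) by (intro exI[of _ m]) (simp add: tm_output_def)
  qed
  then show ?thesis unfolding poly_time_computable_def using M'(1) by blast
qed

subsection \<open>A program computing the reduction\<close>

text \<open>The encodings form a regular language, so a finite automaton can check the format:
  \<open>S0\<close>, \<open>L0\<close>, \<open>L1\<close> read the clauses, \<open>BS\<close>,
  \<open>B1\<close>, \<open>B2\<close> the variable list, \<open>K0\<close>, \<open>K1\<close>,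
  \<open>K2\<close> the bound.\<close>

datatype scan_state = S0 | L0 | L1 | BS | B1 | B2 | K0 | K1 | K2 | Reject

text \<open>In \<open>L1\<close>, \<open>B1\<close>, \<open>K1\<close> the last symbol read was a bit \<open>0\<close>, so the number must go on;
  in \<open>L0\<close>, \<open>B2\<close>, \<open>K2\<close> it may end. Only \<open>K2\<close> accepts, so negative \<open>k\<close> is rejected like a malformed word.\<close>
fun scan :: "scan_state \<Rightarrow> nat \<Rightarrow> scan_state" where
  "scan S0 a = (if a = 3 \<or> a = 4 then L0 else if a = 5 then S0 else if a = 6 then BS else Reject)"
| "scan L0 a = (if a = 1 then L1 else if a = 2 \<or> a = 3 \<or> a = 4 then L0 else if a = 5 then S0 else Reject)"
| "scan L1 a = (if a = 1 then L1 else if a = 2 then L0 else Reject)"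
| "scan BS a = (if a = 1 then B1 else if a = 2 then B2 else if a = 5 then BS else if a = 6 then K0 else Reject)"
| "scan B1 a = (if a = 1 then B1 else if a = 2 then B2 else Reject)"
| "scan B2 a = (if a = 1 then B1 else if a = 2 then B2 else if a = 5 then BS else Reject)"
| "scan K0 a = (if a = 3 then K2 else Reject)"
| "scan K1 a = (if a = 1 then K1 else if a = 2 then K2 else Reject)"
| "scan K2 a = (if a = 1 then K1 else if a = 2 then K2 else Reject)"
| "scan Reject a = Reject"

definition guard_word :: "nat list" where
  "guard_word = enc_lit (Neg X1v) @ enc_lit (Neg X2v)"

definition gate_word :: "nat list" where
  "gate_word = concat (map enc_clause gate_clauses) @ [6]"

definition final_word :: "nat list" where
  "final_word = concat (map (\<lambda>v. enc_nat v @ [5]) [Xv, Zv]) @ [6] @ enc_nat Xv"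

text \<open>\<open>Fv\<close> puts the symbol 2 in front of the code of a variable, so renaming on
  the fly means writing 2 after each sign.\<close>

definition cnf_word :: "scan_state \<Rightarrow> nat \<Rightarrow> nat list" where
  "cnf_word q a = (if q \<in> {S0, L0, L1} then
     (if a = 3 \<or> a = 4 then [a, 2] else if a = 5 then guard_word @ [5] else if a = 1 \<or> a = 2 then [a] else [])
     else [])"

definition vars_word :: "scan_state \<Rightarrow> nat \<Rightarrow> nat list" where
  "vars_word q a = (if a \<in> {1, 2, 5} then (if q = BS then [2, a] else if q = B1 \<or> q = B2 then [a] else []) else [])"

text \<open>A template item \<open>(s, c)\<close> at a digit of \<open>k\<close> stands for \<open>s\<close> followed by the digits from the
  current one on (if \<open>c\<close>) or from the next one on; this is how the names \<open>Dv (k div 2 ^ i)\<close> etc. are written.\<close>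
type_synonym template = "(nat list \<times> bool) list"

text \<open>Used at the sign cell of \<open>k\<close>, where the digits from the next cell on are
  all of \<open>k\<close>; \<open>[4, 1, 2]\<close> is a negative sign followed by the tag of
  \<open>Dv\<close>.\<close>

definition conflict_items :: template where
  "conflict_items = [(enc_lit (Pos Qv) @ [4, 1, 2], False), ([5] @ enc_lit (Neg Qv) @ [4, 1, 2], False)]"

text \<open>The tags of \<open>Dv\<close>, \<open>Ev\<close>, \<open>Yv\<close> are
  \<open>1 2\<close>, \<open>1 1 2\<close>, \<open>1 1 1 2\<close>. A name built on
  \<open>a div 2\<close> uses the tail from the next digit, one built on \<open>a\<close> the tail
  from the current digit. The closing 5 of the last clause is written when the cell is left.\<close>

definition items :: "bool \<Rightarrow> nat \<Rightarrow> template" where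
  "items m b = (if m then [([1, 1, 1, 2], True)] else
    [([4, 1, 2], False), ([4, 1, 1, 1, 2], True), ([3, 1, 2], True),
     ([5, 4, 1, 2], False), ([3, 1, 1, 1, 2], True), ([3, 1, 2], True)] @
    (if b = 2 then [([5, 4, 1, 1, 2], False), ([4, 1, 1, 1, 2], True), ([3, 1, 1, 2], True)]
     else [([5, 4, 1, 1, 2], False), ([4, 1, 1, 1, 2], True), ([5, 4, 1, 1, 2], False), ([3, 1, 1, 2], True)]))"

datatype state = Start | Halt | Scan scan_state | Fail | ToSign | Loop bool | Items bool template
  | Copy bool template | Rewind bool template | Back1 | Back2 | VarScan scan_state

text \<open>The tape holds the input, the separator 7 and the output so far. The scan translates the
  clauses while it checks the format; the digits of \<open>k\<close> are swept once for clauses and,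
  after the variable list has been reread, once for names. Symbols above 8 mark the cell whose tail
  is being copied.\<close>

fun prog1 :: "state \<Rightarrow> nat \<Rightarrow> state \<times> nat \<times> dir \<times> nat list" where
  "prog1 Start a = (Scan S0, a, Stay, [7])"
| "prog1 Halt a = (Halt, a, Stay, [])"
| "prog1 (Scan q) a = (if a = 7 then (if q = K2 then (ToSign, 7, Lft, []) else (Fail, 7, Rgt, []))
     else (Scan (scan q a), a, Rgt, cnf_word q a))"
| "prog1 Fail a = (Fail, a, Rgt, [])"
| "prog1 ToSign a = (if a = 3 then (Items False conflict_items, 3, Stay, []) else (ToSign, a, Lft, []))"
| "prog1 (Loop m) a = (if a = 7 then (if m then (Halt, 7, Rgt, final_word) else (Back1, 7, Lft, gate_word))
     else (Items m (items m a), a, Stay, []))"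
| "prog1 (Items m []) a = (Loop m, a, Rgt, [5])"
| "prog1 (Items m ((s, c) # its)) a =
     (if a \<le> 3 then (Copy m its, a + 8, Rgt, s @ (if c then [a] else [])) else (Halt, a, Stay, []))"
| "prog1 (Copy m its) a = (if a = 7 then (Rewind m its, 7, Lft, []) else (Copy m its, a, Rgt, [a]))"
| "prog1 (Rewind m its) a = (if a > 8 then (Items m its, a - 8, Stay, []) else (Rewind m its, a, Lft, []))"
| "prog1 Back1 a = (if a = 6 then (Back2, 6, Lft, []) else (Back1, a, Lft, []))"
| "prog1 Back2 a = (if a = 6 then (VarScan BS, 6, Rgt, []) else (Back2, a, Lft, []))"
| "prog1 (VarScan q) a = (if q = K0 then (Loop True, a, Rgt, []) else (VarScan (scan q a), a, Rgt, vars_word q a))"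

definition prog :: "state \<Rightarrow> nat \<Rightarrow> state \<times> nat \<times> dir \<times> nat list" where
  "prog q a = (if a = 0 then (Halt, 0, Stay, []) else prog1 q a)"

fun tails :: "'a list \<Rightarrow> 'a list set" where
  "tails [] = {[]}"
| "tails (x # xs) = insert (x # xs) (tails xs)"

lemma finite_tails [simp]: "finite (tails l)" by (induction l) auto
lemma tails_refl [simp]: "l \<in> tails l" by (cases l) auto
lemma tails_Cons: "x # xs \<in> tails l \<Longrightarrow> xs \<in> tails l" by (induction l) auto
lemma tails_subset: "xs \<in> tails l \<Longrightarrow> set xs \<subseteq> set l" by (induction l) auto

text \<open>Closed under dropping the first item, so the pending items can be stored in the state.
  Symbols 1 and 2 cover all cases, since \<open>items m b\<close> only asks whether
  \<open>b = 2\<close>.\<close>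

definition templates :: "template set" where
  "templates = tails conflict_items \<union> (\<Union>m. \<Union>b\<in>{1, 2}. tails (items m b))"

definition states :: "state set" where
  "states = {Start, Halt, Fail, ToSign, Back1, Back2} \<union> range Scan \<union> range VarScan \<union> range Loop \<union>
     (\<Union>m. Items m ` templates \<union> Copy m ` templates \<union> Rewind m ` templates)"

lemma scan_state_UNIV: "UNIV = {S0, L0, L1, BS, B1, B2, K0, K1, K2, Reject}"
  by (auto intro: scan_state.exhaust)

lemma finite_states: "finite states"
  unfolding states_def templates_def scan_state_UNIV UNIV_bool by simp

lemma items_template: "items m b \<in> templates"
proof -
  have "items m b = items m 1 \<or> items m b = items m 2" by (simp add: items_def)
  then have "items m b \<in> (\<Union>b\<in>{1, 2}. tails (items m b))" by (metis UN_I insertI1 insertI2 tails_refl)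
  then show ?thesis unfolding templates_def by blast
qed

lemma templates_Cons: "x # its \<in> templates \<Longrightarrow> its \<in> templates"
  by (auto simp: templates_def dest: tails_Cons)

lemma states_simps [simp]:
  "Start \<in> states" "Halt \<in> states" "Fail \<in> states" "ToSign \<in> states" "Back1 \<in> states" "Back2 \<in> states"
  "Scan q \<in> states" "VarScan q \<in> states" "Loop m \<in> states"
  "Items m its \<in> states \<longleftrightarrow> its \<in> templates" "Copy m its \<in> states \<longleftrightarrow> its \<in> templates"
  "Rewind m its \<in> states \<longleftrightarrow> its \<in> templates"
  unfolding states_def by auto

lemma set_enc_nat: "set (enc_nat n) \<subseteq> {1, 2}"
proof (induction n rule: enc_nat.induct)
  case (1 n) then show ?case by (subst enc_nat.simps) auto
qed

declare enc_nat.simps [simp del]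

lemma set_enc_lit: "set (enc_lit l) \<subseteq> {1..6}"
  using set_enc_nat by (cases l) force+

lemma set_enc_clause: "set (enc_clause C) \<subseteq> {1..6}"
  using set_enc_lit by (auto simp: enc_clause_def)

lemma set_words:
  "set guard_word \<subseteq> {1..6}" "set gate_word \<subseteq> {1..6}" "set final_word \<subseteq> {1..6}"
  using set_enc_lit set_enc_clause set_enc_nat
  by (fastforce simp: guard_word_def gate_word_def final_word_def)+

lemma set_cnf_word: "set (cnf_word q a) \<subseteq> {1..6}"
  using set_words by (auto simp: cnf_word_def)

lemma set_vars_word: "set (vars_word q a) \<subseteq> {1..6}"
  by (auto simp: vars_word_def)

lemma set_template:
  assumes "its \<in> templates" "(s, c) \<in> set its" shows "set s \<subseteq> {1..6}"
proof -
  have c: "\<forall>(s, c)\<in>set conflict_items. set s \<subseteq> {1..6}"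
    using set_enc_lit[of "Pos Qv"] set_enc_lit[of "Neg Qv"] unfolding conflict_items_def by simp
  have i: "\<forall>(s, c)\<in>set (items m b). set s \<subseteq> {1..6}" for m b
    unfolding items_def by auto
  consider "its \<in> tails conflict_items" | m b where "its \<in> tails (items m b)"
    using assms(1) unfolding templates_def by blast
  then show ?thesis
    by cases (use c i tails_subset assms(2) in blast)+
qed

definition max_word :: nat where
  "max_word = Max ((\<lambda>(q, a). length (snd (snd (snd (prog q a))))) ` (states \<times> {..<12}))"

lemma prog1_ok:
  assumes q: "q \<in> states" and a: "0 < a" "a < 12" and p: "prog1 q a = (q', b, d, s)"
  shows "q' \<in> states \<and> 0 < b \<and> b < 12 \<and> set s \<subseteq> {1..<12}"
proof -
  have w: "set guard_word \<subseteq> {1..<12}" "set gate_word \<subseteq> {1..<12}" "set final_word \<subseteq> {1..<12}"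
    "set (cnf_word r e) \<subseteq> {1..<12}" "set (vars_word r e) \<subseteq> {1..<12}" for r e
    using set_words set_cnf_word[of r e] set_vars_word[of r e] by fastforce+
  have t: "its \<in> templates \<Longrightarrow> (s, c) \<in> set its \<Longrightarrow> set s \<subseteq> {1..<12}" for its s c
    using set_template by fastforce
  have ci: "conflict_items \<in> templates" by (simp add: templates_def)
  note w' = w[unfolded One_nat_def]
  show ?thesis
  proof (cases q)
    case (Items m its)
    show ?thesis
    proof (cases its)
      case Nil
      then show ?thesis using Items p a by auto
    next
      case (Cons i its')
      obtain s' c where i: "i = (s', c)" by (cases i)
      have "set s' \<subseteq> {Suc 0..<12}" "its' \<in> templates"
        using q t[of its s' c] Items Cons i templates_Cons[of i its'] by auto
      then show ?thesis using Items Cons i p a by (fastforce split: if_splits)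
    qed
  next
    case (Loop m)
    then show ?thesis using p a items_template[of m a] by (auto dest!: w'[THEN subsetD] split: if_splits)
  next
    case ToSign
    then show ?thesis using p a ci by (auto split: if_splits)
  qed (use p a q in \<open>auto dest!: w'[THEN subsetD] split: if_splits\<close>)
qed

lemma prog_ok: "emitter_ok states 12 max_word Halt prog"
  unfolding emitter_ok_def
proof (intro ballI allI impI)
  fix q a q' b d s assume q: "q \<in> states - {Halt}" and a: "a < (12::nat)" and p: "prog q a = (q', b, d, s)"
  have "length s \<le> max_word" unfolding max_word_def
    by (rule Max_ge) (use finite_states q a p in \<open>auto intro!: rev_image_eqI[of "(q, a)"]\<close>)
  then show "q' \<in> states \<and> b < 12 \<and> set s \<subseteq> {1..<12} \<and> length s \<le> max_word \<and>
      (if a = 0 then s = [] \<and> q' = Halt else b \<noteq> 0)"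
    using p prog1_ok[of q a q' b d s] q a unfolding prog_def by (auto split: if_splits)
qed

section \<open>Runs of the program\<close>

definition reaches :: "nat \<Rightarrow> state \<times> nat list \<times> nat list \<Rightarrow> state \<times> nat list \<times> nat list \<Rightarrow> bool" where
  "reaches t c c' \<longleftrightarrow> (\<exists>n\<le>t. (estep prog Halt ^^ n) c = c')"

lemma reaches_refl [simp]: "reaches t c c"
  unfolding reaches_def by (intro exI[of _ 0]) simp

lemma reaches_trans: "reaches s c c' \<Longrightarrow> reaches t c' c'' \<Longrightarrow> reaches (s + t) c c''"
  unfolding reaches_def by (metis add_mono funpow_add_apply)

lemma reaches_mono: "reaches s c c' \<Longrightarrow> s \<le> t \<Longrightarrow> reaches t c c'"
  unfolding reaches_def using le_trans by blast

lemma reaches_step: "estep prog Halt c = c' \<Longrightarrow> reaches t c' c'' \<Longrightarrow> reaches (Suc t) c c''"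
proof -
  assume s: "estep prog Halt c = c'" and r: "reaches t c' c''"
  have "reaches 1 c c'" unfolding reaches_def using s by (intro exI[of _ 1]) simp
  then show ?thesis using reaches_trans[OF _ r] by fastforce
qed

fun emit :: "(scan_state \<Rightarrow> nat \<Rightarrow> nat list) \<Rightarrow> scan_state \<Rightarrow> nat list \<Rightarrow> nat list" where
  "emit w q [] = []"
| "emit w q (a # u) = w q a @ emit w (scan q a) u"

lemma scan_walk:
  assumes "set u \<subseteq> {1..6}"
  shows "reaches (length u) (Scan q, ls, u @ r) (Scan (foldl scan q u), rev u @ ls, r @ emit cnf_word q u)"
  using assms
proof (induction u arbitrary: q ls r)
  case (Cons a u)
  have st: "estep prog Halt (Scan q, ls, (a # u) @ r) = (Scan (scan q a), a # ls, u @ (r @ cnf_word q a))"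
    using Cons.prems by (auto simp: prog_def)
  then show ?case using reaches_step[OF st Cons.IH] Cons.prems by simp
qed simp

lemma var_scan_walk:
  assumes "set u \<subseteq> {1, 2, 5}" "q \<noteq> K0"
  shows "reaches (length u) (VarScan q, ls, u @ r) (VarScan (foldl scan q u), rev u @ ls, r @ emit vars_word q u)"
  using assms
proof (induction u arbitrary: q ls r)
  case (Cons a u)
  have st: "estep prog Halt (VarScan q, ls, (a # u) @ r) = (VarScan (scan q a), a # ls, u @ (r @ vars_word q a))"
    using Cons.prems by (auto simp: prog_def)
  have "scan q a \<noteq> K0" using Cons.prems by (cases q) auto
  then show ?case using reaches_step[OF st Cons.IH] Cons.prems by simp
qed simp

lemma copy_walk:
  assumes "set u \<subseteq> {1, 2}"
  shows "reaches (length u) (Copy m its, ls, u @ r) (Copy m its, rev u @ ls, r @ u)"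
  using assms
proof (induction u arbitrary: ls r)
  case (Cons a u)
  have st: "estep prog Halt (Copy m its, ls, (a # u) @ r) = (Copy m its, a # ls, u @ (r @ [a]))"
    using Cons.prems by (auto simp: prog_def)
  then show ?case using reaches_step[OF st Cons.IH] Cons.prems by simp
qed simp

lemma fail_walk:
  assumes "0 \<notin> set u"
  shows "reaches (length u) (Fail, ls, u) (Fail, rev u @ ls, [])"
  using assms
proof (induction u arbitrary: ls)
  case (Cons a u)
  have st: "estep prog Halt (Fail, ls, a # u) = (Fail, a # ls, u)"
    using Cons.prems by (auto simp: prog_def)
  then show ?case using reaches_step[OF st Cons.IH] Cons.prems by simp
qed simp

lemma left_walk:
  assumes "p \<noteq> Halt" "\<And>a. a \<in> set u \<Longrightarrow> prog p a = (p, a, Lft, [])"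
  shows "reaches (length u) (p, tl (u @ c # ls), hd (u @ c # ls) # r) (p, ls, c # rev u @ r)"
  using assms(2)
proof (induction u arbitrary: r)
  case (Cons y u)
  have st: "estep prog Halt (p, u @ c # ls, y # r) = (p, tl (u @ c # ls), hd (u @ c # ls) # y # r)"
    using Cons.prems assms(1) shift_Lft_append by simp
  then show ?case using reaches_step[OF st Cons.IH] Cons.prems by simp
qed simp

lemma turn_left:
  assumes "q \<noteq> Halt" "prog q x = (p, y, Lft, s)" "p \<noteq> Halt" "\<And>a. a \<in> set u \<Longrightarrow> prog p a = (p, a, Lft, [])"
  shows "reaches (Suc (length u)) (q, u @ c # ls, x # r) (p, ls, c # rev u @ y # r @ s)"
proof -
  have st: "estep prog Halt (q, u @ c # ls, x # r) = (p, tl (u @ c # ls), hd (u @ c # ls) # y # r @ s)"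
    using assms(1,2) shift_Lft_append by simp
  show ?thesis using reaches_step[OF st left_walk[OF assms(3,4)]] by simp
qed

definition item_word :: "nat \<Rightarrow> nat list \<Rightarrow> nat list \<times> bool \<Rightarrow> nat list" where
  "item_word b bs i = fst i @ (if snd i then [b] else []) @ bs"

text \<open>The cell \<open>b\<close> is a digit or, for the conflict clauses, the sign 3. Each item
  marks it, copies the digits up to 7 and returns.\<close>

lemma items_run:
  assumes b: "b \<in> {1, 2, 3}" and bs: "set bs \<subseteq> {1, 2}"
  shows "reaches (length its * (2 * length bs + 4)) (Items m its, R, b # bs @ 7 # r)
    (Items m [], R, b # bs @ 7 # r @ concat (map (item_word b bs) its))"
proof (induction its arbitrary: r)
  case (Cons i its)
  obtain s c where i: "i = (s, c)" by (cases i)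
  let ?r = "r @ s @ (if c then [b] else [])"
  have 1: "estep prog Halt (Items m (i # its), R, b # bs @ 7 # r) = (Copy m its, (b + 8) # R, bs @ 7 # ?r)"
    using b i by (auto simp: prog_def)
  have 2: "reaches (length bs) (Copy m its, (b + 8) # R, bs @ 7 # ?r) (Copy m its, rev bs @ (b + 8) # R, 7 # ?r @ bs)"
    using copy_walk[OF bs, of m its "(b + 8) # R" "7 # ?r"] by simp
  have "prog (Rewind m its) a = (Rewind m its, a, Lft, [])" if "a \<in> set (rev bs)" for a
    using bs that by (auto simp: prog_def)
  from turn_left[OF _ _ _ this, where u = "rev bs" and q = "Copy m its" and x = 7 and y = 7 and s = "[]" and c = "b + 8" and ls = R and r = "?r @ bs"]
  have 3: "reaches (Suc (length bs)) (Copy m its, rev bs @ (b + 8) # R, 7 # ?r @ bs)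
     (Rewind m its, R, (b + 8) # bs @ 7 # ?r @ bs)" by (simp add: prog_def)
  have 4: "estep prog Halt (Rewind m its, R, (b + 8) # bs @ 7 # ?r @ bs) = (Items m its, R, b # bs @ 7 # ?r @ bs)"
    using b by (auto simp: prog_def)
  have A: "reaches (Suc (length bs + (Suc (length bs) + Suc (length its * (2 * length bs + 4)))))
    (Items m (i # its), R, b # bs @ 7 # r)
    (Items m [], R, b # bs @ 7 # (?r @ bs) @ concat (map (item_word b bs) its))"
    by (rule reaches_step[OF 1], rule reaches_trans[OF 2], rule reaches_trans[OF 3], rule reaches_step[OF 4],
      rule Cons.IH)
  have E: "(?r @ bs) @ concat (map (item_word b bs) its) = r @ concat (map (item_word b bs) (i # its))"
    by (simp add: i item_word_def)
  show ?case by (rule reaches_mono[OF A[unfolded E]]) simp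
qed simp

fun loop_word :: "bool \<Rightarrow> nat list \<Rightarrow> nat list" where
  "loop_word m [] = []"
| "loop_word m (b # bs) = concat (map (item_word b bs) (items m b)) @ [5] @ loop_word m bs"

text \<open>At most 10 items cost \<open>2 * n + 4\<close> steps each, and entering and leaving a
  cell adds 2; this gives \<open>20 * n + 42\<close> per digit.\<close>

lemma loop_run:
  assumes "set bs \<subseteq> {1, 2}" "length bs \<le> n"
  shows "reaches (length bs * (20 * n + 42)) (Loop m, ls, bs @ 7 # r)
    (Loop m, rev bs @ ls, 7 # r @ loop_word m bs)"
  using assms
proof (induction bs arbitrary: ls r)
  case (Cons b bs)
  let ?its = "items m b" and ?w = "concat (map (item_word b bs) (items m b))"
  have b: "b \<in> {1, 2, 3}" "b \<noteq> 0" "b \<noteq> 7" and bs: "set bs \<subseteq> {1, 2}" using Cons.prems by auto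
  have 1: "estep prog Halt (Loop m, ls, (b # bs) @ 7 # r) = (Items m ?its, ls, b # bs @ 7 # r)"
    using b by (auto simp: prog_def)
  note 2 = items_run[OF b(1) bs, of ?its m ls r]
  have 3: "estep prog Halt (Items m [], ls, b # bs @ 7 # r @ ?w) = (Loop m, b # ls, bs @ 7 # (r @ ?w @ [5]))"
    using b by (auto simp: prog_def)
  have 4: "reaches (length bs * (20 * n + 42)) (Loop m, b # ls, bs @ 7 # (r @ ?w @ [5]))
     (Loop m, rev bs @ b # ls, 7 # (r @ ?w @ [5]) @ loop_word m bs)"
    by (rule Cons.IH[OF bs]) (use Cons.prems(2) in simp)
  have "length ?its \<le> 10" by (simp add: items_def)
  moreover have "2 * length bs + 4 \<le> 2 * n + 4" using Cons.prems(2) by simp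
  ultimately have "length ?its * (2 * length bs + 4) \<le> 10 * (2 * n + 4)" by (rule mult_le_mono)
  then have T: "Suc (length ?its * (2 * length bs + 4) + Suc (length bs * (20 * n + 42)))
    \<le> length (b # bs) * (20 * n + 42)" by simp
  show ?case
    using reaches_mono[OF reaches_step[OF 1 reaches_trans[OF 2 reaches_step[OF 3 4]]] T] by simp
qed simp

lemma start_step:
  "set w \<subseteq> {1..6} \<Longrightarrow> w \<noteq> [] \<Longrightarrow> estep prog Halt (Start, [], w) = (Scan S0, [], w @ [7])"
  by (cases w) (auto simp: prog_def)

lemma accepting_run:
  assumes w: "w = u @ [6] @ v @ [6, 3] @ bs" and u: "set u \<subseteq> {1..6}" and v: "set v \<subseteq> {1, 2, 5}" "foldl scan BS v = BS"
    and bs: "set bs \<subseteq> {1, 2}" and acc: "foldl scan S0 w = K2"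
  shows "\<exists>ls. reaches (200 * (length w + 1) ^ 2) (Start, [], w)
    (Halt, ls, emit cnf_word S0 w @ concat (map (item_word 3 bs) conflict_items) @ [5] @ loop_word False bs @
      gate_word @ emit vars_word BS v @ loop_word True bs @ final_word)"
proof -
  define R where "R = rev v @ 6 # rev u"
  have sw: "set w \<subseteq> {1..6}" using w u v bs by auto
  have rw: "rev w = rev bs @ 3 # 6 # R" by (simp add: w R_def)
  let ?E = "emit cnf_word S0 w" and ?C = "concat (map (item_word 3 bs) conflict_items)"
  have 1: "estep prog Halt (Start, [], w) = (Scan S0, [], w @ [7])"
    using sw by (rule start_step) (simp add: w)
  have 2: "reaches (length w) (Scan S0, [], w @ [7]) (Scan K2, rev bs @ 3 # 6 # R, 7 # ?E)"
    using scan_walk[OF sw, of S0 "[]" "[7]"] acc rw by simp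
  have "prog ToSign a = (ToSign, a, Lft, [])" if "a \<in> set (rev bs)" for a
    using bs that by (auto simp: prog_def)
  from turn_left[OF _ _ _ this, where u = "rev bs" and q = "Scan K2" and x = 7 and y = 7 and s = "[]" and c = 3 and ls = "6 # R" and r = ?E]
  have 3: "reaches (Suc (length bs)) (Scan K2, rev bs @ 3 # 6 # R, 7 # ?E) (ToSign, 6 # R, 3 # bs @ 7 # ?E)"
    by (simp add: prog_def)
  have 4: "estep prog Halt (ToSign, 6 # R, 3 # bs @ 7 # ?E) = (Items False conflict_items, 6 # R, 3 # bs @ 7 # ?E)"
    by (simp add: prog_def)
  have 5: "reaches (2 * (2 * length bs + 4)) (Items False conflict_items, 6 # R, 3 # bs @ 7 # ?E)
      (Items False [], 6 # R, 3 # bs @ 7 # ?E @ ?C)"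
    using items_run[OF _ bs, of 3 conflict_items False "6 # R" ?E] by (simp add: conflict_items_def)
  have 6: "estep prog Halt (Items False [], 6 # R, 3 # bs @ 7 # ?E @ ?C) =
      (Loop False, 3 # 6 # R, bs @ 7 # (?E @ ?C @ [5]))" by (simp add: prog_def)
  define O1 where "O1 = (?E @ ?C @ [5]) @ loop_word False bs"
  have 7: "reaches (length bs * (20 * length bs + 42)) (Loop False, 3 # 6 # R, bs @ 7 # (?E @ ?C @ [5]))
      (Loop False, (rev bs @ [3]) @ 6 # R, 7 # O1)"
    using loop_run[OF bs le_refl, of False "3 # 6 # R" "?E @ ?C @ [5]"] by (simp add: O1_def)
  have "prog Back1 a = (Back1, a, Lft, [])" if "a \<in> set (rev bs @ [3])" for a
    using bs that by (auto simp: prog_def)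
  from turn_left[OF _ _ _ this, where u = "rev bs @ [3]" and q = "Loop False" and x = 7 and y = 7 and s = gate_word and c = 6 and ls = R and r = O1]
  have 8: "reaches (Suc (Suc (length bs))) (Loop False, (rev bs @ [3]) @ 6 # R, 7 # O1)
      (Back1, rev v @ 6 # rev u, 6 # 3 # bs @ 7 # O1 @ gate_word)"
    by (simp add: prog_def R_def)
  have "prog Back2 a = (Back2, a, Lft, [])" if "a \<in> set (rev v)" for a
    using v that by (auto simp: prog_def)
  from turn_left[OF _ _ _ this, where u = "rev v" and q = Back1 and x = 6 and y = 6 and s = "[]" and c = 6 and ls = "rev u" and r = "3 # bs @ 7 # O1 @ gate_word"]
  have 9: "reaches (Suc (length v)) (Back1, rev v @ 6 # rev u, 6 # 3 # bs @ 7 # O1 @ gate_word)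
      (Back2, rev u, 6 # v @ 6 # 3 # bs @ 7 # O1 @ gate_word)"
    by (simp add: prog_def)
  have 10: "estep prog Halt (Back2, rev u, 6 # v @ 6 # 3 # bs @ 7 # O1 @ gate_word) =
      (VarScan BS, 6 # rev u, v @ 6 # 3 # bs @ 7 # O1 @ gate_word)" by (simp add: prog_def)
  define O2 where "O2 = (O1 @ gate_word) @ emit vars_word BS v"
  have 11: "reaches (length v) (VarScan BS, 6 # rev u, v @ 6 # 3 # bs @ 7 # O1 @ gate_word)
      (VarScan BS, rev v @ 6 # rev u, 6 # 3 # bs @ 7 # O2)"
    using var_scan_walk[OF v(1), of BS "6 # rev u" "6 # 3 # bs @ 7 # O1 @ gate_word"] v(2) by (simp add: O2_def)
  have 12: "estep prog Halt (VarScan BS, rev v @ 6 # rev u, 6 # 3 # bs @ 7 # O2) =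
      (VarScan K0, 6 # rev v @ 6 # rev u, 3 # bs @ 7 # O2)" by (simp add: prog_def vars_word_def)
  have 13: "estep prog Halt (VarScan K0, 6 # rev v @ 6 # rev u, 3 # bs @ 7 # O2) =
      (Loop True, 3 # 6 # rev v @ 6 # rev u, bs @ 7 # O2)" by (simp add: prog_def)
  have 14: "reaches (length bs * (20 * length bs + 42)) (Loop True, 3 # 6 # rev v @ 6 # rev u, bs @ 7 # O2)
      (Loop True, rev w, 7 # O2 @ loop_word True bs)"
    using loop_run[OF bs le_refl, of True "3 # 6 # rev v @ 6 # rev u" O2] by (simp add: rw R_def)
  have 15: "estep prog Halt (Loop True, rev w, 7 # O2 @ loop_word True bs) =
      (Halt, 7 # rev w, (O2 @ loop_word True bs) @ final_word)" by (simp add: prog_def)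
  let ?t = "Suc (length w + (Suc (length bs) + Suc (2 * (2 * length bs + 4) + Suc (length bs * (20 * length bs + 42) +
    (Suc (Suc (length bs)) + (Suc (length v) + Suc (length v + Suc (Suc (length bs * (20 * length bs + 42) + Suc 0)))))))))"
  have "reaches ?t (Start, [], w) (Halt, 7 # rev w, (O2 @ loop_word True bs) @ final_word)"
    by (rule reaches_step[OF 1], rule reaches_trans[OF 2], rule reaches_trans[OF 3], rule reaches_step[OF 4],
      rule reaches_trans[OF 5], rule reaches_step[OF 6], rule reaches_trans[OF 7], rule reaches_trans[OF 8],
      rule reaches_trans[OF 9], rule reaches_step[OF 10], rule reaches_trans[OF 11], rule reaches_step[OF 12],
      rule reaches_step[OF 13], rule reaches_trans[OF 14], rule reaches_step[OF 15], rule reaches_refl)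
  \<comment> \<open>Each of the two digit loops takes at most \<open>62 * (l * l)\<close> steps; the
    other terms are linear.\<close>
  moreover have "?t \<le> 200 * (length w + 1) ^ 2"
  proof -
    define l where "l = length w + 1"
    have lb: "length bs \<le> l" "length v \<le> l" "length w \<le> l" "1 \<le> l" by (simp_all add: l_def w)
    have ll: "l \<le> l * l" using lb(4) by simp
    have "length bs * (20 * length bs + 42) \<le> l * (20 * l + 42)" using lb by (intro mult_le_mono) auto
    also have "\<dots> = 20 * (l * l) + 42 * l" by (simp add: algebra_simps)
    finally have "length bs * (20 * length bs + 42) \<le> 62 * (l * l)" using ll by linarith
    moreover define x where "x = length bs * (20 * length bs + 42)"
    moreover define y where "y = l * l"
    ultimately have "x \<le> 62 * y" "length bs \<le> y" "length v \<le> y" "length w \<le> y" "1 \<le> y"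
      using lb ll by linarith+
    then have "?t \<le> 200 * y" unfolding x_def[symmetric] by simp
    then show ?thesis by (simp add: y_def l_def power2_eq_square)
  qed
  ultimately show ?thesis
    by (intro exI[of _ "7 # rev w"]) (auto simp: O2_def O1_def intro: reaches_mono)
qed

lemma length_emit: "length (emit cnf_word q u) \<le> (length guard_word + 2) * length u"
proof (induction u arbitrary: q)
  case (Cons a u)
  have "length (cnf_word q a) \<le> length guard_word + 2" by (simp add: cnf_word_def)
  then show ?case using Cons[of "scan q a"] by simp
qed simp

lemma set_emit: "set (emit cnf_word q u) \<subseteq> {1..6}"
proof (induction u arbitrary: q)
  case (Cons a u)
  then show ?case using set_cnf_word[of q a] by auto
qed simp

text \<open>Part of a translation may already be written when the word turns out to be malformed.
  \<open>Fail\<close> runs past it, so the head ends on a blank and the output is empty.\<close>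

lemma rejecting_run:
  assumes w: "set w \<subseteq> {1..6}" and rej: "foldl scan S0 w \<noteq> K2"
  shows "\<exists>ls. reaches ((length guard_word + 10) * (length w + 1) ^ 2) (Start, [], w) (Halt, ls, [0])"
proof (cases "w = []")
  case True
  then have 1: "estep prog Halt (Start, [], w) = (Halt, [], [0])" by (simp add: prog_def)
  have "reaches 1 (Start, [], w) (Halt, [], [0])" using reaches_step[OF 1 reaches_refl[of 0]] by simp
  then show ?thesis by (intro exI[of _ "[]"]) (rule reaches_mono, auto)
next
  case False
  let ?E = "emit cnf_word S0 w" and ?q = "foldl scan S0 w"
  have 1: "estep prog Halt (Start, [], w) = (Scan S0, [], w @ [7])"
    using w False by (rule start_step)
  have 2: "reaches (length w) (Scan S0, [], w @ [7]) (Scan ?q, rev w, 7 # ?E)"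
    using scan_walk[OF w, of S0 "[]" "[7]"] by simp
  have 3: "estep prog Halt (Scan ?q, rev w, 7 # ?E) = (Fail, 7 # rev w, ?E)"
    using rej by (simp add: prog_def)
  have 4: "reaches (length ?E) (Fail, 7 # rev w, ?E) (Fail, rev ?E @ 7 # rev w, [])"
    using fail_walk[of ?E] set_emit[of S0 w] by fastforce
  have 5: "estep prog Halt (Fail, rev ?E @ 7 # rev w, []) = (Halt, rev ?E @ 7 # rev w, [0])"
    by (simp add: prog_def)
  let ?t = "Suc (length w + Suc (length ?E + Suc 0))"
  have "reaches ?t (Start, [], w) (Halt, rev ?E @ 7 # rev w, [0])"
    by (rule reaches_step[OF 1], rule reaches_trans[OF 2], rule reaches_step[OF 3], rule reaches_trans[OF 4],
      rule reaches_step[OF 5], rule reaches_refl)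
  moreover have "?t \<le> (length guard_word + 10) * (length w + 1) ^ 2"
  proof -
    have "?t \<le> (length guard_word + 10) * (length w + 1)" using length_emit[of S0 w] by (simp add: distrib_right)
    also have "\<dots> \<le> (length guard_word + 10) * (length w + 1) ^ 2"
      by (intro mult_le_mono2) (simp add: power2_eq_square)
    finally show ?thesis .
  qed
  ultimately show ?thesis using reaches_mono by blast
qed

subsection \<open>Encodings\<close>

lemma enc_nat_0 [simp]: "enc_nat 0 = []" by (simp add: enc_nat.simps)
lemma enc_nat_pos: "n > 0 \<Longrightarrow> enc_nat n = (if even n then 1 else 2) # enc_nat (n div 2)"
  by (subst enc_nat.simps) simp
lemma enc_nat_odd: "enc_nat (2 * n + 1) = 2 # enc_nat n" by (simp add: enc_nat_pos)
lemma enc_nat_even: "n > 0 \<Longrightarrow> enc_nat (2 * n) = 1 # enc_nat n" by (simp add: enc_nat_pos)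

text \<open>With the least significant digit first, the residue that tags a family becomes a prefix
  and the code of the index follows unchanged.\<close>

lemma enc_nat_vars:
  "enc_nat (Fv n) = 2 # enc_nat n" "enc_nat (Dv n) = [1, 2] @ enc_nat n"
  "enc_nat (Ev n) = [1, 1, 2] @ enc_nat n" "enc_nat (Yv n) = [1, 1, 1, 2] @ enc_nat n"
proof -
  have F: "Fv n = 2 * n + 1" and D: "Dv n = 2 * (2 * n + 1)"
    and E: "Ev n = 2 * (2 * (2 * n + 1))" and Y: "Yv n = 2 * (2 * (2 * (2 * n + 1)))"
    by (simp_all add: gadget_var_defs)
  have p: "0 < 2 * n + 1" "0 < 2 * (2 * n + 1)" "0 < 2 * (2 * (2 * n + 1))" by simp_all
  show "enc_nat (Fv n) = 2 # enc_nat n" unfolding F by (rule enc_nat_odd)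
  show "enc_nat (Dv n) = [1, 2] @ enc_nat n"
    unfolding D enc_nat_even[OF p(1)] enc_nat_odd by simp
  show "enc_nat (Ev n) = [1, 1, 2] @ enc_nat n"
    unfolding E enc_nat_even[OF p(2)] enc_nat_even[OF p(1)] enc_nat_odd by simp
  show "enc_nat (Yv n) = [1, 1, 1, 2] @ enc_nat n"
    unfolding Y enc_nat_even[OF p(3)] enc_nat_even[OF p(2)] enc_nat_even[OF p(1)] enc_nat_odd by simp
qed

lemma enc_nat_eq_Nil [simp]: "enc_nat n = [] \<longleftrightarrow> n = 0" "[] = enc_nat n \<longleftrightarrow> n = 0"
  by (cases "n = 0"; simp add: enc_nat_pos)+

lemma enc_nat_inj: "enc_nat n = enc_nat m \<Longrightarrow> n = m"
proof (induction n arbitrary: m rule: less_induct)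
  case (less n)
  show ?case
  proof (cases "n = 0 \<or> m = 0")
    case True
    then show ?thesis using less.prems by auto
  next
    case False
    then have "(if even n then 1 else 2) # enc_nat (n div 2) = (if even m then 1 else 2) # enc_nat (m div 2)"
      using less.prems enc_nat_pos[of n] enc_nat_pos[of m] by (metis gr0I)
    then have d: "enc_nat (n div 2) = enc_nat (m div 2)" and p: "even n = even m"
      by (simp_all split: if_splits)
    from d have "n div 2 = m div 2" using less.IH[of "n div 2"] False by simp
    then show ?thesis using p by presburger
  qed
qed

text \<open>Codes have no leading zeros, so a nonempty bit word is a code precisely when it ends in
  2; the automaton need only remember the last bit.\<close>

lemma bits_snoc_2: "set u \<subseteq> {1, 2} \<Longrightarrow> \<exists>n. u @ [2] = enc_nat n"
proof (induction u)
  case Nil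
  have "[] @ [2] = enc_nat (2 * 0 + 1)" unfolding enc_nat_odd by simp
  then show ?case by blast
next
  case (Cons b u)
  then obtain n where n: "u @ [2] = enc_nat n" by auto
  then have "n > 0" by (cases n) auto
  then have "1 # u @ [2] = enc_nat (2 * n)" "2 # u @ [2] = enc_nat (2 * n + 1)"
    using n enc_nat_odd[of n] enc_nat_even[of n] by simp_all
  then show ?case using Cons.prems by auto
qed

definition lits_word :: "lit list \<Rightarrow> nat list" where "lits_word C = concat (map enc_lit C)"
definition clauses_word :: "lit list list \<Rightarrow> nat list" where "clauses_word F = concat (map enc_clause F)"
definition names_word :: "nat list \<Rightarrow> nat list" where "names_word B = concat (map (\<lambda>v. enc_nat v @ [5]) B)"

lemma words_simps [simp]:
  "lits_word [] = []" "lits_word (l # C) = enc_lit l @ lits_word C" "lits_word (C @ D) = lits_word C @ lits_word D"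
  "clauses_word [] = []" "clauses_word (D # F) = enc_clause D @ clauses_word F"
  "clauses_word (F @ G) = clauses_word F @ clauses_word G"
  "names_word [] = []" "names_word (v # B) = enc_nat v @ 5 # names_word B"
  "names_word (B @ B') = names_word B @ names_word B'"
  by (simp_all add: lits_word_def clauses_word_def names_word_def)

lemma enc_folds:
  "enc_clause C = lits_word C @ [5]" "enc_cnf F = clauses_word F @ [6]" "enc_vars B = names_word B @ [6]"
  by (simp_all add: enc_clause_def enc_cnf_def enc_vars_def lits_word_def clauses_word_def names_word_def)

text \<open>Serves the pairs \<open>L0\<close>/\<open>L1\<close>,
  \<open>B2\<close>/\<open>B1\<close> and \<open>K2\<close>/\<open>K1\<close>. From
  \<open>bad\<close> a number must still supply a digit 1, hence the condition
  \<open>n > 0\<close>.\<close>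

lemma scan_bits:
  assumes "scan ok 1 = bad" "scan ok 2 = ok" "scan bad 1 = bad" "scan bad 2 = ok"
  shows "foldl scan ok (enc_nat n) = ok \<and> (n > 0 \<longrightarrow> foldl scan bad (enc_nat n) = ok)"
proof (induction n rule: less_induct)
  case (less n)
  show ?case
  proof (cases "n = 0")
    case False
    have "even n \<Longrightarrow> n div 2 > 0" using False by presburger
    then show ?thesis using less.IH[of "n div 2"] False enc_nat_pos[of n] assms by auto
  qed simp
qed

lemma scan_lit: "q = S0 \<or> q = L0 \<Longrightarrow> foldl scan q (enc_lit l) = L0"
  using scan_bits[of L0 L1] by (cases l) auto

lemma scan_lits: "q = S0 \<or> q = L0 \<Longrightarrow> foldl scan q (lits_word C) = S0 \<or> foldl scan q (lits_word C) = L0"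
proof (induction C arbitrary: q)
  case (Cons l C) then show ?case using scan_lit[of q l] by simp
qed auto

lemma scan_clauses: "foldl scan S0 (clauses_word F) = S0"
proof (induction F)
  case (Cons C F)
  then show ?case using scan_lits[of S0 C] by (auto simp: enc_folds(1))
qed simp

lemma scan_name: "foldl scan BS (enc_nat v @ [5]) = BS"
proof (cases "v = 0")
  case False
  have "even v \<Longrightarrow> v div 2 > 0" using False by presburger
  then show ?thesis using False enc_nat_pos[of v] scan_bits[of B2 B1 "v div 2"] by auto
qed simp

lemma scan_names: "foldl scan BS (names_word B) = BS"
proof (induction B)
  case (Cons v B)
  have "foldl scan BS (names_word (v # B)) = foldl scan (foldl scan BS (enc_nat v @ [5])) (names_word B)" by simp
  then show ?case unfolding scan_name using Cons by simp
qed simp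

lemma scan_accepts: "foldl scan S0 (enc_cnf F @ enc_vars B @ 3 # enc_nat k) = K2"
  using scan_bits[of K2 K1 k] by (simp add: enc_folds scan_clauses scan_names)

text \<open>The invariant of the automaton: what is known about the prefix read so far. States after
  a bit 0 keep a raw bit word, which need not be a code yet.\<close>

fun parsed :: "scan_state \<Rightarrow> nat list \<Rightarrow> bool" where
  "parsed S0 w = (\<exists>F. w = clauses_word F)"
| "parsed L0 w = (\<exists>F C l. w = clauses_word F @ lits_word C @ enc_lit l)"
| "parsed L1 w = (\<exists>F C s u. w = clauses_word F @ lits_word C @ s # u \<and> (s = 3 \<or> s = 4) \<and> set u \<subseteq> {1, 2})"
| "parsed BS w = (\<exists>F B. w = enc_cnf F @ names_word B)"
| "parsed B1 w = (\<exists>F B u. w = enc_cnf F @ names_word B @ u \<and> set u \<subseteq> {1, 2})"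
| "parsed B2 w = (\<exists>F B n. w = enc_cnf F @ names_word B @ enc_nat n)"
| "parsed K0 w = (\<exists>F B. w = enc_cnf F @ enc_vars B)"
| "parsed K1 w = (\<exists>F B u. w = enc_cnf F @ enc_vars B @ 3 # u \<and> set u \<subseteq> {1, 2})"
| "parsed K2 w = (\<exists>F B k. w = enc_cnf F @ enc_vars B @ 3 # enc_nat k)"
| "parsed Reject w = True"

lemma enc_lit_cases: "\<exists>s u. enc_lit l = s # u \<and> (s = 3 \<or> s = 4) \<and> set u \<subseteq> {1, 2}"
  using set_enc_nat by (cases l) auto

lemma enc_lit_snoc_2:
  assumes "s = 3 \<or> s = 4" "set u \<subseteq> {1, 2}" shows "\<exists>l. s # u @ [2] = enc_lit l"
proof -
  obtain n where "u @ [2] = enc_nat n" using bits_snoc_2 assms(2) by blast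
  then have "3 # u @ [2] = enc_lit (Pos n)" "4 # u @ [2] = enc_lit (Neg n)" by simp_all
  then show ?thesis using assms(1) by blast
qed

lemma enc_lit_start: "s = 3 \<or> s = 4 \<Longrightarrow> \<exists>l. [s] = enc_lit l"
proof -
  assume s: "s = 3 \<or> s = 4"
  have "[3] = enc_lit (Pos 0)" "[4] = enc_lit (Neg 0)" by simp_all
  then show ?thesis using s by blast
qed

lemma parsed_step: "parsed q w \<Longrightarrow> parsed (scan q a) (w @ [a])"
proof (cases q)
  case S0
  assume p: "parsed q w"
  then obtain F where w: "w = clauses_word F" using S0 by auto
  consider "a = 3 \<or> a = 4" | "a = 5" | "a = 6" | "a \<notin> {3, 4, 5, 6}" by auto
  then show ?thesis
  proof cases
    case 1
    then obtain l where "[a] = enc_lit l" using enc_lit_start by blast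
    then have "w @ [a] = clauses_word F @ lits_word [] @ enc_lit l" using w by simp
    then have "parsed L0 (w @ [a])" unfolding parsed.simps by blast
    then show ?thesis using S0 1 by auto
  next
    case 2
    have "w @ [a] = clauses_word (F @ [[]])" using w 2 by (simp add: enc_folds)
    then have "parsed S0 (w @ [a])" unfolding parsed.simps by blast
    then show ?thesis using S0 2 by simp
  next
    case 3
    have "w @ [a] = enc_cnf F @ names_word []" using w 3 by (simp add: enc_folds)
    then have "parsed BS (w @ [a])" unfolding parsed.simps by blast
    then show ?thesis using S0 3 by simp
  qed (use S0 in auto)
next
  case L0
  assume p: "parsed q w"
  then obtain F C l where w: "w = clauses_word F @ lits_word C @ enc_lit l" using L0 by auto
  consider "a = 1" | "a = 2" | "a = 3 \<or> a = 4" | "a = 5" | "a \<notin> {1, 2, 3, 4, 5}" by auto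
  then show ?thesis
  proof cases
    case 1
    obtain s u where "enc_lit l = s # u" "s = 3 \<or> s = 4" "set u \<subseteq> {1, 2}" using enc_lit_cases by blast
    then have "w @ [a] = clauses_word F @ lits_word C @ s # (u @ [1]) \<and> (s = 3 \<or> s = 4) \<and> set (u @ [1]) \<subseteq> {1, 2}"
      using w 1 by simp
    then have "parsed L1 (w @ [a])" unfolding parsed.simps by blast
    then show ?thesis using L0 1 by simp
  next
    case 2
    obtain s u where su: "enc_lit l = s # u" "s = 3 \<or> s = 4" "set u \<subseteq> {1, 2}" using enc_lit_cases by blast
    then obtain l' where "s # u @ [2] = enc_lit l'" using enc_lit_snoc_2 by blast
    then have "w @ [a] = clauses_word F @ lits_word C @ enc_lit l'" using w 2 su by simp
    then have "parsed L0 (w @ [a])" unfolding parsed.simps by blast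
    then show ?thesis using L0 2 by simp
  next
    case 3
    then obtain l' where "[a] = enc_lit l'" using enc_lit_start by blast
    then have "w @ [a] = clauses_word F @ lits_word (C @ [l]) @ enc_lit l'" using w by simp
    then have "parsed L0 (w @ [a])" unfolding parsed.simps by blast
    then show ?thesis using L0 3 by auto
  next
    case 4
    have "w @ [a] = clauses_word (F @ [C @ [l]])" using w 4 by (simp add: enc_folds)
    then have "parsed S0 (w @ [a])" unfolding parsed.simps by blast
    then show ?thesis using L0 4 by simp
  qed (use L0 in auto)
next
  case L1
  assume p: "parsed q w"
  then obtain F C s u where w: "w = clauses_word F @ lits_word C @ s # u" "s = 3 \<or> s = 4" "set u \<subseteq> {1, 2}"
    using L1 by auto
  consider "a = 1" | "a = 2" | "a \<notin> {1, 2}" by auto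
  then show ?thesis
  proof cases
    case 1
    have "w @ [a] = clauses_word F @ lits_word C @ s # (u @ [1]) \<and> (s = 3 \<or> s = 4) \<and> set (u @ [1]) \<subseteq> {1, 2}"
      using w 1 by simp
    then have "parsed L1 (w @ [a])" unfolding parsed.simps by blast
    then show ?thesis using L1 1 by simp
  next
    case 2
    obtain l' where "s # u @ [2] = enc_lit l'" using enc_lit_snoc_2 w by blast
    then have "w @ [a] = clauses_word F @ lits_word C @ enc_lit l'" using w 2 by simp
    then have "parsed L0 (w @ [a])" unfolding parsed.simps by blast
    then show ?thesis using L1 2 by simp
  qed (use L1 in auto)
next
  case BS
  assume p: "parsed q w"
  then obtain F B where w: "w = enc_cnf F @ names_word B" using BS by auto
  consider "a = 1" | "a = 2" | "a = 5" | "a = 6" | "a \<notin> {1, 2, 5, 6}" by auto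
  then show ?thesis
  proof cases
    case 1
    have "w @ [a] = enc_cnf F @ names_word B @ [1] \<and> set [1] \<subseteq> {1, 2 :: nat}" using w 1 by simp
    then have "parsed B1 (w @ [a])" unfolding parsed.simps by blast
    then show ?thesis using BS 1 by simp
  next
    case 2
    obtain n where "[2] = enc_nat n" using bits_snoc_2[of "[]"] by auto
    then have "w @ [a] = enc_cnf F @ names_word B @ enc_nat n" using w 2 by simp
    then have "parsed B2 (w @ [a])" unfolding parsed.simps by blast
    then show ?thesis using BS 2 by simp
  next
    case 3
    have "w @ [a] = enc_cnf F @ names_word (B @ [0])" using w 3 by simp
    then have "parsed BS (w @ [a])" unfolding parsed.simps by blast
    then show ?thesis using BS 3 by simp
  next
    case 4
    have "w @ [a] = enc_cnf F @ enc_vars B" using w 4 by (simp add: enc_folds(3))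
    then have "parsed K0 (w @ [a])" unfolding parsed.simps by blast
    then show ?thesis using BS 4 by simp
  qed (use BS in auto)
next
  case B1
  assume p: "parsed q w"
  then obtain F B u where w: "w = enc_cnf F @ names_word B @ u" "set u \<subseteq> {1, 2}" using B1 by auto
  consider "a = 1" | "a = 2" | "a \<notin> {1, 2}" by auto
  then show ?thesis
  proof cases
    case 1
    have "w @ [a] = enc_cnf F @ names_word B @ (u @ [1]) \<and> set (u @ [1]) \<subseteq> {1, 2}" using w 1 by simp
    then have "parsed B1 (w @ [a])" unfolding parsed.simps by blast
    then show ?thesis using B1 1 by simp
  next
    case 2
    obtain n where "u @ [2] = enc_nat n" using bits_snoc_2 w by blast
    then have "w @ [a] = enc_cnf F @ names_word B @ enc_nat n" using w 2 by simp
    then have "parsed B2 (w @ [a])" unfolding parsed.simps by blast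
    then show ?thesis using B1 2 by simp
  qed (use B1 in auto)
next
  case B2
  assume p: "parsed q w"
  then obtain F B n where w: "w = enc_cnf F @ names_word B @ enc_nat n" using B2 by auto
  consider "a = 1" | "a = 2" | "a = 5" | "a \<notin> {1, 2, 5}" by auto
  then show ?thesis
  proof cases
    case 1
    have "w @ [a] = enc_cnf F @ names_word B @ (enc_nat n @ [1]) \<and> set (enc_nat n @ [1]) \<subseteq> {1, 2}"
      using w 1 set_enc_nat by simp
    then have "parsed B1 (w @ [a])" unfolding parsed.simps by blast
    then show ?thesis using B2 1 by simp
  next
    case 2
    obtain n' where "enc_nat n @ [2] = enc_nat n'" using bits_snoc_2 set_enc_nat by blast
    then have "w @ [a] = enc_cnf F @ names_word B @ enc_nat n'" using w 2 by simp
    then have "parsed B2 (w @ [a])" unfolding parsed.simps by blast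
    then show ?thesis using B2 2 by simp
  next
    case 3
    have "w @ [a] = enc_cnf F @ names_word (B @ [n])" using w 3 by simp
    then have "parsed BS (w @ [a])" unfolding parsed.simps by blast
    then show ?thesis using B2 3 by simp
  qed (use B2 in auto)
next
  case K0
  assume p: "parsed q w"
  then obtain F B where w: "w = enc_cnf F @ enc_vars B" using K0 by auto
  show ?thesis
  proof (cases "a = 3")
    case True
    have "w @ [a] = enc_cnf F @ enc_vars B @ 3 # enc_nat 0" using w True by simp
    then have "parsed K2 (w @ [a])" unfolding parsed.simps by blast
    then show ?thesis using K0 True by simp
  qed (use K0 in auto)
next
  case K1
  assume p: "parsed q w"
  then obtain F B u where w: "w = enc_cnf F @ enc_vars B @ 3 # u" "set u \<subseteq> {1, 2}" using K1 by auto
  consider "a = 1" | "a = 2" | "a \<notin> {1, 2}" by auto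
  then show ?thesis
  proof cases
    case 1
    have "w @ [a] = enc_cnf F @ enc_vars B @ 3 # (u @ [1]) \<and> set (u @ [1]) \<subseteq> {1, 2}" using w 1 by simp
    then have "parsed K1 (w @ [a])" unfolding parsed.simps by blast
    then show ?thesis using K1 1 by simp
  next
    case 2
    obtain n where "u @ [2] = enc_nat n" using bits_snoc_2 w by blast
    then have "w @ [a] = enc_cnf F @ enc_vars B @ 3 # enc_nat n" using w 2 by simp
    then have "parsed K2 (w @ [a])" unfolding parsed.simps by blast
    then show ?thesis using K1 2 by simp
  qed (use K1 in auto)
next
  case K2
  assume p: "parsed q w"
  then obtain F B n where w: "w = enc_cnf F @ enc_vars B @ 3 # enc_nat n" using K2 by auto
  consider "a = 1" | "a = 2" | "a \<notin> {1, 2}" by auto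
  then show ?thesis
  proof cases
    case 1
    have "w @ [a] = enc_cnf F @ enc_vars B @ 3 # (enc_nat n @ [1]) \<and> set (enc_nat n @ [1]) \<subseteq> {1, 2}"
      using w 1 set_enc_nat by simp
    then have "parsed K1 (w @ [a])" unfolding parsed.simps by blast
    then show ?thesis using K2 1 by simp
  next
    case 2
    obtain n' where "enc_nat n @ [2] = enc_nat n'" using bits_snoc_2 set_enc_nat by blast
    then have "w @ [a] = enc_cnf F @ enc_vars B @ 3 # enc_nat n'" using w 2 by simp
    then have "parsed K2 (w @ [a])" unfolding parsed.simps by blast
    then show ?thesis using K2 2 by simp
  qed (use K2 in auto)
qed auto

lemma parsed_foldl: "parsed (foldl scan S0 w) w"
proof (induction w rule: rev_induct)
  case Nil
  have "[] = clauses_word []" by simp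
  then show ?case by (metis foldl_Nil parsed.simps(1))
next
  case (snoc a w) then show ?case using parsed_step by simp
qed

lemma scan_accepts_iff: "foldl scan S0 w = K2 \<longleftrightarrow> (\<exists>F B k. w = enc_cnf F @ enc_vars B @ 3 # enc_nat k)"
  using parsed_foldl[of w] scan_accepts by (metis parsed.simps(9))

section \<open>The words written by the program\<close>

lemma emit_append: "emit w q (u @ v) = emit w q u @ emit w (foldl scan q u) v"
  by (induction u arbitrary: q) auto

lemma emit_cnf_silent: "q \<notin> {S0, L0, L1} \<Longrightarrow> emit cnf_word q u = []"
proof (induction u arbitrary: q)
  case (Cons a u)
  have "scan q a \<notin> {S0, L0, L1}" using Cons.prems by (cases q) auto
  then show ?case using Cons by (simp add: cnf_word_def)
qed simp

lemma emit_cnf_bits: "set u \<subseteq> {1, 2} \<Longrightarrow> q = L0 \<or> q = L1 \<Longrightarrow> emit cnf_word q u = u"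
proof (induction u arbitrary: q)
  case (Cons a u)
  then have "scan q a = L0 \<or> scan q a = L1" "cnf_word q a = [a]" by (auto simp: cnf_word_def)
  then show ?case using Cons by simp
qed simp

lemma emit_lit: "q = S0 \<or> q = L0 \<Longrightarrow> emit cnf_word q (enc_lit l) = enc_lit (ren l)"
  using emit_cnf_bits[OF set_enc_nat, of L0] by (cases l) (auto simp: cnf_word_def enc_nat_vars)

lemma emit_lits: "q = S0 \<or> q = L0 \<Longrightarrow> emit cnf_word q (lits_word C) = lits_word (map ren C)"
proof (induction C arbitrary: q)
  case (Cons l C)
  then show ?case using scan_lit[OF Cons.prems] emit_lit[OF Cons.prems] by (simp add: emit_append)
qed simp

lemma emit_clauses: "emit cnf_word S0 (clauses_word F) = clauses_word (map guard F)"
proof (induction F)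
  case (Cons C F)
  have "foldl scan S0 (enc_clause C) = S0" using scan_clauses[of "[C]"] by simp
  moreover have "emit cnf_word S0 (enc_clause C) = enc_clause (guard C)"
    using emit_lits[of S0 C] scan_lits[of S0 C]
    by (auto simp: enc_folds(1) emit_append cnf_word_def guard_word_def guard_def)
  ultimately show ?case using Cons by (simp add: emit_append)
qed simp

lemma emit_vars_bits: "set u \<subseteq> {1, 2} \<Longrightarrow> q = B1 \<or> q = B2 \<Longrightarrow> emit vars_word q u = u"
proof (induction u arbitrary: q)
  case (Cons a u)
  then have "scan q a = B1 \<or> scan q a = B2" "vars_word q a = [a]" by (auto simp: vars_word_def)
  then show ?case using Cons by simp
qed simp

lemma emit_name: "emit vars_word BS (enc_nat v @ [5]) = enc_nat (Fv v) @ [5]"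
proof (cases "v = 0")
  case False
  define b where "b = (if even v then 1 else 2 :: nat)"
  have e: "enc_nat v = b # enc_nat (v div 2)" using False enc_nat_pos by (simp add: b_def)
  have q: "scan BS b = B1 \<or> scan BS b = B2" "vars_word BS b = [2, b]" by (auto simp: b_def vars_word_def)
  have "foldl scan (scan BS b) (enc_nat (v div 2)) = B2"
  proof (cases "even v")
    case True
    then have "v div 2 > 0" using False by presburger
    then show ?thesis using scan_bits[of B2 B1 "v div 2"] True by (simp add: b_def)
  next
    case F: False
    then show ?thesis using scan_bits[of B2 B1 "v div 2"] by (simp add: b_def)
  qed
  then have "emit vars_word BS (enc_nat v @ [5]) = [2, b] @ enc_nat (v div 2) @ [5]"
    using q emit_vars_bits[OF set_enc_nat q(1)] unfolding e by (simp add: emit_append vars_word_def)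
  then show ?thesis by (simp add: enc_nat_vars e)
qed (simp add: vars_word_def enc_nat_vars)

lemma emit_names: "emit vars_word BS (names_word B) = names_word (map Fv B)"
proof (induction B)
  case (Cons v B)
  have "emit vars_word BS (names_word (v # B)) = emit vars_word BS ((enc_nat v @ [5]) @ names_word B)" by simp
  also have "\<dots> = (enc_nat (Fv v) @ [5]) @ names_word (map Fv B)"
    unfolding emit_append[of _ _ "enc_nat v @ [5]"] scan_name emit_name Cons ..
  finally show ?case by simp
qed simp

lemma conflict_items_word:
  "concat (map (item_word 3 (enc_nat k)) conflict_items) @ [5] = clauses_word (conflict_clauses k)"
  by (simp add: conflict_items_def item_word_def conflict_clauses_def enc_folds enc_nat_vars)

lemma loop_word_clauses: "loop_word False (enc_nat k) = clauses_word (count_clauses k)"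
proof (induction k rule: count_clauses.induct)
  case (1 k)
  show ?case
  proof (cases "k = 0")
    case False
    define b where "b = (if even k then 1 else 2 :: nat)"
    have e: "enc_nat k = b # enc_nat (k div 2)" using False enc_nat_pos by (simp add: b_def)
    have "concat (map (item_word b (enc_nat (k div 2))) (items False b)) @ [5] = clauses_word (digit_clauses k)"
      by (cases "even k")
        (simp_all add: items_def item_word_def digit_clauses_def Let_def enc_folds enc_nat_vars e b_def)
    then show ?thesis using 1 False by (simp add: e count_clauses.simps[of k])
  qed (simp add: count_clauses.simps)
qed

lemma loop_word_names: "loop_word True (enc_nat k) = names_word (digit_vars k)"
proof (induction k rule: digit_vars.induct)
  case (1 k)
  show ?case
  proof (cases "k = 0")
    case False
    define b where "b = (if even k then 1 else 2 :: nat)"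
    have e: "enc_nat k = b # enc_nat (k div 2)" using False enc_nat_pos by (simp add: b_def)
    have "concat (map (item_word b (enc_nat (k div 2))) (items True b)) = enc_nat (Yv k)"
      by (simp add: items_def item_word_def enc_nat_vars e)
    then show ?thesis using 1 False by (simp add: e digit_vars.simps[of k])
  qed (simp add: digit_vars.simps)
qed

definition target_word :: "lit list list \<Rightarrow> nat list \<Rightarrow> nat \<Rightarrow> nat list" where
  "target_word F B k = enc_cnf (target_cnf F k) @ enc_vars (target_vars B k) @ enc_nat Xv"

lemma set_names_word: "set (names_word B) \<subseteq> {1, 2, 5}"
proof (induction B)
  case (Cons v B) then show ?case using set_enc_nat[of v] by auto
qed simp

lemma set_clauses_word: "set (clauses_word F) \<subseteq> {1..6}"
  using set_enc_clause by (auto simp: clauses_word_def)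

lemma run_on_instance:
  assumes w: "w = enc_cnf F @ enc_vars B @ 3 # enc_nat k"
  shows "\<exists>ls. reaches (200 * (length w + 1) ^ 2) (Start, [], w) (Halt, ls, target_word F B k)"
proof -
  have w': "w = clauses_word F @ [6] @ names_word B @ [6, 3] @ enc_nat k" by (simp add: w enc_folds)
  have e: "emit cnf_word S0 w = clauses_word (map guard F)"
    unfolding w' emit_append[of _ _ "clauses_word F"] scan_clauses emit_clauses
    by (simp add: cnf_word_def emit_cnf_silent)
  have "clauses_word (map guard F) @ concat (map (item_word 3 (enc_nat k)) conflict_items) @ [5] @
      loop_word False (enc_nat k) @ gate_word @ emit vars_word BS (names_word B) @ loop_word True (enc_nat k) @ final_word =
    target_word F B k"
    using conflict_items_word[of k]
    by (simp add: target_word_def enc_folds(2,3) target_cnf_def target_vars_def loop_word_clauses loop_word_names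
      emit_names gate_word_def final_word_def clauses_word_def)
  then show ?thesis
    using accepting_run[OF w' set_clauses_word set_names_word scan_names set_enc_nat] scan_accepts[of F B k]
    unfolding e by (simp add: w)
qed

section \<open>Unique readability\<close>

definition stops_bits :: "nat list \<Rightarrow> bool" where
  "stops_bits r \<longleftrightarrow> r = [] \<or> hd r \<notin> {1, 2}"

text \<open>Inside a clause a variable has no terminator of its own; its code extends as far as
  there are bits, which determines it when the next symbol is not a bit.\<close>

lemma enc_nat_append_inj:
  assumes "enc_nat n @ r = enc_nat m @ s" "stops_bits r" "stops_bits s"
  shows "n = m \<and> r = s"
proof -
  have t: "takeWhile (\<lambda>a. a \<in> {1, 2}) (enc_nat n @ r) = enc_nat n" if "stops_bits r" for n r
  proof -
    have "takeWhile (\<lambda>a. a \<in> {1, 2}) r = []" using that by (cases r) (auto simp: stops_bits_def)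
    moreover have "\<And>a. a \<in> set (enc_nat n) \<Longrightarrow> a \<in> {1, 2}" using set_enc_nat by blast
    ultimately show ?thesis by (simp add: takeWhile_append2)
  qed
  have "enc_nat n = enc_nat m" using t[OF assms(2), of n] t[OF assms(3), of m] assms(1) by simp
  then show ?thesis using enc_nat_inj assms(1) by auto
qed

lemma stops_lits: "stops_bits (lits_word C @ 5 # r)"
proof (cases C)
  case (Cons l C') then show ?thesis by (cases l) (auto simp: stops_bits_def)
qed (simp add: stops_bits_def)

lemma enc_lit_append_inj:
  assumes "enc_lit l @ r = enc_lit m @ s" "stops_bits r" "stops_bits s"
  shows "l = m \<and> r = s"
proof -
  have e: "enc_nat (var l) @ r = enc_nat (var m) @ s" and p: "pol l = pol m"
    using assms(1) by (cases l; cases m; simp)+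
  show ?thesis using enc_nat_append_inj[OF e assms(2,3)] p lit_eq_iff[of l m] by blast
qed

lemma lits_word_inj: "lits_word C @ 5 # r = lits_word D @ 5 # s \<Longrightarrow> C = D \<and> r = s"
proof (induction C arbitrary: D)
  case Nil
  then show ?case
  proof (cases D)
    case (Cons l D') then show ?thesis using Nil by (cases l) auto
  qed simp
next
  case (Cons l C)
  show ?case
  proof (cases D)
    case Nil then show ?thesis using Cons.prems by (cases l) auto
  next
    case D: (Cons m D')
    have "l = m \<and> lits_word C @ 5 # r = lits_word D' @ 5 # s"
      using Cons.prems D by (intro enc_lit_append_inj stops_lits) simp
    then show ?thesis using Cons.IH D by blast
  qed
qed

lemma clauses_word_inj: "clauses_word F @ 6 # r = clauses_word G @ 6 # s \<Longrightarrow> F = G \<and> r = s"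
proof -
  have h: "\<exists>a t. enc_clause C @ x = a # t \<and> a \<noteq> 6" for C x
  proof (cases C)
    case (Cons l C') then show ?thesis by (cases l) (auto simp: enc_folds)
  qed (simp add: enc_folds)
  show "clauses_word F @ 6 # r = clauses_word G @ 6 # s \<Longrightarrow> F = G \<and> r = s"
  proof (induction F arbitrary: G)
    case Nil
    then show ?case
    proof (cases G)
      case (Cons C G') then show ?thesis using Nil h[of C "clauses_word G' @ 6 # s"] by auto
    qed simp
  next
    case (Cons C F)
    show ?case
    proof (cases G)
      case Nil then show ?thesis using Cons.prems h[of C "clauses_word F @ 6 # r"] by auto
    next
      case G: (Cons D G')
      have "C = D \<and> clauses_word F @ 6 # r = clauses_word G' @ 6 # s"
        using Cons.prems G by (intro lits_word_inj) (simp add: enc_folds)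
      then show ?thesis using Cons.IH G by blast
    qed
  qed
qed

lemma enc_nat_not_6: "enc_nat v @ 5 # r \<noteq> 6 # s" "6 # s \<noteq> enc_nat v @ 5 # r"
  by (cases "v = 0"; simp add: enc_nat_pos)+

lemma names_word_inj: "names_word A @ 6 # r = names_word B @ 6 # s \<Longrightarrow> A = B \<and> r = s"
proof (induction A arbitrary: B)
  case Nil
  then show ?case
  proof (cases B)
    case (Cons v B')
    then show ?thesis using Nil by (simp add: enc_nat_not_6)
  qed simp
next
  case (Cons v A)
  show ?case
  proof (cases B)
    case Nil
    then show ?thesis using Cons.prems by (simp add: enc_nat_not_6)
  next
    case B: (Cons u B')
    have "v = u \<and> 5 # names_word A @ 6 # r = 5 # names_word B' @ 6 # s"
      using Cons.prems B by (intro enc_nat_append_inj) (simp_all add: stops_bits_def)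
    then show ?thesis using Cons.IH B by blast
  qed
qed

text \<open>A word belongs to \<open>OBV_lang\<close> if some reading of it is a positive instance;
  uniqueness of the reading is what lets membership of the output be traced back to the
  input.\<close>

lemma OBV_word_inj:
  assumes "enc_cnf F @ enc_vars B @ enc_nat x = enc_cnf G @ enc_vars A @ enc_nat y"
  shows "F = G \<and> B = A \<and> x = y"
  using assms clauses_word_inj[of F "names_word B @ 6 # enc_nat x" G "names_word A @ 6 # enc_nat y"]
    names_word_inj[of B "enc_nat x" A "enc_nat y"] enc_nat_inj[of x y]
  by (simp add: enc_folds)

lemma set_target_word: "0 \<notin> set (target_word F B k)"
  using set_clauses_word set_names_word set_enc_nat
  by (fastforce simp: target_word_def enc_folds)

theorem theorem6:
  shows "poly_many_one_reducible OTS_lang OBV_lang"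
proof -
  let ?W = "\<lambda>F B k. enc_cnf F @ enc_vars B @ 3 # enc_nat k"
  \<comment> \<open>The reduction is fixed only as a relation between word and output, and
    \<open>f\<close> is chosen from what the machine computes. Malformed words and negative bounds
    yield \<open>[]\<close>.\<close>
  let ?R = "\<lambda>w out. (\<exists>F B k. w = ?W F B k \<and> out = target_word F B k) \<or>
    ((\<nexists>F B k. w = ?W F B k) \<and> out = [])"
  let ?C = "200 + (length guard_word + 10)"
  let ?P = "\<lambda>w out. (\<exists>n \<le> ?C * (length w + 1) ^ 2. \<exists>ls rs.
      (estep prog Halt ^^ n) (Start, [], w) = (Halt, ls, rs) \<and> takeWhile (\<lambda>a. a \<noteq> 0) rs = out) \<and> ?R w out"
  have ex: "\<exists>out. ?P w out" if w: "w \<in> lists input_alphabet" for w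
  proof (cases "\<exists>F B k. w = ?W F B k")
    case True
    then obtain F B k where wk: "w = ?W F B k" by blast
    then obtain ls where "reaches (200 * (length w + 1) ^ 2) (Start, [], w) (Halt, ls, target_word F B k)"
      using run_on_instance by blast
    then have "reaches (?C * (length w + 1) ^ 2) (Start, [], w) (Halt, ls, target_word F B k)"
      by (rule reaches_mono) (simp add: add_mult_distrib)
    moreover have "takeWhile (\<lambda>a. a \<noteq> 0) (target_word F B k) = target_word F B k"
      unfolding takeWhile_eq_all_conv using set_target_word[of F B k] by (intro ballI notI) simp
    moreover have "?R w (target_word F B k)" using wk by blast
    ultimately show ?thesis unfolding reaches_def by (intro exI[of _ "target_word F B k"]) blast
  next
    case False
    then have "foldl scan S0 w \<noteq> K2" using scan_accepts_iff by blast
    moreover have "set w \<subseteq> {1..6}" using w by (auto simp: input_alphabet_def)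
    ultimately obtain ls where "reaches ((length guard_word + 10) * (length w + 1) ^ 2) (Start, [], w) (Halt, ls, [0])"
      using rejecting_run by blast
    then have "reaches (?C * (length w + 1) ^ 2) (Start, [], w) (Halt, ls, [0])"
      by (rule reaches_mono) (simp add: add_mult_distrib)
    moreover have "takeWhile (\<lambda>a. a \<noteq> (0::nat)) [0] = []" by simp
    moreover have "?R w []" using False by blast
    ultimately show ?thesis unfolding reaches_def by (intro exI[of _ "[]"]) blast
  qed
  obtain f where f: "\<And>w. w \<in> lists input_alphabet \<Longrightarrow> ?P w (f w)"
  proof -
    have "\<exists>f. \<forall>w\<in>lists input_alphabet. ?P w (f w)"
      by (rule bchoice) (rule ballI, rule ex)
    then show ?thesis using that by (elim exE) (rule that, erule (1) bspec)
  qed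
  have "poly_time_computable f"
    by (rule emitter_poly_time[OF finite_states _ _ _ _ prog_ok, of Start _ f])
      (use f in \<open>auto simp del: estep.simps\<close>)
  moreover have "w \<in> OTS_lang \<longleftrightarrow> f w \<in> OBV_lang" if w: "w \<in> lists input_alphabet" for w
  proof
    assume "w \<in> OTS_lang"
    then obtain F B k where F: "w = enc_cnf F @ enc_vars B @ enc_int k" "OTS (cnf_of F) (set B) k"
      unfolding OTS_lang_def by blast
    \<comment> \<open>Tree sizes are never negative, so rejecting every negative bound in the scan
      is sound.\<close>
    have k0: "0 \<le> k" using F(2) unfolding OTS_def by auto
    then have k: "k = int (nat k)" by simp
    have "w = ?W F B (nat k)" using F(1) k0 by (simp add: enc_int_def)
    then obtain F' B' k' where F': "w = ?W F' B' k'" "f w = target_word F' B' k'" using f[OF w] by blast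
    have "OBV (cnf_of (target_cnf F' k')) (set (target_vars B' k')) Xv"
    proof -
      have "F = F' \<and> B = B' \<and> nat k = k'"
        using \<open>w = ?W F B (nat k)\<close> F'(1)
          clauses_word_inj[of F "names_word B @ 6 # 3 # enc_nat (nat k)" F' "names_word B' @ 6 # 3 # enc_nat k'"]
          names_word_inj[of B "3 # enc_nat (nat k)" B' "3 # enc_nat k'"] enc_nat_inj
        by (simp add: enc_folds)
      then show ?thesis using OBV_target_iff_OTS F(2) k by metis
    qed
    then show "f w \<in> OBV_lang" unfolding F'(2) OBV_lang_def target_word_def by blast
  next
    assume "f w \<in> OBV_lang"
    then obtain G A y where G: "f w = enc_cnf G @ enc_vars A @ enc_nat y" "OBV (cnf_of G) (set A) y"
      unfolding OBV_lang_def by blast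
    \<comment> \<open>Every instance code contains the terminator 6, so \<open>[]\<close> lies
      outside \<open>OBV_lang\<close> and \<open>w\<close> must have been accepted.\<close>
    then have "f w \<noteq> []" by (simp add: enc_folds)
    then obtain F B k where F: "w = ?W F B k" "f w = target_word F B k" using f[OF w] by blast
    have "target_cnf F k = G \<and> target_vars B k = A \<and> Xv = y"
      using F(2) G(1) unfolding target_word_def by (intro OBV_word_inj) simp
    then have "OTS (cnf_of F) (set B) (int k)" using G(2) OBV_target_iff_OTS by blast
    moreover have "w = enc_cnf F @ enc_vars B @ enc_int (int k)" using F(1) by (simp add: enc_int_def)
    ultimately show "w \<in> OTS_lang" unfolding OTS_lang_def by blast
  qed
  ultimately show ?thesis unfolding poly_many_one_reducible_def by blast
qed

end
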